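(* Let $\Omega\subset\mathbb{R}^d$ be any open set, $p\in(1,\infty)$ and $\{s_n\}\subset[0,1]$ a sequence with $s_n\to\sigma\in[0,1]$. Then $\Lambda^{s_n,p}_0(\Omega)$ converges in the generalized sense of Mosco to $\Lambda^{\sigma,p}_0(\Omega)$, i.e. $\Lambda^{s_n,p}_0(\Omega)\xrightarrow{s_n-M}\Lambda^{\sigma,p}_0(\Omega)$ as $s_n\to\sigma$.
   Context: Fractional gradient. For $r\in(0,1)$ and $\varphi\in C_c^\infty(\mathbb{R}^d)$ let $I_r\varphi(x)=\frac{\mu_{d,1-r}}{d-r}\int_{\mathbb{R}^d}\frac{\varphi(y)}{|x-y|^{d-r}}\,dy$ be the Riesz potential, where $\mu_{d,s}=\frac{2^s\Gamma((d+s+1)/2)}{\pi^{d/2}\Gamma((1-s)/2)}$. For $s\in(0,1)$, $D^s\varphi=D(I_{1-s}\varphi)$, where $D$ is the classical gradient; $D^1=D$; and $D^0=-R$, where $R$ is the vector-valued Riesz transform, $R_j\varphi(x)=\frac{\Gamma((d+1)/2)}{\pi^{(d+1)/2}}\,\mathrm{p.v.}\!\int_{\mathbb{R}^d}\frac{x_j-y_j}{|x-y|^{d+1}}\varphi(y)\,dy$. For $\Phi\in C^\infty_c(\mathbb{R}^d;\mathbb{R}^d)$, $D^s\cdot\Phi=\sum_{j=1}^d (D^s\Phi_j)_j$. For $0\le s<1$ and $u\in L^p(\mathbb{R}^d)$, the weak $s$-fractional gradient $D^su$ is the function $\Gamma\in L^1_{\mathrm{loc}}(\mathbb{R}^d;\mathbb{R}^d)$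 (if it exists) such that $\int u\,D^s\cdot\Phi\,dx=-\int\Gamma\cdot\Phi\,dx$ for all $\Phi\in C_c^\infty(\mathbb{R}^d;\mathbb{R}^d)$. Spaces. $\Lambda^{s,p}(\mathbb{R}^d)=\{u\in L^p(\mathbb{R}^d): D^su\in L^p(\mathbb{R}^d;\mathbb{R}^d)\}$ with norm $(\|u\|^p_{L^p(\mathbb{R}^d)}+\|D^su\|^p_{L^p(\mathbb{R}^d;\mathbb{R}^d)})^{1/p}$; $\Lambda^{1,p}(\mathbb{R}^d)=W^{1,p}(\mathbb{R}^d)$ and $\Lambda^{0,p}(\mathbb{R}^d)=L^p(\mathbb{R}^d)$ with equivalent norms. For $\Omega$ open, $\Lambda^{s,p}_0(\Omega)$ is the closure of $C^\infty_c(\Omega)$ in $\Lambda^{s,p}(\mathbb{R}^d)$, with the same norm; its elements vanish a.e. outside $\Omega$; $\Lambda^{0,p}_0(\Omega)=L^p_0(\Omega)=\{u\in L^p(\mathbb{R}^d):u=0\text{ a.e. in }\mathbb{R}^d\setminus\Omega\}$. Generalized Mosco convergence. Let $\mathbb{L}^p(\Omega)=L^p_0(\Omega)\times L^p(\mathbb{R}^d;\mathbb{R}^d)$ and $\Pi_s:\Lambda^{s,p}_0(\Omega)\to\mathbb{L}^p(\Omega)$, $\Pi_s(u)=(u,D^su)$. For $s_n\to\sigma$ in $[0,1]$ and convex sets $K_n\subset\Lambda^{s_n,p}_0(\Omega)$, $K\subset\Lambda^{\sigma,p}_0(\Omega)$, $K_n\xrightarrow{s_n-M}K$ means: (M1)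 for every $u\in K$ there are $u_n\in K_n$ with $\Pi_{s_n}(u_n)\to\Pi_\sigma(u)$ in $\mathbb{L}^p(\Omega)$; (M2) if along some subsequence $n_k$ there are $u_{n_k}\in K_{n_k}$ and $u\in\Lambda^{\sigma,p}_0(\Omega)$ with $\Pi_{s_{n_k}}(u_{n_k})\rightharpoonup\Pi_\sigma(u)$ weakly in $\mathbb{L}^p(\Omega)$, then $u\in K$. *)

theory Defs
  imports "HOL-Analysis.Analysis"
begin

text \<open>Euclidean space \<open>\<real>\<^sup>d\<close> is a type \<open>'a::euclidean_space\<close> with \<open>d = DIM('a)\<close>; the \<open>j\<close>-th component
  of \<open>x\<close> is \<open>x \<bullet> b\<close> for the corresponding \<open>b \<in> Basis\<close>. Elements of function spaces are represented by
  Lebesgue measurable functions, not by classes modulo null sets; the spaces and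
  seminorms below are invariant under modification on a null set.\<close>

subsection \<open>Test functions\<close>

primrec C_k :: "nat \<Rightarrow> ('a::euclidean_space \<Rightarrow> 'b::real_normed_vector) \<Rightarrow> bool" where
  "C_k 0 f \<longleftrightarrow> continuous_on UNIV f"
| "C_k (Suc k) f \<longleftrightarrow>
     (\<forall>x. f differentiable (at x)) \<and> (\<forall>b\<in>Basis. C_k k (\<lambda>x. frechet_derivative f (at x) b))"

definition test_functions :: "'a::euclidean_space set \<Rightarrow> ('a \<Rightarrow> 'b::real_normed_vector) set" where
  "test_functions \<Omega> =
     {f. (\<forall>k. C_k k f) \<and> compact (closure {x. f x \<noteq> 0}) \<and> closure {x. f x \<noteq> 0} \<subseteq> \<Omega>}"

subsection \<open>The fractional gradient of test functions\<close>

definition \<mu> :: "nat \<Rightarrow> real \<Rightarrow> real" where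
  "\<mu> d s = 2 powr s * Gamma ((real d + s + 1) / 2) / (pi powr (real d / 2) * Gamma ((1 - s) / 2))"

definition riesz_potential :: "real \<Rightarrow> ('a::euclidean_space \<Rightarrow> real) \<Rightarrow> 'a \<Rightarrow> real" where
  "riesz_potential r \<phi> x =
     \<mu> DIM('a) (1 - r) / (real DIM('a) - r) *
     (\<integral>y. \<phi> y / norm (x - y) powr (real DIM('a) - r) \<partial>lebesgue)"

text \<open>The limit of the truncated integrals is the principal value.\<close>

definition riesz_transform :: "('a::euclidean_space \<Rightarrow> real) \<Rightarrow> 'a \<Rightarrow> 'a" where
  "riesz_transform \<phi> x =
     (\<Sum>b\<in>Basis. (Gamma ((real DIM('a) + 1) / 2) / pi powr ((real DIM('a) + 1) / 2) *
       Lim (at_right 0) (\<lambda>\<epsilon>. LINT y:{y. \<epsilon> < norm (x - y)}|lebesgue.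
         ((x - y) \<bullet> b) / norm (x - y) ^ (DIM('a) + 1) * \<phi> y)) *\<^sub>R b)"

definition gradient :: "('a::euclidean_space \<Rightarrow> real) \<Rightarrow> 'a \<Rightarrow> 'a" where
  "gradient f x = (THE D. GDERIV f x :> D)"

definition frac_grad_test :: "real \<Rightarrow> ('a::euclidean_space \<Rightarrow> real) \<Rightarrow> 'a \<Rightarrow> 'a" where
  "frac_grad_test s \<phi> =
     (if s = 0 then (\<lambda>x. - riesz_transform \<phi> x)
      else if s = 1 then gradient \<phi>
      else gradient (riesz_potential (1 - s) \<phi>))"

definition frac_div_test :: "real \<Rightarrow> ('a::euclidean_space \<Rightarrow> 'a) \<Rightarrow> 'a \<Rightarrow> real" where
  "frac_div_test s \<Phi> x = (\<Sum>b\<in>Basis. frac_grad_test s (\<lambda>z. \<Phi> z \<bullet> b) x \<bullet> b)"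

subsection \<open>Lebesgue spaces and the weak fractional gradient\<close>

definition Lp :: "real \<Rightarrow> ('a::euclidean_space \<Rightarrow> 'b::euclidean_space) set" where
  "Lp p = {u \<in> borel_measurable lebesgue. integrable lebesgue (\<lambda>x. norm (u x) powr p)}"

definition Lp_norm :: "real \<Rightarrow> ('a::euclidean_space \<Rightarrow> 'b::euclidean_space) \<Rightarrow> real" where
  "Lp_norm p u = (\<integral>x. norm (u x) powr p \<partial>lebesgue) powr (1 / p)"

definition Lp0 :: "real \<Rightarrow> 'a::euclidean_space set \<Rightarrow> ('a \<Rightarrow> real) set" where
  "Lp0 p \<Omega> = {u \<in> Lp p. AE x in lebesgue. x \<notin> \<Omega> \<longrightarrow> u x = 0}"

definition L1_loc :: "('a::euclidean_space \<Rightarrow> 'b::euclidean_space) set" where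
  "L1_loc = {G. \<forall>C. compact C \<longrightarrow> set_integrable lebesgue C G}"

text \<open>For \<open>s = 1\<close> this is the usual weak gradient.\<close>

definition has_frac_grad ::
  "real \<Rightarrow> ('a::euclidean_space \<Rightarrow> real) \<Rightarrow> ('a \<Rightarrow> 'a) \<Rightarrow> bool" where
  "has_frac_grad s u G \<longleftrightarrow> G \<in> L1_loc \<and>
     (\<forall>\<Phi>\<in>test_functions UNIV.
        (\<integral>x. u x * frac_div_test s \<Phi> x \<partial>lebesgue) = - (\<integral>x. G x \<bullet> \<Phi> x \<partial>lebesgue))"

text \<open>The weak gradient is unique only up to null sets, hence the choice operator.\<close>

definition frac_grad :: "real \<Rightarrow> ('a::euclidean_space \<Rightarrow> real) \<Rightarrow> 'a \<Rightarrow> 'a" where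
  "frac_grad s u = (SOME G. has_frac_grad s u G)"

subsection \<open>The spaces \<open>\<Lambda>\<^sup>s\<^sup>,\<^sup>p(\<real>\<^sup>d)\<close> and \<open>\<Lambda>\<^sup>s\<^sup>,\<^sup>p\<^sub>0(\<Omega>)\<close>\<close>

definition Lambda :: "real \<Rightarrow> real \<Rightarrow> ('a::euclidean_space \<Rightarrow> real) set" where
  "Lambda s p = {u \<in> Lp p. \<exists>G\<in>Lp p. has_frac_grad s u G}"

definition Lambda_norm :: "real \<Rightarrow> real \<Rightarrow> ('a::euclidean_space \<Rightarrow> real) \<Rightarrow> real" where
  "Lambda_norm s p u = (Lp_norm p u powr p + Lp_norm p (frac_grad s u) powr p) powr (1 / p)"

definition Lambda0 :: "real \<Rightarrow> real \<Rightarrow> 'a::euclidean_space set \<Rightarrow> ('a \<Rightarrow> real) set" where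
  "Lambda0 s p \<Omega> = {u \<in> Lambda s p.
     \<forall>\<epsilon>>0. \<exists>\<phi>\<in>test_functions \<Omega>. Lambda_norm s p (\<lambda>x. u x - \<phi> x) < \<epsilon>}"

subsection \<open>Convergence in \<open>L\<^sup>p\<^sub>0(\<Omega>) \<times> L\<^sup>p(\<real>\<^sup>d; \<real>\<^sup>d)\<close>\<close>

definition LL :: "real \<Rightarrow> 'a::euclidean_space set \<Rightarrow> (('a \<Rightarrow> real) \<times> ('a \<Rightarrow> 'a)) set" where
  "LL p \<Omega> = Lp0 p \<Omega> \<times> Lp p"

definition LL_norm :: "real \<Rightarrow> ('a::euclidean_space \<Rightarrow> real) \<times> ('a \<Rightarrow> 'a) \<Rightarrow> real" where
  "LL_norm p X = (Lp_norm p (fst X) powr p + Lp_norm p (snd X) powr p) powr (1 / p)"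

definition LL_tendsto :: "real \<Rightarrow> 'a::euclidean_space set \<Rightarrow>
    (nat \<Rightarrow> ('a \<Rightarrow> real) \<times> ('a \<Rightarrow> 'a)) \<Rightarrow> ('a \<Rightarrow> real) \<times> ('a \<Rightarrow> 'a) \<Rightarrow> bool" where
  "LL_tendsto p \<Omega> X Y \<longleftrightarrow> (\<forall>n. X n \<in> LL p \<Omega>) \<and> Y \<in> LL p \<Omega> \<and>
     (\<lambda>n. LL_norm p (\<lambda>x. fst (X n) x - fst Y x, \<lambda>x. snd (X n) x - snd Y x)) \<longlonglongrightarrow> 0"

text \<open>Boundedness with respect to the seminorm forces a functional to be constant on classes
  modulo null sets, so these are exactly the elements of the dual of the quotient space.\<close>

definition LL_dual :: "real \<Rightarrow> 'a::euclidean_space set \<Rightarrow>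
    (('a \<Rightarrow> real) \<times> ('a \<Rightarrow> 'a) \<Rightarrow> real) set" where
  "LL_dual p \<Omega> = {F.
     (\<forall>X\<in>LL p \<Omega>. \<forall>Y\<in>LL p \<Omega>.
        F (\<lambda>x. fst X x + fst Y x, \<lambda>x. snd X x + snd Y x) = F X + F Y) \<and>
     (\<forall>c. \<forall>X\<in>LL p \<Omega>. F (\<lambda>x. c * fst X x, \<lambda>x. c *\<^sub>R snd X x) = c * F X) \<and>
     (\<exists>C. \<forall>X\<in>LL p \<Omega>. \<bar>F X\<bar> \<le> C * LL_norm p X)}"

definition LL_weakly_tendsto :: "real \<Rightarrow> 'a::euclidean_space set \<Rightarrow>
    (nat \<Rightarrow> ('a \<Rightarrow> real) \<times> ('a \<Rightarrow> 'a)) \<Rightarrow> ('a \<Rightarrow> real) \<times> ('a \<Rightarrow> 'a) \<Rightarrow> bool" where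
  "LL_weakly_tendsto p \<Omega> X Y \<longleftrightarrow> (\<forall>n. X n \<in> LL p \<Omega>) \<and> Y \<in> LL p \<Omega> \<and>
     (\<forall>F\<in>LL_dual p \<Omega>. (\<lambda>n. F (X n)) \<longlonglongrightarrow> F Y)"

subsection \<open>Generalized Mosco convergence\<close>

definition Pi_s :: "real \<Rightarrow> ('a::euclidean_space \<Rightarrow> real) \<Rightarrow> ('a \<Rightarrow> real) \<times> ('a \<Rightarrow> 'a)" where
  "Pi_s s u = (u, frac_grad s u)"

text \<open>Meant for \<open>s \<longlonglongrightarrow> \<sigma>\<close> in \<open>{0..1}\<close> and convex sets \<open>K n \<subseteq> Lambda0 (s n) p \<Omega>\<close> and
  \<open>K' \<subseteq> Lambda0 \<sigma> p \<Omega>\<close>.\<close>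

definition mosco_converges :: "real \<Rightarrow> 'a::euclidean_space set \<Rightarrow> (nat \<Rightarrow> real) \<Rightarrow> real \<Rightarrow>
    (nat \<Rightarrow> ('a \<Rightarrow> real) set) \<Rightarrow> ('a \<Rightarrow> real) set \<Rightarrow> bool" where
  "mosco_converges p \<Omega> s \<sigma> K K' \<longleftrightarrow>
     (\<forall>u\<in>K'. \<exists>v. (\<forall>n. v n \<in> K n) \<and> LL_tendsto p \<Omega> (\<lambda>n. Pi_s (s n) (v n)) (Pi_s \<sigma> u)) \<and>
     (\<forall>r v. \<forall>u\<in>Lambda0 \<sigma> p \<Omega>. strict_mono r \<longrightarrow> (\<forall>k. v k \<in> K (r k)) \<longrightarrow>
        LL_weakly_tendsto p \<Omega> (\<lambda>k. Pi_s (s (r k)) (v k)) (Pi_s \<sigma> u) \<longrightarrow> u \<in> K')"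

end

theory Submission
  imports Defs
begin

text \<open>
  The second condition of Mosco convergence is immediate, because the limit set is the whole space
  \<open>Lambda0 \<sigma> p \<Omega>\<close>. The content is the existence of a recovery sequence. Test functions are dense in
  \<open>Lambda0 \<sigma> p \<Omega>\<close> by definition and belong to \<open>Lambda0 s p \<Omega>\<close> for every order \<open>s\<close>. By a diagonal argument
  (\<open>near_minimisers_tendsto_0\<close>) it therefore suffices that, for one fixed test function \<open>\<phi>\<close>, the fractional
  gradients \<open>D\<^sup>s \<phi>\<close> converge in \<open>L\<^sup>p\<close> to \<open>D\<^sup>\<sigma> \<phi>\<close> as \<open>s\<close> tends to \<open>\<sigma>\<close> (\<open>frac_grad_test_Lp_tendsto\<close>).

  For \<open>0 \<le> s < 1\<close> the fractional gradient is the absolutely convergent integral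
  \<open>\<mu> d s / 2 * (\<integral>h. (\<phi> (x + h) - \<phi> (x - h)) * h / norm h powr (d + 1 + s))\<close>. At \<open>s = 0\<close> this is the symmetrised
  principal value of the Riesz transform. For \<open>s > 0\<close> it results from moving the gradient through the Riesz potential
  onto \<open>\<phi>\<close> and integrating by parts (\<open>frac_grad_test_eq_singular\<close>). Since the integrand is of size
  \<open>norm h powr (1 - d - s)\<close> near the origin, dominated convergence gives pointwise convergence when \<open>\<sigma> < 1\<close>. When
  \<open>\<sigma> = 1\<close>, the constant \<open>\<mu> d s\<close> has a zero of first order that cancels the factor \<open>1 / (1 - s)\<close> in the integral of
  \<open>norm h powr (1 - d - s)\<close> over the unit ball, and the kernels of the Riesz potentials form an approximate identity
  (\<open>frac_grad_test_near_1\<close>). The same cancellation yields the bound \<open>C * (1 + norm x) powr - d\<close> for \<open>D\<^sup>s \<phi>\<close>, uniformly in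
  \<open>s\<close> (\<open>frac_grad_test_decay\<close>). Because \<open>p > 1\<close>, the \<open>p\<close>-th power of this bound is integrable, and pointwise
  convergence improves to convergence in \<open>L\<^sup>p\<close>.

  Two facts connect this with the weak gradients that define the spaces. The weak gradient is unique up to
  null sets, since smooth bumps approximate the indicators of boxes (\<open>has_frac_grad_unique\<close>). And the fractional
  gradient of a test function is a weak fractional gradient, since the kernel is odd
  (\<open>frac_grad_test_duality\<close>, \<open>has_frac_grad_test\<close>).
\<close>

section \<open>Closure properties of the classes of differentiable functions\<close>

lemma C_k_imp_continuous: "C_k k f \<Longrightarrow> continuous_on UNIV f"
  by (cases k) (auto intro: differentiable_imp_continuous_within continuous_at_imp_continuous_on)

lemma C_k_SucD: "C_k (Suc k) f \<Longrightarrow> C_k k f"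
proof (induction k arbitrary: f)
  case 0
  then show ?case by (auto intro: differentiable_imp_continuous_within continuous_at_imp_continuous_on)
next
  case (Suc k)
  then show ?case by auto
qed

lemma frechet_derivative_eqI:
  "(f has_derivative f') (at x) \<Longrightarrow> frechet_derivative f (at x) = f'"
  using frechet_derivative_at by metis

text \<open>Only derivatives along basis vectors enter the definition of \<open>C_k\<close>, so each closure property below is an
  induction on the order that computes one Frechet derivative and stays inside the class.\<close>

lemma C_k_bounded_linear:
  assumes "bounded_linear T"
  shows "C_k k f \<Longrightarrow> C_k k (\<lambda>x. T (f x))"
proof (induction k arbitrary: f)
  case 0
  then show ?case using assms by (simp add: bounded_linear.continuous_on)
next
  case (Suc k)
  have d: "((\<lambda>x. T (f x)) has_derivative (\<lambda>h. T (frechet_derivative f (at x) h))) (at x)" for x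
    using Suc.prems by (intro bounded_linear.has_derivative[OF assms]) (simp add: frechet_derivative_works)
  show ?case
    using Suc d by (auto simp: frechet_derivative_eqI[OF d] differentiable_def)
qed

lemma C_k_add: "C_k k f \<Longrightarrow> C_k k g \<Longrightarrow> C_k k (\<lambda>x. f x + g x)"
proof (induction k arbitrary: f g)
  case 0
  then show ?case by (simp add: continuous_on_add)
next
  case (Suc k)
  have d: "((\<lambda>x. f x + g x) has_derivative (\<lambda>h. frechet_derivative f (at x) h + frechet_derivative g (at x) h)) (at x)" for x
    using Suc.prems by (intro has_derivative_add) (simp_all add: frechet_derivative_works)
  show ?case
    using Suc d by (auto simp: frechet_derivative_eqI[OF d] differentiable_def)
qed

lemma C_k_mult:
  fixes f g :: "'a::euclidean_space \<Rightarrow> real"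
  shows "C_k k f \<Longrightarrow> C_k k g \<Longrightarrow> C_k k (\<lambda>x. f x * g x)"
proof (induction k arbitrary: f g)
  case 0
  then show ?case by (simp add: continuous_on_mult)
next
  case (Suc k)
  have d: "((\<lambda>x. f x * g x) has_derivative (\<lambda>h. f x * frechet_derivative g (at x) h + frechet_derivative f (at x) h * g x)) (at x)" for x
    using Suc.prems by (intro has_derivative_mult) (simp_all add: frechet_derivative_works)
  have "C_k k f" "C_k k g" using Suc.prems C_k_SucD by blast+
  then show ?case
    using Suc d by (auto simp: frechet_derivative_eqI[OF d] differentiable_def intro!: C_k_add)
qed

lemma C_k_const: "C_k k (\<lambda>x. c)"
proof (induction k arbitrary: c)
  case (Suc k)
  have d: "((\<lambda>x::'a. c) has_derivative (\<lambda>h. 0)) (at x)" for x by simp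
  show ?case using Suc d by (auto simp: frechet_derivative_eqI[OF d])
qed simp

lemma C_k_prod:
  fixes f :: "'i \<Rightarrow> 'a::euclidean_space \<Rightarrow> real"
  assumes "\<And>i. i \<in> I \<Longrightarrow> C_k k (f i)"
  shows "C_k k (\<lambda>x. \<Prod>i\<in>I. f i x)"
  using assms by (induction I rule: infinite_finite_induct) (auto intro: C_k_const C_k_mult)

lemma C_k_compose_affine:
  fixes f :: "real \<Rightarrow> real" and c :: "'a::euclidean_space"
  shows "C_k k f \<Longrightarrow> C_k k (\<lambda>x. f (x \<bullet> c + \<alpha>))"
proof (induction k arbitrary: f)
  case 0
  then show ?case 
    by (auto intro!: continuous_on_compose2[of UNIV f UNIV "\<lambda>x. x \<bullet> c + \<alpha>"] continuous_intros)
next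
  case (Suc k)
  have d: "((\<lambda>x. f (x \<bullet> c + \<alpha>)) has_derivative (\<lambda>h. frechet_derivative f (at (x \<bullet> c + \<alpha>)) (h \<bullet> c))) (at x)" for x
    using Suc.prems 
    by (intro has_derivative_compose[of "\<lambda>x. x \<bullet> c + \<alpha>" "\<lambda>h. h \<bullet> c" x UNIV f])
       (auto intro!: derivative_eq_intros simp: frechet_derivative_works)
  have e: "frechet_derivative f (at t) r = r * frechet_derivative f (at t) 1" for t r
  proof -
    have "linear (frechet_derivative f (at t))"
      using linear_frechet_derivative[of f "at t"] Suc.prems by simp
    from linear_scale[OF this, of r 1] show ?thesis by simp
  qed
  have "C_k k (\<lambda>x. frechet_derivative f (at (x \<bullet> c + \<alpha>)) (b \<bullet> c))" for b
    unfolding e[of _ "b \<bullet> c"] by (intro C_k_mult C_k_const Suc.IH) (use Suc.prems in simp)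
  then show ?case
    using d by (auto simp: frechet_derivative_eqI[OF d] differentiable_def)
qed

section \<open>Smooth bumps supported in boxes\<close>

text \<open>The functions \<open>P (1 / t) * exp (- 1 / t)\<close> on the positive half line, extended by zero. All polynomials \<open>P\<close>
  are admitted because the family is then closed under differentiation, which yields smoothness of every
  member by induction.\<close>

definition exp_cutoff :: "real poly \<Rightarrow> real \<Rightarrow> real" where
  "exp_cutoff P t = (if t > 0 then poly P (1 / t) * exp (- (1 / t)) else 0)"

lemma poly_mult_exp_tendsto_0: "((\<lambda>u::real. poly P u * exp (- u)) \<longlongrightarrow> 0) at_top"
proof -
  have "((\<lambda>u::real. \<Sum>i\<le>degree P. coeff P i * (u ^ i / exp u)) \<longlongrightarrow> (\<Sum>i\<le>degree P. coeff P i * 0)) at_top"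
    by (intro tendsto_intros tendsto_power_div_exp_0)
  then show ?thesis
    by (simp add: poly_altdef sum_distrib_right exp_minus divide_inverse mult.assoc)
qed

text \<open>With \<open>u = 1 / t\<close> the derivative of \<open>P u * exp (- u)\<close> in \<open>t\<close> is \<open>u\<^sup>2 * (P u - P' u) * exp (- u)\<close>. At the
  origin the difference quotient is \<open>u * P u * exp (- u)\<close>, which tends to zero as \<open>u\<close> tends to infinity.\<close>

lemma exp_cutoff_DERIV:
  "(exp_cutoff P has_real_derivative exp_cutoff (pCons 0 (pCons 0 (P - pderiv P))) t) (at t)"
proof -
  consider "t > 0" | "t < 0" | "t = 0" by linarith
  then show ?thesis
  proof cases
    case 1
    have "((\<lambda>t. poly P (1 / t) * exp (- (1 / t))) has_real_derivative exp_cutoff (pCons 0 (pCons 0 (P - pderiv P))) t) (at t)"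
      using 1 unfolding exp_cutoff_def
      by (auto intro!: derivative_eq_intros DERIV_chain2[OF poly_DERIV] simp: field_simps power2_eq_square)
    moreover have "\<forall>\<^sub>F x in nhds t. exp_cutoff P x = poly P (1 / x) * exp (- (1 / x))"
      using eventually_nhds_in_open[of "{0<..}" t] 1 by (auto simp: exp_cutoff_def elim: eventually_mono)
    ultimately show ?thesis by (subst DERIV_cong_ev) auto
  next
    case 2
    have "\<forall>\<^sub>F x in nhds t. exp_cutoff P x = 0"
      using eventually_nhds_in_open[of "{..<0}" t] 2 by (auto simp: exp_cutoff_def elim: eventually_mono)
    then have "(exp_cutoff P has_real_derivative 0) (at t)" by (subst DERIV_cong_ev) auto
    then show ?thesis using 2 by (simp add: exp_cutoff_def)
  next
    case 3
    have l: "((\<lambda>h. exp_cutoff P h / h) \<longlongrightarrow> 0) (at_left 0)"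
      by (rule tendsto_eventually) (auto simp: eventually_at_filter exp_cutoff_def)
    have "((\<lambda>h. poly (pCons 0 P) (inverse h) * exp (- inverse h)) \<longlongrightarrow> 0) (at_right (0::real))"
      by (rule filterlim_compose[OF poly_mult_exp_tendsto_0 filterlim_inverse_at_top_right])
    moreover have "\<forall>\<^sub>F h in at_right 0. poly (pCons 0 P) (inverse h) * exp (- inverse h) = exp_cutoff P h / h"
      by (auto simp: eventually_at_filter exp_cutoff_def divide_inverse)
    ultimately have r: "((\<lambda>h. exp_cutoff P h / h) \<longlongrightarrow> 0) (at_right 0)"
      by (rule Lim_transform_eventually)
    from l r have "((\<lambda>h. exp_cutoff P h / h) \<longlongrightarrow> 0) (at 0)"
      by (simp add: filterlim_split_at)
    then show ?thesis using 3 by (simp add: DERIV_def exp_cutoff_def)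
  qed
qed

lemma C_k_exp_cutoff: "C_k k (exp_cutoff P)"
proof (induction k arbitrary: P)
  case 0
  show ?case using exp_cutoff_DERIV by (auto intro!: continuous_at_imp_continuous_on DERIV_isCont)
next
  case (Suc k)
  have d: "(exp_cutoff P has_derivative (\<lambda>h. exp_cutoff (pCons 0 (pCons 0 (P - pderiv P))) t * h)) (at t)" for t
    using exp_cutoff_DERIV[of P t] by (simp add: has_field_derivative_def)
  show ?case
    using Suc d by (auto simp: frechet_derivative_eqI[OF d] differentiable_def)
qed

definition smooth_step :: "real \<Rightarrow> real" where
  "smooth_step = exp_cutoff 1"

lemma smooth_step_simps:
  "t \<le> 0 \<Longrightarrow> smooth_step t = 0" "0 \<le> smooth_step t" "smooth_step t \<le> 1"
  by (auto simp: smooth_step_def exp_cutoff_def)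

text \<open>A smooth step that never reaches the value one is enough: bumps are only needed as a bounded sequence that
  converges pointwise to the indicator of a box, and rescaling the argument provides it.\<close>

lemma smooth_step_tendsto_1: "0 < t \<Longrightarrow> (\<lambda>n. smooth_step (real n * t)) \<longlonglongrightarrow> 1"
proof -
  assume t: "0 < t"
  have "(\<lambda>n. exp (- (1 / t * (1 / real n)))) \<longlonglongrightarrow> exp (- (1 / t * 0))"
    by (intro tendsto_intros lim_1_over_n)
  moreover have "\<forall>\<^sub>F n in sequentially. exp (- (1 / t * (1 / real n))) = smooth_step (real n * t)"
    using eventually_gt_at_top[of 0] 
    by eventually_elim (use t in \<open>auto simp: smooth_step_def exp_cutoff_def mult.commute\<close>)
  ultimately show ?thesis by (auto intro: Lim_transform_eventually)
qed

definition box_bump :: "'a::euclidean_space \<Rightarrow> 'a \<Rightarrow> nat \<Rightarrow> 'a \<Rightarrow> real" where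
  "box_bump l u n x =
     (\<Prod>b\<in>Basis. smooth_step (real n * (x \<bullet> b - l \<bullet> b)) * smooth_step (real n * (u \<bullet> b - x \<bullet> b)))"

lemma C_k_box_bump: "C_k k (box_bump l u n)"
proof -
  have e: "box_bump l u n = (\<lambda>x. \<Prod>b\<in>Basis. smooth_step (x \<bullet> (real n *\<^sub>R b) + (- real n * (l \<bullet> b))) 
      * smooth_step (x \<bullet> (- real n *\<^sub>R b) + real n * (u \<bullet> b)))"
    by (auto simp: box_bump_def algebra_simps)
  show ?thesis
    unfolding e by (intro C_k_prod C_k_mult C_k_compose_affine) (auto simp: smooth_step_def C_k_exp_cutoff)
qed

lemma box_bump_eq_0: "x \<notin> box l u \<Longrightarrow> box_bump l u n x = 0"
  by (force simp: box_bump_def box_def not_less smooth_step_simps mult_nonneg_nonpos)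

lemma box_bump_bounds: "0 \<le> box_bump l u n x" "box_bump l u n x \<le> 1"
  by (auto simp: box_bump_def smooth_step_simps intro!: prod_nonneg prod_le_1 mult_le_one)

lemma box_bump_tendsto: "(\<lambda>n. box_bump l u n x) \<longlonglongrightarrow> indicator (box l u) x"
proof (cases "x \<in> box l u")
  case True
  have "(\<lambda>n. box_bump l u n x) \<longlonglongrightarrow> (\<Prod>b\<in>(Basis::'a set). 1 * 1)"
    unfolding box_bump_def using True
    by (intro tendsto_prod tendsto_mult smooth_step_tendsto_1) (auto simp: box_def)
  then show ?thesis using True by simp
qed (simp add: box_bump_eq_0)

lemma box_bump_test: "(\<lambda>x. box_bump l u n x *\<^sub>R v) \<in> test_functions UNIV"
proof -
  have "{x. box_bump l u n x *\<^sub>R v \<noteq> 0} \<subseteq> cbox l u"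
    using box_bump_eq_0[of _ l u n] box_subset_cbox[of l u] by auto
  then have "closure {x. box_bump l u n x *\<^sub>R v \<noteq> 0} \<subseteq> cbox l u"
    by (rule closure_minimal) (rule closed_cbox)
  then have "compact (closure {x. box_bump l u n x *\<^sub>R v \<noteq> 0})"
    by (meson bounded_cbox bounded_subset closed_closure compact_eq_bounded_closed)
  then show ?thesis
    unfolding test_functions_def 
    using C_k_bounded_linear[OF bounded_linear_scaleR_left C_k_box_bump] by auto
qed

section \<open>Uniqueness of weak fractional gradients\<close>

text \<open>Boxes form a generator of the Borel sets that is stable under intersection, so the integrals over all Borel sets vanish by
  Dynkin's argument. The integral over the whole space, which complements need, is the limit of integrals
  over growing boxes.\<close>

lemma integral_box_0_imp_AE_0:
  fixes f :: "'a::euclidean_space \<Rightarrow> real"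
  assumes f: "integrable lebesgue f" and box: "\<And>l u. (LINT x:box l u|lebesgue. f x) = 0"
  shows "AE x in lebesgue. f x = 0"
proof -
  obtain g where g[measurable]: "g \<in> borel_measurable lborel" and fg: "AE x in lborel. f x = g x"
    using completion_ex_borel_measurable_real[of f lborel] f by auto
  have fg': "AE x in lebesgue. f x = g x" using fg by (rule AE_completion)
  have gi': "integrable lebesgue g" 
    by (rule integrable_cong_AE_imp[OF f]) (use fg' in \<open>auto simp: measurable_completion eq_commute\<close>)
  then have gi: "integrable lborel g" by (simp add: integrable_completion)
  have gbox: "(LINT x:box l u|lborel. g x) = 0" for l u
  proof -
    have "(LINT x:box l u|lborel. g x) = (LINT x:box l u|lebesgue. g x)"
      unfolding set_lebesgue_integral_def by (subst integral_completion) auto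
    also have "\<dots> = (LINT x:box l u|lebesgue. f x)"
      unfolding set_lebesgue_integral_def 
      by (rule integral_cong_AE) (use fg' f in \<open>auto simp: measurable_completion intro!: borel_measurable_times borel_measurable_indicator\<close>)
    finally show ?thesis using box by simp
  qed
  have univ: "(LINT x|lborel. g x) = 0"
  proof -
    have "(\<lambda>n. LINT x:box (- real n *\<^sub>R One) (real n *\<^sub>R One)|lborel. g x) \<longlonglongrightarrow> (LINT x|lborel. g x)"
      unfolding set_lebesgue_integral_def
    proof (rule integral_dominated_convergence[where w="\<lambda>x. norm (g x)"])
      show "AE x in lborel. (\<lambda>i. indicat_real (box (- real i *\<^sub>R One) (real i *\<^sub>R One)) x *\<^sub>R g x) \<longlonglongrightarrow> g x"
      proof (rule AE_I2)
        fix x :: 'a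
        obtain N where N: "norm x < real N" using reals_Archimedean2 by blast
        have "x \<in> box (- real n *\<^sub>R One) (real n *\<^sub>R One)" if "n \<ge> N" for n
        proof -
          have "\<bar>x \<bullet> b\<bar> < real n" if "b \<in> Basis" for b
            using Basis_le_norm[OF that, of x] N \<open>n \<ge> N\<close> by linarith
          then show ?thesis by (auto simp: box_def abs_less_iff minus_less_iff)
        qed
        then show "(\<lambda>i. indicat_real (box (- real i *\<^sub>R One) (real i *\<^sub>R One)) x *\<^sub>R g x) \<longlonglongrightarrow> g x"
          by (intro tendsto_eventually) (auto simp: eventually_sequentially intro!: exI[of _ N])
      qed
    qed (use gi in \<open>auto simp: indicator_def\<close>)
    then show ?thesis using gbox by (simp add: LIMSEQ_unique)
  qed
  have "AE x in lborel. g x = 0"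
  proof (rule sigma_finite_measure.density_zero[OF sigma_finite_lborel gi])
    fix A :: "'a set" assume A: "A \<in> sets lborel"
    let ?E = "range (\<lambda>(l::'a,u). box l u)"
    have gA: "set_integrable lborel B g" if "B \<in> sets lborel" for B
      unfolding set_integrable_def using integrable_mult_indicator[OF that gi] .
    have "Int_stable ?E"
      by (auto simp: Int_stable_def box_Int_box)
    moreover have "?E \<subseteq> Pow UNIV" by simp
    moreover have "A \<in> sigma_sets UNIV ?E"
      using A by (simp add: borel_eq_box sets_measure_of)
    ultimately show "(LINT x:A|lborel. g x) = 0"
    proof (induct rule: sigma_sets_induct_disjoint)
      case (basic A)
      then show ?case using gbox by auto
    next
      case empty
      then show ?case by (simp add: set_lebesgue_integral_def)
    next
      case (compl A)
      have A: "A \<in> sets lborel" using compl(1) by (simp add: borel_eq_box sets_measure_of)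
      have "(LINT x|lborel. g x) = (LINT x:A|lborel. g x) + (LINT x:UNIV - A|lborel. g x)"
        using set_integral_Un[of A "UNIV - A" lborel g] gA A by (simp add: set_lebesgue_integral_def)
      then show ?case using compl univ by simp
    next
      case (union B)
      have B: "B i \<in> sets lborel" for i using union(2) by (auto simp: borel_eq_box sets_measure_of)
      show ?case 
        using lebesgue_integral_countable_add[of B lborel g] B gA union(1,3)
        by (auto simp: disjoint_family_on_def)
    qed
  qed
  then have "AE x in lebesgue. g x = 0" by (rule AE_completion)
  with fg' show ?thesis by eventually_elim simp
qed


lemma L1_loc_inner_integrable:
  assumes "G \<in> L1_loc" "compact C"
  shows "integrable lebesgue (\<lambda>x. indicator C x * (G x \<bullet> b))"
proof -
  have "integrable lebesgue (\<lambda>x. indicat_real C x *\<^sub>R G x)"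
    using assms by (simp add: L1_loc_def set_integrable_def)
  from integrable_inner_left[of b lebesgue "\<lambda>x. indicat_real C x *\<^sub>R G x"] this
  show ?thesis by simp
qed

lemma L1_loc_bump_tendsto:
  assumes G: "G \<in> L1_loc"
  shows "(\<lambda>n. \<integral>x. G x \<bullet> (box_bump l u n x *\<^sub>R b) \<partial>lebesgue) \<longlonglongrightarrow> (LINT x:box l u|lebesgue. G x \<bullet> b)"
  unfolding set_lebesgue_integral_def
proof (rule integral_dominated_convergence)
  have i: "integrable lebesgue (\<lambda>x. indicat_real (cbox l u) x * (G x \<bullet> b))"
    by (rule L1_loc_inner_integrable[OF G compact_cbox])
  then show "integrable lebesgue (\<lambda>x. norm (indicat_real (cbox l u) x * (G x \<bullet> b)))" by simp
  have e1: "(\<lambda>x. indicator (box l u) x *\<^sub>R (G x \<bullet> b)) = (\<lambda>x. indicator (box l u) x * (indicat_real (cbox l u) x * (G x \<bullet> b)))"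
    using box_subset_cbox[of l u] by (auto simp: indicator_def fun_eq_iff)
  show "(\<lambda>x. indicator (box l u) x *\<^sub>R (G x \<bullet> b)) \<in> borel_measurable lebesgue"
    unfolding e1 by (intro borel_measurable_times borel_measurable_integrable[OF i] borel_measurable_indicator) simp
  have e2: "(\<lambda>x. G x \<bullet> (box_bump l u n x *\<^sub>R b)) = (\<lambda>x. box_bump l u n x * (indicat_real (cbox l u) x * (G x \<bullet> b)))" for n
    using box_subset_cbox[of l u] box_bump_eq_0[of _ l u n] by (auto simp: indicator_def fun_eq_iff)
  have "box_bump l u n \<in> borel_measurable borel" for n
    by (rule borel_measurable_continuous_onI) (rule C_k_imp_continuous[OF C_k_box_bump])
  then have "box_bump l u n \<in> borel_measurable lebesgue" for n
    by (simp add: measurable_completion)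
  then show "(\<lambda>x. G x \<bullet> (box_bump l u n x *\<^sub>R b)) \<in> borel_measurable lebesgue" for n
    unfolding e2 by (intro borel_measurable_times borel_measurable_integrable[OF i])
  show "AE x in lebesgue. (\<lambda>n. G x \<bullet> (box_bump l u n x *\<^sub>R b)) \<longlonglongrightarrow> indicator (box l u) x *\<^sub>R (G x \<bullet> b)"
    using box_bump_tendsto[of l u] by (auto intro!: tendsto_intros)
  show "AE x in lebesgue. norm (G x \<bullet> (box_bump l u n x *\<^sub>R b)) \<le> norm (indicat_real (cbox l u) x * (G x \<bullet> b))" for n
    unfolding fun_cong[OF e2] norm_mult
    by (intro AE_I2 mult_left_le_one_le) (simp_all add: box_bump_bounds)
qed

text \<open>Testing with bumps times basis vectors and letting the bumps tend to the indicator of a box shows that all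
  components have the same integrals over all boxes. Truncation to a large box makes the difference
  integrable; intersections of boxes are boxes, so the truncated difference still has vanishing box integrals.\<close>

lemma L1_loc_eq_if_test_integrals_eq:
  fixes G H :: "'a::euclidean_space \<Rightarrow> 'a"
  assumes G: "G \<in> L1_loc" and H: "H \<in> L1_loc"
    and eq: "\<And>\<Phi>. \<Phi> \<in> test_functions UNIV \<Longrightarrow> (\<integral>x. G x \<bullet> \<Phi> x \<partial>lebesgue) = (\<integral>x. H x \<bullet> \<Phi> x \<partial>lebesgue)"
  shows "AE x in lebesgue. G x = H x"
proof -
  have box_eq: "(LINT x:box l u|lebesgue. G x \<bullet> b) = (LINT x:box l u|lebesgue. H x \<bullet> b)" for l u b
    using LIMSEQ_unique[OF L1_loc_bump_tendsto[OF G, of l u b]] L1_loc_bump_tendsto[OF H, of l u b]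
    by (simp only: eq[OF box_bump_test])
  define Q where "Q N = box (- real N *\<^sub>R One) (real N *\<^sub>R One :: 'a)" for N
  have i: "set_integrable lebesgue (box l u) (\<lambda>x. K x \<bullet> b)" if "K \<in> L1_loc" for K :: "'a \<Rightarrow> 'a" and l u b
  proof -
    have "set_integrable lebesgue (cbox l u) (\<lambda>x. K x \<bullet> b)"
      using L1_loc_inner_integrable[OF that compact_cbox] by (simp add: set_integrable_def)
    then show ?thesis by (rule set_integrable_subset) (auto simp: box_subset_cbox)
  qed
  have "AE x in lebesgue. indicator (Q N) x * (G x \<bullet> b - H x \<bullet> b) = 0" for N b
  proof (rule integral_box_0_imp_AE_0)
    show "integrable lebesgue (\<lambda>x. indicat_real (Q N) x * (G x \<bullet> b - H x \<bullet> b))"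
      using set_integral_diff(1)[OF i[OF G] i[OF H]] by (simp add: Q_def set_integrable_def)
    fix l u
    obtain l' u' where b: "box l u \<inter> Q N = box l' u'" unfolding Q_def box_Int_box by blast
    have "(LINT x:box l u|lebesgue. indicat_real (Q N) x * (G x \<bullet> b - H x \<bullet> b)) =
       (LINT x:box l' u'|lebesgue. G x \<bullet> b - H x \<bullet> b)"
      unfolding set_lebesgue_integral_def b[symmetric] by (simp add: indicator_inter_arith mult.assoc)
    also have "\<dots> = 0"
      using set_integral_diff(2)[OF i[OF G] i[OF H]] box_eq by simp
    finally show "(LINT x:box l u|lebesgue. indicat_real (Q N) x * (G x \<bullet> b - H x \<bullet> b)) = 0" .
  qed
  then have "AE x in lebesgue. \<forall>N. \<forall>b\<in>Basis. indicator (Q N) x * (G x \<bullet> b - H x \<bullet> b) = 0"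
    by (intro AE_all_countable[THEN iffD2] allI AE_finite_allI finite_Basis)
  then show ?thesis
  proof eventually_elim
    fix x assume *: "\<forall>N. \<forall>b\<in>Basis. indicator (Q N) x * (G x \<bullet> b - H x \<bullet> b) = (0::real)"
    obtain N where N: "norm x < real N" using reals_Archimedean2 by blast
    have "\<bar>x \<bullet> b\<bar> < real N" if "b \<in> Basis" for b
      using Basis_le_norm[OF that, of x] N by linarith
    then have "x \<in> Q N" by (auto simp: Q_def box_def abs_less_iff minus_less_iff)
    then have "G x \<bullet> b = H x \<bullet> b" if "b \<in> Basis" for b
      using bspec[OF spec[OF *, of N] that] by simp
    then show "G x = H x" by (rule euclidean_eqI)
  qed
qed

text \<open>This determines the chosen representative \<open>frac_grad s u\<close> up to null sets, so that every concrete formula for a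
  weak gradient may be used in its place.\<close>

lemma has_frac_grad_unique:
  assumes "has_frac_grad s u G" "has_frac_grad s u H"
  shows "AE x in lebesgue. G x = H x"
proof (rule L1_loc_eq_if_test_integrals_eq)
  fix \<Phi> :: "'a \<Rightarrow> 'a" assume "\<Phi> \<in> test_functions UNIV"
  with assms show "(\<integral>x. G x \<bullet> \<Phi> x \<partial>lebesgue) = (\<integral>x. H x \<bullet> \<Phi> x \<partial>lebesgue)"
    by (simp add: has_frac_grad_def)
qed (use assms in \<open>auto simp: has_frac_grad_def\<close>)

section \<open>Integrals of powers of the norm\<close>

text \<open>Fubini replaces integration in polar coordinates: every radial function that decreases to zero is an integral of
  indicators of balls, and the volume of a ball is known.\<close>

lemma nn_integral_norm_layer_cake:
  fixes w :: "real \<Rightarrow> real"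
  assumes [measurable]: "w \<in> borel_measurable borel"
  shows "(\<integral>\<^sup>+x. (\<integral>\<^sup>+t. ennreal (w t) * indicator {norm x..} t \<partial>lborel) \<partial>(lborel :: 'a::euclidean_space measure)) =
    (\<integral>\<^sup>+t. ennreal (w t) * ennreal (unit_ball_vol DIM('a) * t ^ DIM('a)) * indicator {0..} t \<partial>lborel)"
proof -
  have [measurable]: "Measurable.pred (borel \<Otimes>\<^sub>M borel) (\<lambda>(x::'a, t). t \<in> {norm x..})"
    unfolding atLeast_iff by measurable
  have "(\<integral>\<^sup>+x. (\<integral>\<^sup>+t. ennreal (w t) * indicator {norm x..} t \<partial>lborel) \<partial>(lborel :: 'a measure)) =
    (\<integral>\<^sup>+t. (\<integral>\<^sup>+x. ennreal (w t) * indicator {norm x..} t \<partial>(lborel :: 'a measure)) \<partial>lborel)"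
    by (rule lborel_pair.Fubini') measurable
  also have "\<dots> = (\<integral>\<^sup>+t. ennreal (w t) * ennreal (unit_ball_vol DIM('a) * t ^ DIM('a)) * indicator {0..} t \<partial>lborel)"
  proof (rule nn_integral_cong)
    fix t :: real
    have "(\<integral>\<^sup>+x. ennreal (w t) * indicator {norm x..} t \<partial>(lborel :: 'a measure)) = 
      (\<integral>\<^sup>+x. ennreal (w t) * indicator (cball 0 t) x \<partial>(lborel :: 'a measure))"
      by (intro nn_integral_cong) (auto simp: indicator_def)
    also have "\<dots> = ennreal (w t) * emeasure lborel (cball (0::'a) t)"
      by (rule nn_integral_cmult_indicator) simp
    also have "\<dots> = ennreal (w t) * ennreal (unit_ball_vol DIM('a) * t ^ DIM('a)) * indicator {0..} t"
      by (cases "t \<ge> 0") (auto simp: emeasure_cball indicator_def)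
    finally show "(\<integral>\<^sup>+x. ennreal (w t) * indicator {norm x..} t \<partial>(lborel :: 'a measure)) = 
      ennreal (w t) * ennreal (unit_ball_vol DIM('a) * t ^ DIM('a)) * indicator {0..} t" .
  qed
  finally show ?thesis .
qed

text \<open>The exact value matters, since it has to cancel the zero of \<open>\<mu> d s\<close> at \<open>s = 1\<close>. For \<open>norm x < 1\<close> one writes
  \<open>norm x powr - a - 1\<close> as the integral of \<open>a * t powr (- a - 1)\<close> over \<open>t\<close> between \<open>norm x\<close> and \<open>1\<close>.\<close>

lemma has_integral_norm_powr_ball:
  fixes a :: real
  assumes "0 \<le> a" "a < DIM('a::euclidean_space)"
  shows "has_bochner_integral lborel (\<lambda>x::'a. indicator (ball 0 1) x * norm x powr - a)
    (DIM('a) * unit_ball_vol DIM('a) / (DIM('a) - a))"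
proof -
  let ?d = "DIM('a)" and ?V = "unit_ball_vol DIM('a)"
  have [measurable]: "cball (0::'a) 1 \<in> sets borel" "ball (0::'a) 1 \<in> sets borel" by simp_all
  \<comment> \<open>minus the derivative of \<open>t powr - a\<close>, cut off at \<open>1\<close>\<close>
  define w where "w t = indicator {..1} t * (a * t powr (- a - 1))" for t :: real
  have [measurable]: "w \<in> borel_measurable borel" unfolding w_def by measurable
  have inner: "(\<integral>\<^sup>+t. ennreal (w t) * indicator {norm x..} t \<partial>lborel) = ennreal ((norm x powr - a - 1) * indicator (cball 0 1) x)"
    if "x \<noteq> 0" for x :: 'a
  proof (cases "norm x \<le> 1")
    case True
    have "(\<integral>\<^sup>+t. ennreal (w t) * indicator {norm x..} t \<partial>lborel) =
       (\<integral>\<^sup>+t. ennreal (a * t powr (- a - 1)) * indicator {norm x..1} t \<partial>lborel)"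
      by (intro nn_integral_cong) (auto simp: indicator_def w_def)
    also have "\<dots> = ennreal (- (1 powr - a) - (- (norm x powr - a)))"
    proof (rule nn_integral_FTC_Icc)
      fix t assume t: "t \<in> {norm x..1}"
      have "0 < norm x" using that by simp
      then have "0 < t" using t unfolding atLeastAtMost_iff by linarith
      show "((\<lambda>t. - (t powr - a)) has_real_derivative a * t powr (- a - 1)) (at t)"
        using \<open>0 < t\<close> by (auto intro!: derivative_eq_intros)
      show "0 \<le> a * t powr (- a - 1)" using assms by simp
    qed (use True in auto)
    finally show ?thesis using True by simp
  next
    case False
    then have z: "ennreal (w t) * indicator {norm x..} t = 0" for t
      by (auto simp: w_def indicator_def)
    show ?thesis unfolding z using False by simp
  qed
  have "(\<integral>\<^sup>+x. ennreal ((norm x powr - a - 1) * indicator (cball 0 1) x) \<partial>(lborel :: 'a measure)) 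
     = (\<integral>\<^sup>+x. (\<integral>\<^sup>+t. ennreal (w t) * indicator {norm x..} t \<partial>lborel) \<partial>(lborel :: 'a measure))"
    by (intro nn_integral_cong_AE) (use AE_lborel_singleton[of "0::'a"] inner in \<open>auto elim: eventually_mono\<close>)
  also have "\<dots> = (\<integral>\<^sup>+t. ennreal (w t) * ennreal (?V * t ^ ?d) * indicator {0..} t \<partial>lborel)"
    by (rule nn_integral_norm_layer_cake) measurable
  also have "\<dots> = (\<integral>\<^sup>+t. ennreal (a * ?V) * (ennreal (t powr (?d - a - 1)) * indicator {0..1} t) \<partial>lborel)"
  proof (intro nn_integral_cong)
    fix t :: real
    show "ennreal (w t) * ennreal (?V * t ^ ?d) * indicator {0..} t = ennreal (a * ?V) * (ennreal (t powr (?d - a - 1)) * indicator {0..1} t)"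
    proof (cases "0 < t")
      case True
      then have "a * t powr (- a - 1) * (?V * t ^ ?d) = a * ?V * t powr (?d - a - 1)"
        by (simp add: powr_realpow[symmetric] powr_add[symmetric] algebra_simps)
      then show ?thesis using True assms 
        by (auto simp: w_def indicator_def ennreal_mult[symmetric])
    qed (auto simp: w_def indicator_def)
  qed
  also have "\<dots> = ennreal (a * ?V) * ennreal (1 powr (?d - a - 1 + 1) / (?d - a - 1 + 1))"
    using assms
    by (subst nn_integral_cmult) 
       (auto intro!: arg_cong2[where f="(*)"] nn_integral_has_integral_lebesgue' simp del: diff_add_cancel
          intro: has_integral_powr_from_0[of "?d - a - 1" 1, simplified])
  also have "\<dots> = ennreal (a * ?V / (?d - a))"
    using assms by (simp add: ennreal_mult[symmetric])
  finally have I: "(\<integral>\<^sup>+x. ennreal ((norm x powr - a - 1) * indicator (cball 0 1) x) \<partial>(lborel :: 'a measure)) = ennreal (a * ?V / (?d - a))" .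
  have ge1: "1 \<le> norm x powr - a" if "x \<noteq> 0" "norm x \<le> 1" for x :: 'a
    using powr_mono2'[of "-a" "norm x" 1] that assms by simp
  have nul: "AE x in lborel. x \<notin> sphere (0::'a) 1"
    using negligible_sphere[of "0::'a" 1] 
    by (intro AE_not_in) (simp add: negligible_iff_null_sets null_sets_completion_iff)
  have "(\<integral>\<^sup>+x. ennreal (indicator (ball 0 1) x * norm x powr - a) \<partial>(lborel :: 'a measure)) =
     (\<integral>\<^sup>+x. ennreal ((norm x powr - a - 1) * indicator (cball 0 1) x) + indicator (cball 0 1) x \<partial>(lborel :: 'a measure))"
  proof (rule nn_integral_cong_AE)
    show "AE x in lborel. ennreal (indicator (ball 0 1) x * norm x powr - a) = 
       ennreal ((norm x powr - a - 1) * indicator (cball 0 1) (x::'a)) + indicator (cball 0 1) x"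
      using AE_lborel_singleton[of "0::'a"] nul
    proof eventually_elim
      fix x :: 'a assume "x \<noteq> 0" "x \<notin> sphere 0 1"
      then show "ennreal (indicator (ball 0 1) x * norm x powr - a) = 
         ennreal ((norm x powr - a - 1) * indicator (cball 0 1) (x::'a)) + indicator (cball 0 1) x"
        using ge1[of x] ennreal_plus[of "norm x powr - a - 1" 1] by (auto simp: indicator_def simp del: ennreal_plus)
    qed
  qed
  also have "\<dots> = ennreal (a * ?V / (?d - a)) + ennreal ?V"
  proof (subst nn_integral_add)
    show "(\<lambda>x::'a. ennreal ((norm x powr - a - 1) * indicat_real (cball 0 1) x)) \<in> borel_measurable lborel"
      by measurable
    show "indicator (cball (0::'a) 1) \<in> borel_measurable lborel" by measurable
  qed (simp_all add: I emeasure_cball)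
  also have "\<dots> = ennreal (a * ?V / (?d - a) + ?V)"
    using assms by (simp add: ennreal_plus[symmetric] del: ennreal_plus)
  also have "a * ?V / (?d - a) + ?V = ?d * ?V / (?d - a)"
    using assms by (simp add: field_simps)
  finally have "(\<integral>\<^sup>+x. ennreal (indicator (ball 0 1) x * norm x powr - a) \<partial>(lborel :: 'a measure)) = ennreal (?d * ?V / (?d - a))" .
  moreover have "(\<lambda>x::'a. indicat_real (ball 0 1) x * norm x powr - a) \<in> borel_measurable lborel" by measurable
  ultimately show ?thesis using assms by (intro has_bochner_integral_nn_integral) auto
qed

text \<open>The layer cake formula for \<open>(1 + t) powr - b\<close>, where the volume factor \<open>t ^ d\<close> is estimated by \<open>(1 + t) ^ d\<close>.\<close>

lemma integrable_one_plus_norm_powr: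
  fixes b :: real
  assumes "b > DIM('a::euclidean_space)"
  shows "integrable lborel (\<lambda>x::'a. (1 + norm x) powr - b)"
proof (rule integrableI_nonneg)
  let ?d = "DIM('a)" and ?V = "unit_ball_vol DIM('a)"
  \<comment> \<open>minus the derivative of \<open>(1 + t) powr - b\<close>\<close>
  define w where "w t = b * (1 + t) powr (- b - 1)" for t :: real
  have bpos: "b > 0" using assms by linarith
  have [measurable]: "w \<in> borel_measurable borel" unfolding w_def by measurable
  have inner: "(\<integral>\<^sup>+t. ennreal (w t) * indicator {norm x..} t \<partial>lborel) = ennreal ((1 + norm x) powr - b)" for x :: 'a
  proof -
    have "(\<integral>\<^sup>+t. ennreal (w t) * indicator {norm x..} t \<partial>lborel) = ennreal (0 - (- ((1 + norm x) powr - b)))"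
    proof (rule nn_integral_FTC_atLeast)
      fix t assume t: "norm x \<le> t"
      then have "0 \<le> t" using norm_ge_zero[of x] by linarith
      then show "((\<lambda>t. - ((1 + t) powr - b)) has_real_derivative w t) (at t)"
        by (auto intro!: derivative_eq_intros simp: w_def)
      show "0 \<le> w t" using bpos by (simp add: w_def)
    next
      have "((\<lambda>t. - ((1 + t) powr - b)) \<longlongrightarrow> - 0) at_top"
        using bpos by (intro tendsto_minus tendsto_neg_powr filterlim_tendsto_add_at_top[OF tendsto_const] filterlim_ident) auto
      then show "((\<lambda>t. - ((1 + t) powr - b)) \<longlongrightarrow> 0) at_top" by simp
    qed auto
    then show ?thesis by simp
  qed
  have "(\<integral>\<^sup>+x. ennreal ((1 + norm x) powr - b) \<partial>(lborel :: 'a measure)) =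
     (\<integral>\<^sup>+t. ennreal (w t) * ennreal (?V * t ^ ?d) * indicator {0..} t \<partial>lborel)"
    unfolding inner[symmetric] by (rule nn_integral_norm_layer_cake) measurable
  also have "\<dots> \<le> (\<integral>\<^sup>+t. ennreal (b * ?V * (1 + t) powr (?d - b - 1)) * indicator {0..} t \<partial>lborel)"
  proof (rule nn_integral_mono)
    fix t :: real
    show "ennreal (w t) * ennreal (?V * t ^ ?d) * indicator {0..} t \<le> ennreal (b * ?V * (1 + t) powr (?d - b - 1)) * indicator {0..} t"
    proof (cases "0 \<le> t")
      case True
      have "w t * (?V * t ^ ?d) \<le> w t * (?V * (1 + t) ^ ?d)"
        using True bpos by (intro mult_left_mono power_mono) (auto simp: w_def)
      also have "\<dots> = b * ?V * (1 + t) powr (?d - b - 1)"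
        using True by (simp add: w_def powr_realpow[symmetric] powr_add[symmetric] algebra_simps)
      finally show ?thesis using True bpos by (simp add: ennreal_mult[symmetric] w_def ennreal_leI)
    qed auto
  qed
  also have "\<dots> = ennreal (0 - b * ?V / (?d - b) * (1 + 0) powr (?d - b))"
  proof (rule nn_integral_FTC_atLeast)
    fix t :: real assume t: "0 \<le> t"
    then show "((\<lambda>t. b * ?V / (?d - b) * (1 + t) powr (?d - b)) has_real_derivative b * ?V * (1 + t) powr (?d - b - 1)) (at t)"
      using assms by (auto intro!: derivative_eq_intros)
    show "0 \<le> b * ?V * (1 + t) powr (?d - b - 1)" using bpos by simp
  next
    have "((\<lambda>t. b * ?V / (?d - b) * (1 + t) powr (?d - b)) \<longlongrightarrow> b * ?V / (?d - b) * 0) at_top"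
      using assms by (intro tendsto_mult tendsto_const tendsto_neg_powr filterlim_tendsto_add_at_top[OF tendsto_const] filterlim_ident) auto
    then show "((\<lambda>t. b * ?V / (?d - b) * (1 + t) powr (?d - b)) \<longlongrightarrow> 0) at_top" by simp
  qed auto
  also have "\<dots> < \<infinity>" by simp
  finally show "(\<integral>\<^sup>+x. ennreal ((1 + norm x) powr - b) \<partial>(lborel :: 'a measure)) < \<infinity>" .
qed auto

section \<open>Gradients of test functions\<close>

lemma gradient_eqI:
  assumes "GDERIV f x :> D"
  shows "gradient f x = D"
  unfolding gradient_def
proof (rule the_equality)
  show "GDERIV f x :> D" by fact
next
  fix E assume "GDERIV f x :> E"
  then have "(\<lambda>h. h \<bullet> E) = (\<lambda>h. h \<bullet> D)"
    using assms unfolding gderiv_def by (rule has_derivative_unique)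
  then have "b \<bullet> E = b \<bullet> D" for b by metis
  then show "E = D" using iffD1[OF vector_eq_ldot[of E D]] by auto
qed

lemma GDERIV_gradient:
  assumes "f differentiable (at x)"
  shows "GDERIV f x :> gradient f x"
proof -
  let ?f' = "frechet_derivative f (at x)"
  have d: "(f has_derivative ?f') (at x)" using assms by (simp add: frechet_derivative_works)
  then have "linear ?f'" by (rule has_derivative_linear)
  have "?f' h = h \<bullet> (\<Sum>b\<in>Basis. ?f' b *\<^sub>R b)" for h
  proof -
    have "?f' h = ?f' (\<Sum>b\<in>Basis. (h \<bullet> b) *\<^sub>R b)" by (simp add: euclidean_representation)
    also have "\<dots> = (\<Sum>b\<in>Basis. (h \<bullet> b) * ?f' b)"
      using \<open>linear ?f'\<close> by (simp add: linear_sum linear_scale)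
    finally show ?thesis by (simp add: inner_sum_right mult.commute)
  qed
  then have "?f' = (\<lambda>h. h \<bullet> (\<Sum>b\<in>Basis. ?f' b *\<^sub>R b))" by (rule ext)
  with d have "GDERIV f x :> (\<Sum>b\<in>Basis. ?f' b *\<^sub>R b)" unfolding gderiv_def by (rule back_subst)
  then show ?thesis using gradient_eqI by metis
qed

lemma frechet_derivative_gradient:
  "f differentiable (at x) \<Longrightarrow> frechet_derivative f (at x) h = h \<bullet> gradient f x"
  using GDERIV_gradient[of f x] unfolding gderiv_def by (simp add: frechet_derivative_eqI)

lemma test_functionD:
  assumes "\<phi> \<in> test_functions \<Omega>"
  shows "C_k k \<phi>" "continuous_on UNIV \<phi>" "\<phi> differentiable (at x)" "compact (closure {x. \<phi> x \<noteq> 0})"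
    "\<phi> \<in> test_functions UNIV"
proof -
  show "C_k k \<phi>" for k using assms by (simp add: test_functions_def)
  from this[of 1] show "\<phi> differentiable (at x)" by simp
  show "continuous_on UNIV \<phi>" using \<open>C_k k \<phi>\<close> by (rule C_k_imp_continuous)
  show "compact (closure {x. \<phi> x \<noteq> 0})" "\<phi> \<in> test_functions UNIV"
    using assms by (simp_all add: test_functions_def)
qed

lemma test_function_support:
  assumes "\<phi> \<in> test_functions \<Omega>"
  obtains R where "1 \<le> R" "\<And>x. R < norm x \<Longrightarrow> \<phi> x = 0"
proof -
  have "bounded {x. \<phi> x \<noteq> 0}"
    using test_functionD(4)[OF assms] compact_imp_bounded bounded_subset closure_subset by metis
  then obtain B where "\<And>x. \<phi> x \<noteq> 0 \<Longrightarrow> norm x \<le> B" by (auto simp: bounded_iff)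
  then show thesis by (intro that[of "max 1 B"]) force+
qed

lemma test_function_bounded:
  assumes "\<phi> \<in> test_functions \<Omega>"
  obtains M where "0 \<le> M" "\<And>x. norm (\<phi> x) \<le> M"
proof -
  have "bounded (\<phi> ` closure {x. \<phi> x \<noteq> 0})"
    by (intro compact_imp_bounded compact_continuous_image test_functionD(4)[OF assms]
        continuous_on_subset[OF test_functionD(2)[OF assms]]) simp
  then obtain B where B: "\<And>x. x \<in> closure {x. \<phi> x \<noteq> 0} \<Longrightarrow> norm (\<phi> x) \<le> B" by (auto simp: bounded_iff)
  have "norm (\<phi> x) \<le> max 0 B" for x
    using B[of x] closure_subset[of "{x. \<phi> x \<noteq> 0}"] by (cases "\<phi> x = 0") auto
  then show thesis by (intro that[of "max 0 B"]) auto
qed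

text \<open>Near a point outside the support the function is constant, so differentiation does not enlarge the support.
  Hence boundedness and Lipschitz estimates for a test function transfer to its gradient.\<close>

lemma test_function_gradient_component:
  assumes \<phi>: "\<phi> \<in> test_functions \<Omega>" and b: "b \<in> Basis"
  shows "(\<lambda>x. gradient \<phi> x \<bullet> b) \<in> test_functions \<Omega>"
proof -
  let ?S = "closure {x. \<phi> x \<noteq> 0}"
  have e: "(\<lambda>x. gradient \<phi> x \<bullet> b) = (\<lambda>x. frechet_derivative \<phi> (at x) b)"
    by (simp add: frechet_derivative_gradient[OF test_functionD(3)[OF \<phi>]] inner_commute)
  have "C_k k (\<lambda>x. gradient \<phi> x \<bullet> b)" for k
    using test_functionD(1)[OF \<phi>, of "Suc k"] b by (simp add: e)
  moreover have "{x. gradient \<phi> x \<bullet> b \<noteq> 0} \<subseteq> ?S"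
  proof (rule ccontr)
    assume "\<not> ?thesis"
    then obtain x where x: "gradient \<phi> x \<bullet> b \<noteq> 0" "x \<in> - ?S" by auto
    have "open (- ?S)" by auto
    moreover have "0 = \<phi> y" if "y \<in> - ?S" for y using that closure_subset[of "{x. \<phi> x \<noteq> 0}"] by auto
    moreover have "((\<lambda>x. 0) has_derivative (\<lambda>h. 0)) (at x)" by simp
    ultimately have "(\<phi> has_derivative (\<lambda>h. 0)) (at x)" 
      using x(2) has_derivative_transform_within_open[of "\<lambda>x. 0" "\<lambda>h. 0" x UNIV "- ?S" \<phi>] by blast
    then show False using x(1) gradient_eqI[of \<phi> x 0] by (simp add: gderiv_def)
  qed
  then have "closure {x. gradient \<phi> x \<bullet> b \<noteq> 0} \<subseteq> ?S" by (rule closure_minimal) simp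
  moreover from this have "compact (closure {x. gradient \<phi> x \<bullet> b \<noteq> 0})"
    using test_functionD(4)[OF \<phi>] by (meson bounded_subset closed_closure compact_eq_bounded_closed)
  ultimately show ?thesis using \<phi> by (auto simp: test_functions_def)
qed

lemma norm_le_components:
  assumes "\<And>b. b \<in> Basis \<Longrightarrow> \<bar>v \<bullet> b\<bar> \<le> K b"
  shows "norm (v::'a::euclidean_space) \<le> (\<Sum>b\<in>Basis. K b)"
  using norm_le_l1[of v] sum_mono[of Basis "\<lambda>b. \<bar>v \<bullet> b\<bar>" K] assms by force

lemma test_function_gradient_bounded:
  assumes "\<phi> \<in> test_functions \<Omega>"
  obtains M where "0 \<le> M" "\<And>x. norm (gradient \<phi> x) \<le> M"
proof -
  have "\<exists>M. \<forall>x. \<bar>gradient \<phi> x \<bullet> b\<bar> \<le> M" if "b \<in> Basis" for b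
    by (rule test_function_bounded[OF test_function_gradient_component[OF assms that]]) auto
  then obtain M where M: "\<And>b x. b \<in> Basis \<Longrightarrow> \<bar>gradient \<phi> x \<bullet> b\<bar> \<le> M b" by metis
  have "norm (gradient \<phi> x) \<le> (\<Sum>b\<in>Basis. M b)" for x by (intro norm_le_components M)
  moreover from this[of 0] have "0 \<le> (\<Sum>b\<in>Basis. M b)" using norm_ge_zero order_trans by blast
  ultimately show thesis by (intro that) auto
qed

lemma test_function_lipschitz:
  assumes "\<phi> \<in> test_functions \<Omega>"
  obtains L where "0 \<le> L" "\<And>x y. \<bar>\<phi> x - \<phi> y\<bar> \<le> L * norm (x - y)"
proof -
  obtain M where M: "0 \<le> M" "\<And>x. norm (gradient \<phi> x) \<le> M" by (rule test_function_gradient_bounded[OF assms]) blast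
  have "norm (\<phi> x - \<phi> y) \<le> M * norm (x - y)" for x y
  proof (rule differentiable_bound[of UNIV])
    show "(\<phi> has_derivative (\<lambda>h. h \<bullet> gradient \<phi> x)) (at x within UNIV)" for x
      using GDERIV_gradient[OF test_functionD(3)[OF assms]] by (simp add: gderiv_def)
    show "onorm (\<lambda>h. h \<bullet> gradient \<phi> x) \<le> M" for x
      using M(2)[of x] by (intro onorm_bound M(1)) (metis Cauchy_Schwarz_ineq2 mult.commute mult_left_mono norm_ge_zero order_trans real_norm_def)
  qed auto
  then show thesis using M(1) by (intro that) auto
qed

lemma test_function_gradient_lipschitz:
  assumes "\<phi> \<in> test_functions \<Omega>"
  obtains L where "0 \<le> L" "\<And>x y. norm (gradient \<phi> x - gradient \<phi> y) \<le> L * norm (x - y)"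
proof -
  have "\<exists>L. 0 \<le> L \<and> (\<forall>x y. \<bar>(gradient \<phi> x - gradient \<phi> y) \<bullet> b\<bar> \<le> L * norm (x - y))" if "b \<in> Basis" for b
    by (rule test_function_lipschitz[OF test_function_gradient_component[OF assms that]]) (auto simp: inner_diff_left)
  then obtain L where L: "\<And>b. b \<in> Basis \<Longrightarrow> 0 \<le> L b" 
    "\<And>b x y. b \<in> Basis \<Longrightarrow> \<bar>(gradient \<phi> x - gradient \<phi> y) \<bullet> b\<bar> \<le> L b * norm (x - y)" by metis
  have "norm (gradient \<phi> x - gradient \<phi> y) \<le> (\<Sum>b\<in>Basis. L b) * norm (x - y)" for x y
    unfolding sum_distrib_right by (intro norm_le_components L)
  then show thesis using L(1) by (intro that[of "\<Sum>b\<in>Basis. L b"]) (auto intro: sum_nonneg)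
qed

text \<open>The quadratic remainder is what makes differentiation under the integral sign possible against a weight that is
  merely integrable near the origin.\<close>

lemma test_function_taylor:
  fixes \<phi> :: "'a::euclidean_space \<Rightarrow> real"
  assumes \<phi>: "\<phi> \<in> test_functions \<Omega>" 
    and L: "0 \<le> L" "\<And>x y. norm (gradient \<phi> x - gradient \<phi> y) \<le> L * norm (x - y)"
  shows "\<bar>\<phi> (x + k) - \<phi> x - k \<bullet> gradient \<phi> x\<bar> \<le> L * (norm k)\<^sup>2"
proof -
  have "norm (\<phi> (x + k) - \<phi> x - (\<lambda>h. h \<bullet> gradient \<phi> x) (x + k - x)) \<le> norm (x + k - x) * (L * norm k)"
  proof (rule differentiable_bound_linearization[where S="cball x (norm k)" and f' = "\<lambda>x h. h \<bullet> gradient \<phi> x"])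
    fix t :: real assume "t \<in> {0..1}"
    then show "x + t *\<^sub>R (x + k - x) \<in> cball x (norm k)"
      by (auto simp: dist_norm mult_left_le_one_le)
  next
    fix y assume "y \<in> cball x (norm k)"
    then have *: "norm (gradient \<phi> y - gradient \<phi> x) \<le> L * norm k"
      using L(2)[of y x] L(1) by (simp add: dist_norm norm_minus_commute) (meson mult_left_mono order_trans)
    show "(\<phi> has_derivative (\<lambda>h. h \<bullet> gradient \<phi> y)) (at y within cball x (norm k))"
      using GDERIV_gradient[OF test_functionD(3)[OF \<phi>]] by (simp add: gderiv_def has_derivative_at_withinI)
    have "\<bar>h \<bullet> gradient \<phi> y - h \<bullet> gradient \<phi> x\<bar> \<le> L * norm k * norm h" for h
      using Cauchy_Schwarz_ineq2[of h "gradient \<phi> y - gradient \<phi> x"] mult_left_mono[OF *, of "norm h"]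
      by (simp add: inner_diff_right mult.commute)
    then show "onorm ((\<lambda>h. h \<bullet> gradient \<phi> y) - (\<lambda>h. h \<bullet> gradient \<phi> x)) \<le> L * norm k"
      using L(1) by (intro onorm_bound) auto
  qed auto
  then show ?thesis by (simp add: power2_eq_square mult_ac)
qed

text \<open>A test function together with one constant \<open>M\<close> for all estimates of order zero, one and two, and a radius \<open>R\<close> for
  its support. Fixing them once makes visible that later bounds are uniform in the order \<open>s\<close>.\<close>

locale bounded_test_function =
  fixes \<phi> :: "'a::euclidean_space \<Rightarrow> real" and R M :: real
  assumes test: "\<phi> \<in> test_functions UNIV"
    and R1: "1 \<le> R" and M0: "0 \<le> M"
    and outside: "R < norm x \<Longrightarrow> \<phi> x = 0"
    and grad_outside: "R < norm x \<Longrightarrow> gradient \<phi> x = 0"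
    and bound: "\<bar>\<phi> x\<bar> \<le> M"
    and grad_bound: "norm (gradient \<phi> x) \<le> M"
    and lipschitz: "\<bar>\<phi> x - \<phi> y\<bar> \<le> M * norm (x - y)"
    and grad_lipschitz: "norm (gradient \<phi> x - gradient \<phi> y) \<le> M * norm (x - y)"

lemma test_function_bounds:
  fixes \<phi> :: "'a::euclidean_space \<Rightarrow> real"
  assumes \<phi>: "\<phi> \<in> test_functions \<Omega>"
  obtains R M where "bounded_test_function \<phi> R M"
proof -
  obtain R where R: "1 \<le> R" "\<And>x. R < norm x \<Longrightarrow> \<phi> x = 0" by (rule test_function_support[OF \<phi>]) blast
  obtain M1 where M1: "0 \<le> M1" "\<And>x. norm (\<phi> x) \<le> M1" by (rule test_function_bounded[OF \<phi>]) blast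
  obtain M2 where M2: "0 \<le> M2" "\<And>x. norm (gradient \<phi> x) \<le> M2" by (rule test_function_gradient_bounded[OF \<phi>]) blast
  obtain M3 where M3: "0 \<le> M3" "\<And>x y. \<bar>\<phi> x - \<phi> y\<bar> \<le> M3 * norm (x - y)" by (rule test_function_lipschitz[OF \<phi>]) blast
  obtain M4 where M4: "0 \<le> M4" "\<And>x y. norm (gradient \<phi> x - gradient \<phi> y) \<le> M4 * norm (x - y)" 
    by (rule test_function_gradient_lipschitz[OF \<phi>]) blast
  define M where "M = M1 + M2 + M3 + M4"
  have le: "M1 \<le> M" "M2 \<le> M" "M3 \<le> M" "M4 \<le> M" "0 \<le> M" using M1 M2 M3 M4 by (auto simp: M_def)
  have "gradient \<phi> x = 0" if "R < norm x" for x
  proof -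
    have "open {x::'a. R < norm x}" by (intro open_Collect_less continuous_intros)
    then have "(\<phi> has_derivative (\<lambda>h. 0)) (at x)" 
      using that R(2) has_derivative_transform_within_open[of "\<lambda>x. 0" "\<lambda>h. 0" x UNIV "{x. R < norm x}" \<phi>] by auto
    then show ?thesis by (intro gradient_eqI) (simp add: gderiv_def)
  qed
  moreover have "\<bar>\<phi> x\<bar> \<le> M" "norm (gradient \<phi> x) \<le> M" for x
    using M1(2)[of x] M2(2)[of x] le by auto
  moreover have "\<bar>\<phi> x - \<phi> y\<bar> \<le> M * norm (x - y)" "norm (gradient \<phi> x - gradient \<phi> y) \<le> M * norm (x - y)" for x y
    using M3(2)[of x y] M4(2)[of x y] mult_right_mono[OF le(3) norm_ge_zero] mult_right_mono[OF le(4) norm_ge_zero]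
    by (meson order_trans)+
  ultimately have "bounded_test_function \<phi> R M"
    using R le(5) test_functionD(5)[OF \<phi>] by unfold_locales auto
  then show thesis by (rule that)
qed

section \<open>Weakly singular integrals and integration by parts\<close>

lemma lborel_distr_reflect: "distr lborel borel (\<lambda>h::'a::euclidean_space. x - h) = lborel"
  using lborel_affine[of "-1" x] by (simp add: density_1)

lemma lborel_distr_translate: "distr lborel borel (\<lambda>h::'a::euclidean_space. x + h) = lborel"
  using lborel_affine[of 1 x] by (simp add: density_1)

lemma
  fixes f :: "'a::euclidean_space \<Rightarrow> 'b::{banach, second_countable_topology}"
  assumes [measurable]: "f \<in> borel_measurable borel"
  shows lborel_integral_translate: "(\<integral>h. f (x + h) \<partial>lborel) = (\<integral>h. f h \<partial>lborel)"
    and lborel_integral_reflect: "(\<integral>h. f (x - h) \<partial>lborel) = (\<integral>h. f h \<partial>lborel)"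
    and lborel_integrable_translate: "integrable lborel (\<lambda>h. f (x + h)) \<longleftrightarrow> integrable lborel f"
    and lborel_integrable_reflect: "integrable lborel (\<lambda>h. f (x - h)) \<longleftrightarrow> integrable lborel f"
proof -
  show "(\<integral>h. f (x + h) \<partial>lborel) = (\<integral>h. f h \<partial>lborel)"
    using integral_distr[of "\<lambda>h. x + h" lborel borel f] by (simp add: lborel_distr_translate)
  show "(\<integral>h. f (x - h) \<partial>lborel) = (\<integral>h. f h \<partial>lborel)"
    using integral_distr[of "\<lambda>h. x - h" lborel borel f] by (simp add: lborel_distr_reflect)
  show "integrable lborel (\<lambda>h. f (x + h)) \<longleftrightarrow> integrable lborel f"
    using integrable_distr_eq[of "\<lambda>h. x + h" lborel borel f] by (simp add: lborel_distr_translate)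
  show "integrable lborel (\<lambda>h. f (x - h)) \<longleftrightarrow> integrable lborel f"
    using integrable_distr_eq[of "\<lambda>h. x - h" lborel borel f] by (simp add: lborel_distr_reflect)
qed

lemma integrable_bounded_support:
  fixes g :: "'a::euclidean_space \<Rightarrow> 'b::{banach, second_countable_topology}"
  assumes [measurable]: "g \<in> borel_measurable borel" and "\<And>x. norm (g x) \<le> K" "\<And>x. R < norm x \<Longrightarrow> g x = 0"
  shows "integrable lborel g"
proof (rule Bochner_Integration.integrable_bound)
  show "integrable lborel (\<lambda>x. K * indicator (cball (0::'a) R) x)"
    by (intro integrable_mult_right integrable_real_indicator) (use emeasure_bounded_finite[OF bounded_cball] in auto)
  show "AE x in lborel. norm (g x) \<le> norm (K * indicator (cball 0 R) x)"
  proof (rule AE_I2)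
    fix x show "norm (g x) \<le> norm (K * indicator (cball 0 R) x)"
      using assms(2)[of x] assms(3)[of x] by (cases "norm x \<le> R") (auto simp: indicator_def)
  qed
qed simp

lemma integrable_norm_powr_times:
  fixes g :: "'a::euclidean_space \<Rightarrow> 'b::{banach, second_countable_topology}" and a :: real
  assumes g[measurable]: "g \<in> borel_measurable borel" and K: "\<And>x. norm (g x) \<le> K" and R: "\<And>x. R < norm x \<Longrightarrow> g x = 0"
    and a: "0 \<le> a" "a < DIM('a)"
  shows "integrable lborel (\<lambda>h. norm h powr - a *\<^sub>R g (x + h))"
proof (rule Bochner_Integration.integrable_bound)
  have "integrable lborel g" by (rule integrable_bounded_support[OF g K R])
  then have "integrable lborel (\<lambda>h. norm (g (x + h)))"
    by (subst lborel_integrable_translate[of "\<lambda>h. norm (g h)"]) auto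
  then show "integrable lborel (\<lambda>h::'a. K * (indicator (ball 0 1) h * norm h powr - a) + norm (g (x + h)))"
    using has_integral_norm_powr_ball[OF a] by (intro Bochner_Integration.integrable_add integrable_mult_right) (auto simp: has_bochner_integral_iff)
  show "AE h in lborel. norm (norm h powr - a *\<^sub>R g (x + h)) \<le> norm (K * (indicator (ball 0 1) h * norm h powr - a) + norm (g (x + h)))"
  proof (rule AE_I2)
    fix h :: 'a
    have K0: "0 \<le> K" using K[of 0] norm_ge_zero order_trans by blast
    show "norm (norm h powr - a *\<^sub>R g (x + h)) \<le> norm (K * (indicator (ball 0 1) h * norm h powr - a) + norm (g (x + h)))"
    proof (cases "norm h < 1")
      case True
      then show ?thesis using mult_left_mono[OF K[of "x + h"], of "norm h powr - a"] K0 by (simp add: mult.commute add_increasing2)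
    next
      case False
      then have "norm h powr - a \<le> 1" using powr_mono2'[of "-a" 1 "norm h"] a by simp
      then show ?thesis using False by (simp add: mult_left_le_one_le)
    qed
  qed
qed measurable

text \<open>By translation invariance the difference quotients of a compactly supported function have integral zero. They
  converge boundedly to the derivative, all supported in one ball, so its integral is zero as well. Applied
  to products this is integration by parts.\<close>

lemma integral_directional_derivative_0:
  fixes F :: "'a::euclidean_space \<Rightarrow> real"
  assumes d: "\<And>x. (F has_derivative F' x) (at x)" and c: "continuous_on UNIV (\<lambda>x. F' x b)"
    and R: "\<And>x. R < norm x \<Longrightarrow> F x = 0"
  shows "(\<integral>x. F' x b \<partial>lborel) = 0"
proof -
  have F'0: "F' x b = 0" if "R < norm x" for x
  proof -
    have "open {x::'a. R < norm x}" by (intro open_Collect_less continuous_intros)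
    then have "(F has_derivative (\<lambda>h. 0)) (at x)" 
      using that R has_derivative_transform_within_open[of "\<lambda>x. 0" "\<lambda>h. 0" x UNIV "{x. R < norm x}" F] by auto
    then show ?thesis using has_derivative_unique[OF d] by metis
  qed
  have cF: "continuous_on UNIV F"
    using d by (meson continuous_at_imp_continuous_on has_derivative_continuous)
  obtain K where K: "\<And>x. \<bar>F' x b\<bar> \<le> K" "0 \<le> K"
  proof -
    have "compact ((\<lambda>x. F' x b) ` cball 0 R)"
      by (intro compact_continuous_image continuous_on_subset[OF c]) auto
    then have "bounded ((\<lambda>x. F' x b) ` cball 0 R)" by (rule compact_imp_bounded)
    then obtain B where B: "\<And>x. norm x \<le> R \<Longrightarrow> \<bar>F' x b\<bar> \<le> B" by (fastforce simp: bounded_iff)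
    have "\<bar>F' x b\<bar> \<le> max 0 B" for x
      using B[of x] F'0[of x] by (cases "norm x \<le> R") auto
    then show thesis by (intro that[of "max 0 B"]) auto
  qed
  have dd: "((\<lambda>t. F (x + t *\<^sub>R b)) has_real_derivative F' (x + t *\<^sub>R b) b) (at t)" for x t
  proof -
    have "((\<lambda>t. F (x + t *\<^sub>R b)) has_derivative (\<lambda>h. F' (x + t *\<^sub>R b) (h *\<^sub>R b))) (at t)"
      by (rule has_derivative_compose[OF _ d]) (auto intro!: derivative_eq_intros)
    moreover have "(\<lambda>h. F' (x + t *\<^sub>R b) (h *\<^sub>R b)) = (*) (F' (x + t *\<^sub>R b) b)"
      by (simp add: fun_eq_iff linear_scale[OF has_derivative_linear[OF d]])
    ultimately show ?thesis by (simp add: has_field_derivative_def)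
  qed
  define e where "e n = inverse (real (Suc n))" for n
  have e: "0 < e n" "e n \<le> 1" "e \<longlonglongrightarrow> 0" for n 
    using LIMSEQ_inverse_real_of_nat by (simp_all add: e_def[abs_def] inverse_le_1_iff)
  define S where "S n x = (F (x + e n *\<^sub>R b) - F x) / e n" for n x
  have mF[measurable]: "F \<in> borel_measurable borel" using cF by (rule borel_measurable_continuous_onI)
  have [measurable]: "(\<lambda>x. F' x b) \<in> borel_measurable borel" using c by (rule borel_measurable_continuous_onI)
  have "(\<lambda>n. \<integral>x. S n x \<partial>lborel) \<longlonglongrightarrow> (\<integral>x. F' x b \<partial>lborel)"
  proof (rule integral_dominated_convergence[where w="\<lambda>x. K * indicator (cball (0::'a) (R + norm b)) x"])
    show "integrable lborel (\<lambda>x. K * indicator (cball (0::'a) (R + norm b)) x)"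
      by (intro integrable_mult_right integrable_real_indicator) (use emeasure_bounded_finite[OF bounded_cball] in auto)
    show "AE x in lborel. (\<lambda>n. S n x) \<longlonglongrightarrow> F' x b"
    proof (rule AE_I2)
      fix x
      have "((\<lambda>h. (F (x + h *\<^sub>R b) - F x) / h) \<longlongrightarrow> F' x b) (at 0)"
        using dd[of x 0] by (simp add: DERIV_def)
      moreover have "filterlim e (at 0) sequentially" using e by (auto simp: filterlim_at less_imp_neq[symmetric])
      ultimately show "(\<lambda>n. S n x) \<longlonglongrightarrow> F' x b" unfolding S_def by (rule filterlim_compose)
    qed
    show "AE x in lborel. norm (S n x) \<le> K * indicator (cball (0::'a) (R + norm b)) x" for n
    proof (rule AE_I2)
      fix x
      show "norm (S n x) \<le> K * indicator (cball (0::'a) (R + norm b)) x"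
      proof (cases "norm x \<le> R + norm b")
        case True
        have "norm (F (x + e n *\<^sub>R b) - F (x + 0 *\<^sub>R b)) \<le> K * norm (e n - 0)"
          by (rule field_differentiable_bound[of UNIV, OF _ dd]) (use K in auto)
        then show ?thesis using True e(1)[of n] by (simp add: S_def field_simps abs_mult)
      next
        case False
        have "norm (e n *\<^sub>R b) \<le> norm b" using e(1,2)[of n] by (simp add: mult_left_le_one_le)
        then have "R < norm (x + e n *\<^sub>R b)" using False norm_triangle_ineq2[of x "- (e n *\<^sub>R b)"] by simp
        moreover have "R < norm x" using False norm_ge_zero[of b] by linarith
        ultimately show ?thesis using R K(2) by (simp add: S_def)
      qed
    qed
  qed (unfold S_def, measurable)
  moreover have "(\<integral>x. S n x \<partial>lborel) = 0" for n
  proof -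
    obtain B where "\<And>x. \<bar>F x\<bar> \<le> B"
    proof -
      have "compact (F ` cball 0 R)"
        by (intro compact_continuous_image continuous_on_subset[OF cF]) auto
      then have "bounded (F ` cball 0 R)" by (rule compact_imp_bounded)
      then obtain B where B: "\<And>x. norm x \<le> R \<Longrightarrow> \<bar>F x\<bar> \<le> B" by (fastforce simp: bounded_iff)
      have "\<bar>F x\<bar> \<le> max 0 B" for x
        using B[of x] R[of x] by (cases "norm x \<le> R") auto
      then show thesis by (rule that)
    qed
    then have iF: "integrable lborel F" by (intro integrable_bounded_support[OF mF _ R]) auto
    then have "integrable lborel (\<lambda>x. F (x + e n *\<^sub>R b))" 
      using lborel_integrable_translate[OF mF, of "e n *\<^sub>R b"] by (simp add: add.commute)
    with iF show ?thesis 
      using lborel_integral_translate[OF mF, of "e n *\<^sub>R b"] by (simp add: S_def add.commute)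
  qed
  ultimately show ?thesis by (simp add: LIMSEQ_const_iff)
qed

section \<open>The fractional gradient as a symmetrised singular integral\<close>

definition frac_kernel :: "real \<Rightarrow> 'a::euclidean_space \<Rightarrow> 'a" where
  "frac_kernel s h = norm h powr - (real DIM('a) + 1 + s) *\<^sub>R h"

text \<open>Symmetrisation in \<open>h\<close> replaces the principal value: for Lipschitz \<open>\<phi>\<close> the difference gains a factor \<open>norm h\<close>, and the
  integrand becomes absolutely integrable as long as \<open>s < 1\<close>.\<close>

definition frac_integrand :: "real \<Rightarrow> ('a::euclidean_space \<Rightarrow> real) \<Rightarrow> 'a \<Rightarrow> 'a \<Rightarrow> 'a" where
  "frac_integrand s \<phi> x h = (\<phi> (x + h) - \<phi> (x - h)) *\<^sub>R frac_kernel s h"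

definition singular_frac_grad :: "real \<Rightarrow> ('a::euclidean_space \<Rightarrow> real) \<Rightarrow> 'a \<Rightarrow> 'a" where
  "singular_frac_grad s \<phi> x = (\<mu> DIM('a) s / 2) *\<^sub>R (\<integral>h. frac_integrand s \<phi> x h \<partial>lborel)"

lemma norm_frac_kernel: "norm (frac_kernel s (h::'a::euclidean_space)) = norm h powr - (real DIM('a) + s)"
proof (cases "h = 0")
  case False
  then have "norm h powr - (real DIM('a) + 1 + s) * norm h powr 1 = norm h powr - (real DIM('a) + s)"
    by (simp only: powr_add[symmetric]) simp
  then show ?thesis using False by (simp add: frac_kernel_def)
qed (simp add: frac_kernel_def)

lemma frac_kernel_measurable[measurable]: "frac_kernel s \<in> borel_measurable borel"
  unfolding frac_kernel_def[abs_def] by measurable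

context bounded_test_function
begin

lemma \<phi>_continuous: "continuous_on UNIV \<phi>"
  by (rule test_functionD(2)[OF test])

lemma \<phi>_GDERIV: "GDERIV \<phi> x :> gradient \<phi> x"
  by (rule GDERIV_gradient[OF test_functionD(3)[OF test]])

lemma gradient_continuous: "continuous_on UNIV (gradient \<phi>)"
  unfolding continuous_on_componentwise[of UNIV "gradient \<phi>"]
  by (auto intro: test_functionD(2)[OF test_function_gradient_component[OF test]])

lemma \<phi>_measurable[measurable]: "\<phi> \<in> borel_measurable borel"
  by (rule borel_measurable_continuous_onI[OF \<phi>_continuous])

lemma gradient_measurable[measurable]: "gradient \<phi> \<in> borel_measurable borel"
  by (rule borel_measurable_continuous_onI[OF gradient_continuous])

lemma \<phi>_integrable: "integrable lborel \<phi>"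
  by (rule integrable_bounded_support[OF \<phi>_measurable]) (use bound outside in auto)

lemma abs_\<phi>_integrable: "integrable lborel (\<lambda>x. \<bar>\<phi> x\<bar>)"
  using \<phi>_integrable by (rule integrable_abs)

lemma frac_integrand_measurable[measurable]: "frac_integrand s \<phi> x \<in> borel_measurable borel"
  unfolding frac_integrand_def[abs_def] by measurable

text \<open>An integrable bound of the integrands that serves all orders up to \<open>t\<close> at once. Near the origin it uses the
  Lipschitz bound; away from it the kernel is at most one.\<close>

definition majorant :: "real \<Rightarrow> 'a \<Rightarrow> 'a \<Rightarrow> real" where
  "majorant t x h = 2 * M * (indicator (ball 0 1) h * norm h powr - (real DIM('a) - 1 + t)) + (\<bar>\<phi> (x + h)\<bar> + \<bar>\<phi> (x - h)\<bar>)"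

lemma norm_frac_integrand_le:
  assumes "0 \<le> s" "s \<le> t"
  shows "norm (frac_integrand s \<phi> x h) \<le> majorant t x h"
proof (cases "norm h < 1")
  case True
  have "norm (frac_integrand s \<phi> x h) = \<bar>\<phi> (x + h) - \<phi> (x - h)\<bar> * norm h powr - (real DIM('a) + s)"
    by (simp add: frac_integrand_def norm_frac_kernel)
  also have "\<dots> \<le> (M * norm ((x + h) - (x - h))) * norm h powr - (real DIM('a) + s)"
    by (intro mult_right_mono lipschitz) simp
  also have "norm ((x + h) - (x - h)) = 2 * norm h"
    using norm_scaleR[of 2 h] by (simp add: scaleR_2 algebra_simps)
  also have "M * (2 * norm h) * norm h powr - (real DIM('a) + s) = 2 * M * norm h powr - (real DIM('a) - 1 + s)"
  proof (cases "h = 0")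
    case False
    have "norm h powr 1 * norm h powr - (real DIM('a) + s) = norm h powr - (real DIM('a) - 1 + s)"
      by (simp only: powr_add[symmetric]) (simp add: algebra_simps)
    then show ?thesis using False by simp
  qed simp
  also have "\<dots> \<le> 2 * M * norm h powr - (real DIM('a) - 1 + t)"
    using True assms M0 by (cases "h = 0") (auto intro!: mult_left_mono powr_mono')
  also have "\<dots> \<le> majorant t x h" using True by (simp add: majorant_def)
  finally show ?thesis .
next
  case False
  then have "norm h powr - (real DIM('a) + s) \<le> 1" using powr_mono2'[of "-(real DIM('a) + s)" 1 "norm h"] assms by simp
  then have "\<bar>\<phi> (x + h) - \<phi> (x - h)\<bar> * norm h powr - (real DIM('a) + s) \<le> \<bar>\<phi> (x + h) - \<phi> (x - h)\<bar> * 1"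
    by (intro mult_left_mono) auto
  then show ?thesis using False by (simp add: frac_integrand_def norm_frac_kernel majorant_def)
qed

lemma abs_\<phi>_translates:
  "integrable lborel (\<lambda>h. \<bar>\<phi> (x + h)\<bar>)" "integrable lborel (\<lambda>h. \<bar>\<phi> (x - h)\<bar>)"
  "(\<integral>h. \<bar>\<phi> (x + h)\<bar> \<partial>lborel) = (\<integral>h. \<bar>\<phi> h\<bar> \<partial>lborel)" "(\<integral>h. \<bar>\<phi> (x - h)\<bar> \<partial>lborel) = (\<integral>h. \<bar>\<phi> h\<bar> \<partial>lborel)"
  using abs_\<phi>_integrable lborel_integrable_translate[of "\<lambda>h. \<bar>\<phi> h\<bar>" x] lborel_integrable_reflect[of "\<lambda>h. \<bar>\<phi> h\<bar>" x]
    lborel_integral_translate[of "\<lambda>h. \<bar>\<phi> h\<bar>" x] lborel_integral_reflect[of "\<lambda>h. \<bar>\<phi> h\<bar>" x] by simp_all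

lemma majorant_integral:
  assumes "0 \<le> t" "t < 1"
  shows "integrable lborel (majorant t x)"
    "(\<integral>h. majorant t x h \<partial>lborel) = 2 * M * (DIM('a) * unit_ball_vol DIM('a) / (1 - t)) + 2 * (\<integral>h. \<bar>\<phi> h\<bar> \<partial>lborel)"
proof -
  have d: "1 \<le> real DIM('a)" using DIM_positive[where 'a='a] by linarith
  have "has_bochner_integral lborel (\<lambda>h::'a. indicator (ball 0 1) h * norm h powr - (real DIM('a) - 1 + t))
      (DIM('a) * unit_ball_vol DIM('a) / (DIM('a) - (real DIM('a) - 1 + t)))"
    by (rule has_integral_norm_powr_ball) (use assms d in auto)
  then have i: "integrable lborel (\<lambda>h::'a. indicator (ball 0 1) h * norm h powr - (real DIM('a) - 1 + t))"
    "(\<integral>h. indicator (ball 0 1) h * norm h powr - (real DIM('a) - 1 + t) \<partial>(lborel :: 'a measure)) = DIM('a) * unit_ball_vol DIM('a) / (1 - t)"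
    by (auto simp: has_bochner_integral_iff)
  show "integrable lborel (majorant t x)"
    unfolding majorant_def by (intro Bochner_Integration.integrable_add integrable_mult_right i abs_\<phi>_translates)
  show "(\<integral>h. majorant t x h \<partial>lborel) = 2 * M * (DIM('a) * unit_ball_vol DIM('a) / (1 - t)) + 2 * (\<integral>h. \<bar>\<phi> h\<bar> \<partial>lborel)"
    unfolding majorant_def using i abs_\<phi>_translates[of x] by (simp del: mult_minus_left)
qed

lemma frac_integrand_integrable:
  assumes "0 \<le> s" "s < 1"
  shows "integrable lborel (frac_integrand s \<phi> x)"
proof (rule Bochner_Integration.integrable_bound[OF majorant_integral(1)[OF assms]])
  show "AE h in lborel. norm (frac_integrand s \<phi> x h) \<le> norm (majorant s x h)"
    using norm_frac_integrand_le[OF assms(1) order_refl, of x] by (auto intro!: AE_I2 order_trans[OF _ abs_ge_self])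
qed measurable

lemma riesz_potential_eq:
  "riesz_potential (1 - s) \<phi> x = \<mu> DIM('a) s / (real DIM('a) - 1 + s) * (\<integral>h. norm h powr - (real DIM('a) - 1 + s) * \<phi> (x + h) \<partial>lborel)"
proof -
  define c where "c = real DIM('a) - 1 + s"
  have c: "real DIM('a) - (1 - s) = c" "1 - (1 - s) = s" by (simp_all add: c_def)
  have "(\<integral>y. \<phi> y / norm (x - y) powr c \<partial>lebesgue) = (\<integral>y. \<phi> y / norm (x - y) powr c \<partial>lborel)"
    by (rule integral_completion) measurable
  also have "\<dots> = (\<integral>h. \<phi> (x + h) / norm (x - (x + h)) powr c \<partial>lborel)"
    by (rule lborel_integral_translate[symmetric]) measurable
  also have "\<dots> = (\<integral>h. norm h powr - c * \<phi> (x + h) \<partial>lborel)"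
    by (intro Bochner_Integration.integral_cong) (auto simp: powr_minus divide_inverse mult.commute)
  finally show ?thesis by (simp only: riesz_potential_def c c_def[symmetric])
qed

text \<open>The Taylor remainder is at most \<open>M * (norm k)\<^sup>2\<close> and vanishes outside one ball for all increments \<open>k\<close> with \<open>norm k < 1\<close>.
  Integrated against the weight it stays \<open>O((norm k)\<^sup>2)\<close>.\<close>

lemma GDERIV_riesz_integral:
  fixes a :: real
  assumes a: "0 \<le> a" "a < DIM('a)"
  shows "GDERIV (\<lambda>x. \<integral>h. norm h powr - a * \<phi> (x + h) \<partial>lborel) x :> (\<integral>h. norm h powr - a *\<^sub>R gradient \<phi> (x + h) \<partial>lborel)"
  unfolding gderiv_def
proof (rule has_derivativeI_sandwich[of 1])
  let ?I = "\<lambda>x. \<integral>h. norm h powr - a * \<phi> (x + h) \<partial>lborel"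
  let ?G = "\<integral>h. norm h powr - a *\<^sub>R gradient \<phi> (x + h) \<partial>lborel"
  define g where "g z = (indicator (cball 0 (R + 1)) z :: real)" for z :: 'a
  have g[measurable]: "g \<in> borel_measurable borel" 
    unfolding g_def[abs_def] by (rule borel_measurable_indicator) simp
  have iphi: "integrable lborel (\<lambda>h. norm h powr - a * \<phi> (x + h))" for x
    using integrable_norm_powr_times[where K=M, OF \<phi>_measurable _ outside a] bound by simp
  have igrad: "integrable lborel (\<lambda>h. norm h powr - a *\<^sub>R gradient \<phi> (x + h))"
    by (rule integrable_norm_powr_times[where K=M, OF gradient_measurable grad_bound grad_outside a])
  have ig: "integrable lborel (\<lambda>h. norm h powr - a * g (x + h))"
    using integrable_norm_powr_times[where K=1 and R="R + 1", OF g _ _ a] by (simp add: g_def)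
  define J where "J = (\<integral>h. norm h powr - a * g (x + h) \<partial>lborel)"
  show "bounded_linear (\<lambda>h. h \<bullet> ?G)" by (rule bounded_linear_inner_left)
  show "((\<lambda>y. M * J * norm (y - x)) \<longlongrightarrow> 0) (at x within UNIV)"
    by (auto intro!: tendsto_eq_intros)
  fix y assume y: "y \<noteq> x" "dist y x < 1"
  define k where "k = y - x"
  have k: "y = x + k" "k \<noteq> 0" "norm k < 1" using y by (auto simp: k_def dist_norm)
  have ik: "integrable lborel (\<lambda>h. norm h powr - a * (k \<bullet> gradient \<phi> (x + h)))"
    using integrable_inner_right[of k lborel "\<lambda>h. norm h powr - a *\<^sub>R gradient \<phi> (x + h)"] igrad by simp
  have "?I y - ?I x - k \<bullet> ?G = (\<integral>h. norm h powr - a * \<phi> (y + h) - norm h powr - a * \<phi> (x + h) - norm h powr - a * (k \<bullet> gradient \<phi> (x + h)) \<partial>lborel)"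
    using iphi[of x] iphi[of y] ik integral_inner_right[of k lborel "\<lambda>h. norm h powr - a *\<^sub>R gradient \<phi> (x + h)"] igrad by simp
  also have "norm \<dots> \<le> (\<integral>h. M * (norm k)\<^sup>2 * (norm h powr - a * g (x + h)) \<partial>lborel)"
  proof (rule Bochner_Integration.integral_norm_bound_integral)
    fix h
    have "\<bar>\<phi> (x + h + k) - \<phi> (x + h) - k \<bullet> gradient \<phi> (x + h)\<bar> \<le> M * (norm k)\<^sup>2 * g (x + h)"
    proof (cases "norm (x + h) \<le> R + 1")
      case True
      then show ?thesis using test_function_taylor[OF test M0 grad_lipschitz] by (simp add: g_def)
    next
      case False
      have "norm (x + h) - norm k \<le> norm (x + h + k)" using norm_triangle_ineq2[of "x + h" "- k"] by simp
      then have "R < norm (x + h + k)" using False k by linarith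
      then show ?thesis using False outside grad_outside by (simp add: g_def)
    qed
    note le = mult_left_mono[OF this, of "norm h powr - a"]
    have "norm h powr - a * \<phi> (y + h) - norm h powr - a * \<phi> (x + h) - norm h powr - a * (k \<bullet> gradient \<phi> (x + h))
      = norm h powr - a * (\<phi> (x + h + k) - \<phi> (x + h) - k \<bullet> gradient \<phi> (x + h))"
      by (simp add: k(1) algebra_simps)
    then show "norm (norm h powr - a * \<phi> (y + h) - norm h powr - a * \<phi> (x + h) - norm h powr - a * (k \<bullet> gradient \<phi> (x + h)))
       \<le> M * (norm k)\<^sup>2 * (norm h powr - a * g (x + h))"
      using le by (simp add: abs_mult mult_ac)
  qed (use iphi ik ig in auto)
  also have "\<dots> = M * J * (norm k)\<^sup>2" using ig by (simp add: J_def)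
  finally have "norm (?I y - ?I x - k \<bullet> ?G) / norm k \<le> M * J * (norm k)\<^sup>2 / norm k"
    by (rule divide_right_mono) simp
  also have "\<dots> = M * J * norm k" using k by (simp add: power2_eq_square)
  finally show "norm (?I y - ?I x - (y - x) \<bullet> ?G) / norm (y - x) \<le> M * J * norm (y - x)"
    by (simp add: k_def)
qed simp

text \<open>The weight is smoothed to \<open>(norm h ^ 2 + e) powr - (a / 2)\<close>, so that no boundary term at the origin arises. The
  resulting kernel is odd in \<open>h\<close>, and averaging over \<open>h\<close> and \<open>- h\<close> produces the difference of \<open>\<phi>\<close>.\<close>

lemma gradient_integral_by_parts:
  assumes e: "0 < e"
  shows "(\<integral>h. (h \<bullet> h + e) powr - (a / 2) * (b \<bullet> gradient \<phi> (x + h)) \<partial>lborel) =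
    a / 2 * (\<integral>h. (\<phi> (x + h) - \<phi> (x - h)) * ((h \<bullet> h + e) powr - (a / 2 + 1) * (h \<bullet> b)) \<partial>lborel)"
proof -
  define q where "q h = h \<bullet> h + e" for h :: 'a
  have q0: "0 < q h" for h using e by (simp add: q_def add_nonneg_pos)
  define F where "F h = \<phi> (x + h) * q h powr - (a / 2)" for h
  define F' where "F' h k = \<phi> (x + h) * (- a * (q h powr - (a / 2 + 1) * (h \<bullet> k))) + (k \<bullet> gradient \<phi> (x + h)) * q h powr - (a / 2)" for h k
  have dq: "((\<lambda>h. q h powr - (a / 2)) has_derivative (\<lambda>k. - a * (q h powr - (a / 2 + 1) * (h \<bullet> k)))) (at h)" for h
  proof -
    have "(q has_derivative (\<lambda>k. 2 * (h \<bullet> k))) (at h)"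
      unfolding q_def[abs_def] by (auto intro!: derivative_eq_intros simp: inner_commute)
    moreover have "((\<lambda>t. t powr - (a / 2)) has_derivative (*) (- (a / 2) * q h powr (- (a / 2) - 1))) (at (q h))"
      by (rule has_real_derivative_powr[OF q0, unfolded has_field_derivative_def])
    ultimately have "((\<lambda>h. q h powr - (a / 2)) has_derivative (\<lambda>k. (- (a / 2) * q h powr (- (a / 2) - 1)) * (2 * (h \<bullet> k)))) (at h)"
      by (rule has_derivative_compose)
    moreover have e: "- (a / 2) - 1 = - (a / 2 + 1)" by simp
    have "(\<lambda>k. (- (a / 2) * q h powr (- (a / 2) - 1)) * (2 * (h \<bullet> k))) = (\<lambda>k. - a * (q h powr - (a / 2 + 1) * (h \<bullet> k)))"
      unfolding e by (simp add: fun_eq_iff)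
    ultimately show ?thesis by (simp only:)
  qed
  have dphi: "((\<lambda>h. \<phi> (x + h)) has_derivative (\<lambda>k. k \<bullet> gradient \<phi> (x + h))) (at h)" for h
  proof (rule has_derivative_compose[of "\<lambda>h. x + h" "\<lambda>h. h" h UNIV \<phi>])
    show "((+) x has_derivative (\<lambda>h. h)) (at h)" by (auto intro!: derivative_eq_intros)
  qed (use \<phi>_GDERIV[of "x + h"] in \<open>simp add: gderiv_def\<close>)
  have d: "(F has_derivative F' h) (at h)" for h
    unfolding F_def[abs_def] F'_def[abs_def] by (rule has_derivative_mult[OF dphi dq])
  have cq: "continuous_on UNIV (\<lambda>h. q h powr c)" for c
    using q0 by (intro continuous_on_powr) (auto simp: q_def[abs_def] less_imp_neq[symmetric] intro!: continuous_intros)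
  have cphi: "continuous_on UNIV (\<lambda>h. \<phi> (x + h))" "continuous_on UNIV (\<lambda>h. gradient \<phi> (x + h))"
    by (rule continuous_on_compose2[OF \<phi>_continuous] continuous_on_compose2[OF gradient_continuous]; 
        auto intro!: continuous_intros)+
  have [measurable]: "(\<lambda>h. q h powr c) \<in> borel_measurable borel" for c
    by (rule borel_measurable_continuous_onI[OF cq])
  have out: "\<phi> (x + h) = 0" "gradient \<phi> (x + h) = 0" if "R + norm x < norm h" for h
  proof -
    have "norm h \<le> norm (x + h) + norm x" using norm_triangle_ineq4[of "x + h" x] by simp
    then have "R < norm (x + h)" using that by linarith
    then show "\<phi> (x + h) = 0" "gradient \<phi> (x + h) = 0" by (auto simp: outside grad_outside)
  qed
  have z: "(\<integral>h. F' h b \<partial>lborel) = 0"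
  proof (rule integral_directional_derivative_0[OF d])
    show "continuous_on UNIV (\<lambda>h. F' h b)"
      unfolding F'_def by (intro continuous_intros cq cphi)
    show "F h = 0" if "R + norm x < norm h" for h using out[OF that] by (simp add: F_def)
  qed
  define U where "U h = \<phi> (x + h) * (q h powr - (a / 2 + 1) * (h \<bullet> b))" for h
  define V where "V h = q h powr - (a / 2) * (b \<bullet> gradient \<phi> (x + h))" for h
  have [measurable]: "U \<in> borel_measurable borel" "V \<in> borel_measurable borel" unfolding U_def[abs_def] V_def[abs_def] by measurable
  have bd: "\<exists>K. \<forall>h. \<bar>f h\<bar> \<le> K" if c: "continuous_on UNIV f" and o: "\<And>h. R + norm x < norm h \<Longrightarrow> f h = 0" for f :: "'a \<Rightarrow> real"
  proof -
    have "compact (f ` cball 0 (R + norm x))"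
      by (intro compact_continuous_image continuous_on_subset[OF c]) auto
    then have "bounded (f ` cball 0 (R + norm x))" by (rule compact_imp_bounded)
    then obtain B where B: "\<And>h. norm h \<le> R + norm x \<Longrightarrow> \<bar>f h\<bar> \<le> B" by (fastforce simp: bounded_iff)
    have "\<bar>f h\<bar> \<le> max 0 B" for h
      using B[of h] o[of h] by (cases "norm h \<le> R + norm x") auto
    then show ?thesis by blast
  qed
  have "continuous_on UNIV U" "continuous_on UNIV V"
    unfolding U_def[abs_def] V_def[abs_def] by (intro continuous_intros cq cphi)+
  then have iUV: "integrable lborel U" "integrable lborel V"
    using bd[of U] bd[of V] out
    by (auto intro!: integrable_bounded_support[where R="R + norm x"] simp: U_def V_def)
  have "F' h b = - a * U h + V h" for h by (simp add: F'_def U_def V_def mult_ac)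
  then have "(\<integral>h. V h \<partial>lborel) = a * (\<integral>h. U h \<partial>lborel)"
    using z iUV by simp
  moreover have "2 * (\<integral>h. U h \<partial>lborel) = (\<integral>h. U h + U (0 - h) \<partial>lborel)"
    using iUV(1) lborel_integral_reflect[of U 0] lborel_integrable_reflect[of U 0]
    by (subst Bochner_Integration.integral_add) auto
  moreover have "U h + U (0 - h) = (\<phi> (x + h) - \<phi> (x - h)) * (q h powr - (a / 2 + 1) * (h \<bullet> b))" for h
    by (simp add: U_def q_def algebra_simps)
  ultimately show ?thesis by (simp add: V_def q_def)
qed


lemma inner_self_powr: "h \<noteq> 0 \<Longrightarrow> (h \<bullet> h) powr c = norm h powr (2 * c)" for h :: 'a
  by (simp add: power2_norm_eq_inner[symmetric] powr_numeral[symmetric] powr_powr del: powr_numeral)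

lemma regularised_powr:
  fixes h :: 'a
  assumes "h \<noteq> 0" "0 \<le> c"
  shows "(\<lambda>n. (h \<bullet> h + inverse (real (Suc n))) powr - c) \<longlonglongrightarrow> norm h powr - (2 * c)"
    and "(h \<bullet> h + inverse (real (Suc n))) powr - c \<le> norm h powr - (2 * c)"
proof -
  have p: "0 < h \<bullet> h" using assms by simp
  have "(\<lambda>n. h \<bullet> h + inverse (real (Suc n))) \<longlonglongrightarrow> h \<bullet> h + 0"
    by (intro tendsto_intros LIMSEQ_inverse_real_of_nat)
  then have "(\<lambda>n. (h \<bullet> h + inverse (real (Suc n))) powr - c) \<longlonglongrightarrow> (h \<bullet> h) powr - c"
    using assms(1) by (intro tendsto_powr tendsto_const) simp_all
  then show "(\<lambda>n. (h \<bullet> h + inverse (real (Suc n))) powr - c) \<longlonglongrightarrow> norm h powr - (2 * c)"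
    using inner_self_powr[OF assms(1), of "- c"] by simp
  have "(h \<bullet> h + inverse (real (Suc n))) powr - c \<le> (h \<bullet> h) powr - c"
    using p assms(2) by (intro powr_mono2') auto
  then show "(h \<bullet> h + inverse (real (Suc n))) powr - c \<le> norm h powr - (2 * c)"
    using inner_self_powr[OF assms(1), of "- c"] by simp
qed

text \<open>The regularised identity is passed to the limit \<open>e \<longlonglongrightarrow> 0\<close>. Both sides are dominated by their limits, as the
  smoothed weights increase to the singular ones. With \<open>a = d - 1 + s\<close> the factor \<open>a\<close> cancels the
  denominator in the Riesz potential.\<close>

lemma riesz_gradient_eq_singular:
  assumes s: "0 < s" "s < 1"
  shows "(\<mu> DIM('a) s / (real DIM('a) - 1 + s)) *\<^sub>R (\<integral>h. norm h powr - (real DIM('a) - 1 + s) *\<^sub>R gradient \<phi> (x + h) \<partial>lborel)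
    = singular_frac_grad s \<phi> x"
proof -
  define a where "a = real DIM('a) - 1 + s"
  have "1 \<le> real DIM('a)" using DIM_positive[where 'a='a] by linarith
  then have a: "0 < a" "0 \<le> a" "a < real DIM('a)" using s unfolding a_def by linarith+
  let ?G = "\<integral>h. norm h powr - a *\<^sub>R gradient \<phi> (x + h) \<partial>lborel"
  let ?S = "\<integral>h. frac_integrand s \<phi> x h \<partial>lborel"
  define e where "e n = inverse (real (Suc n))" for n
  have e0: "0 < e n" for n by (simp add: e_def)
  have iG: "integrable lborel (\<lambda>h. norm h powr - a *\<^sub>R gradient \<phi> (x + h))"
    by (rule integrable_norm_powr_times[where K=M, OF gradient_measurable grad_bound grad_outside a(2,3)])
  have iS: "integrable lborel (frac_integrand s \<phi> x)"
    using s by (intro frac_integrand_integrable) auto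
  have fi: "frac_integrand s \<phi> x h \<bullet> b = (\<phi> (x + h) - \<phi> (x - h)) * (norm h powr - (2 * (a / 2 + 1)) * (h \<bullet> b))" for h b
  proof -
    have "2 * (a / 2 + 1) = a + 2" by simp
    then have "- (real DIM('a) + 1 + s) = - (2 * (a / 2 + 1))" by (simp add: a_def)
    then show ?thesis by (simp only: frac_integrand_def frac_kernel_def inner_scaleR_left)
  qed
  have nz: "AE h in lborel. h \<noteq> (0::'a)" by (rule AE_lborel_singleton)
  have "?G \<bullet> b = a / 2 * (?S \<bullet> b)" for b
  proof -
    have 1: "(\<lambda>n. \<integral>h. (h \<bullet> h + e n) powr - (a / 2) * (b \<bullet> gradient \<phi> (x + h)) \<partial>lborel) \<longlonglongrightarrow>
      (\<integral>h. norm h powr - (2 * (a / 2)) * (b \<bullet> gradient \<phi> (x + h)) \<partial>lborel)"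
    proof (rule integral_dominated_convergence[where w="\<lambda>h. \<bar>(norm h powr - a *\<^sub>R gradient \<phi> (x + h)) \<bullet> b\<bar>"])
      show "integrable lborel (\<lambda>h. \<bar>(norm h powr - a *\<^sub>R gradient \<phi> (x + h)) \<bullet> b\<bar>)"
        by (intro integrable_abs integrable_inner_left iG)
      show "AE h in lborel. (\<lambda>n. (h \<bullet> h + e n) powr - (a / 2) * (b \<bullet> gradient \<phi> (x + h))) \<longlonglongrightarrow> norm h powr - (2 * (a / 2)) * (b \<bullet> gradient \<phi> (x + h))"
        using nz
      proof eventually_elim
        fix h :: 'a assume "h \<noteq> 0"
        then show "(\<lambda>n. (h \<bullet> h + e n) powr - (a / 2) * (b \<bullet> gradient \<phi> (x + h))) \<longlonglongrightarrow> norm h powr - (2 * (a / 2)) * (b \<bullet> gradient \<phi> (x + h))"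
          unfolding e_def using a by (intro tendsto_mult tendsto_const regularised_powr) auto
      qed
      show "AE h in lborel. norm ((h \<bullet> h + e n) powr - (a / 2) * (b \<bullet> gradient \<phi> (x + h))) \<le> \<bar>(norm h powr - a *\<^sub>R gradient \<phi> (x + h)) \<bullet> b\<bar>" for n
        using nz
      proof eventually_elim
        fix h :: 'a assume "h \<noteq> 0"
        then have "(h \<bullet> h + e n) powr - (a / 2) \<le> norm h powr - a"
          unfolding e_def using regularised_powr(2)[of h "a / 2" n] a by simp
        then show "norm ((h \<bullet> h + e n) powr - (a / 2) * (b \<bullet> gradient \<phi> (x + h))) \<le> \<bar>(norm h powr - a *\<^sub>R gradient \<phi> (x + h)) \<bullet> b\<bar>"
          by (simp add: abs_mult inner_commute mult_right_mono)
      qed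
    qed measurable
    have 2: "(\<lambda>n. \<integral>h. (\<phi> (x + h) - \<phi> (x - h)) * ((h \<bullet> h + e n) powr - (a / 2 + 1) * (h \<bullet> b)) \<partial>lborel) \<longlonglongrightarrow>
      (\<integral>h. frac_integrand s \<phi> x h \<bullet> b \<partial>lborel)"
    proof (rule integral_dominated_convergence[where w="\<lambda>h. \<bar>frac_integrand s \<phi> x h \<bullet> b\<bar>"])
      show "integrable lborel (\<lambda>h. \<bar>frac_integrand s \<phi> x h \<bullet> b\<bar>)"
        by (intro integrable_abs integrable_inner_left iS)
      show "AE h in lborel. (\<lambda>n. (\<phi> (x + h) - \<phi> (x - h)) * ((h \<bullet> h + e n) powr - (a / 2 + 1) * (h \<bullet> b))) \<longlonglongrightarrow> frac_integrand s \<phi> x h \<bullet> b"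
        using nz
      proof eventually_elim
        fix h :: 'a assume "h \<noteq> 0"
        then show "(\<lambda>n. (\<phi> (x + h) - \<phi> (x - h)) * ((h \<bullet> h + e n) powr - (a / 2 + 1) * (h \<bullet> b))) \<longlonglongrightarrow> frac_integrand s \<phi> x h \<bullet> b"
          unfolding e_def fi using a by (intro tendsto_mult tendsto_const regularised_powr) auto
      qed
      show "AE h in lborel. norm ((\<phi> (x + h) - \<phi> (x - h)) * ((h \<bullet> h + e n) powr - (a / 2 + 1) * (h \<bullet> b))) \<le> \<bar>frac_integrand s \<phi> x h \<bullet> b\<bar>" for n
        using nz
      proof eventually_elim
        fix h :: 'a assume "h \<noteq> 0"
        then have "(h \<bullet> h + e n) powr - (a / 2 + 1) \<le> norm h powr - (2 * (a / 2 + 1))"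
          unfolding e_def using regularised_powr(2)[of h "a / 2 + 1" n] a by simp
        then show "norm ((\<phi> (x + h) - \<phi> (x - h)) * ((h \<bullet> h + e n) powr - (a / 2 + 1) * (h \<bullet> b))) \<le> \<bar>frac_integrand s \<phi> x h \<bullet> b\<bar>"
          unfolding fi norm_mult abs_mult real_norm_def
          by (intro mult_mono mult_nonneg_nonneg) auto
      qed
    qed measurable
    have "?G \<bullet> b = (\<integral>h. norm h powr - (2 * (a / 2)) * (b \<bullet> gradient \<phi> (x + h)) \<partial>lborel)"
      using integral_inner_left[of b lborel "\<lambda>h. norm h powr - a *\<^sub>R gradient \<phi> (x + h)"] iG by (simp add: inner_commute)
    moreover have "?S \<bullet> b = (\<integral>h. frac_integrand s \<phi> x h \<bullet> b \<partial>lborel)"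
      using integral_inner_left[of b lborel "frac_integrand s \<phi> x"] iS by simp
    ultimately show ?thesis
      using LIMSEQ_unique[OF 1] tendsto_mult[OF tendsto_const[of "a / 2"] 2]
      by (simp only: gradient_integral_by_parts[OF e0])
  qed
  then have "?G \<bullet> b = ((a / 2) *\<^sub>R ?S) \<bullet> b" for b by simp
  then have "?G = (a / 2) *\<^sub>R ?S" by (rule euclidean_eqI)
  then show ?thesis using a by (simp add: singular_frac_grad_def a_def[symmetric])
qed

text \<open>This form, in which the gradient falls on \<open>\<phi>\<close>, is the one to use near order one, where the kernel becomes an
  approximate identity.\<close>

lemma frac_grad_test_eq_riesz_gradient:
  assumes s: "0 < s" "s < 1"
  shows "frac_grad_test s \<phi> x = (\<mu> DIM('a) s / (real DIM('a) - 1 + s)) *\<^sub>R (\<integral>h. norm h powr - (real DIM('a) - 1 + s) *\<^sub>R gradient \<phi> (x + h) \<partial>lborel)"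
proof -
  define a where "a = real DIM('a) - 1 + s"
  have "1 \<le> real DIM('a)" using DIM_positive[where 'a='a] by linarith
  then have a: "0 \<le> a" "a < real DIM('a)" "a \<noteq> 0" using s unfolding a_def by linarith+
  have r: "riesz_potential (1 - s) \<phi> = (\<lambda>x. (\<mu> DIM('a) s / a) * (\<integral>h. norm h powr - a * \<phi> (x + h) \<partial>lborel))"
    by (simp add: fun_eq_iff riesz_potential_eq a_def)
  have "GDERIV (riesz_potential (1 - s) \<phi>) x :> (\<mu> DIM('a) s / a) *\<^sub>R (\<integral>h. norm h powr - a *\<^sub>R gradient \<phi> (x + h) \<partial>lborel)"
    using a(3) GDERIV_riesz_integral[OF a(1,2), of x] unfolding r gderiv_def
    by (auto intro!: derivative_eq_intros)
  then show ?thesis using s by (simp add: frac_grad_test_def gradient_eqI a_def)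
qed

text \<open>Truncation is symmetric in \<open>h\<close>, so the truncated integral equals the average of its values after the
  substitutions \<open>y = x + h\<close> and \<open>y = x - h\<close>.\<close>

lemma truncated_riesz_integral:
  assumes e: "0 < e"
  shows "(LINT y:{y. e < norm (x - y)}|lebesgue. ((x - y) \<bullet> b) / norm (x - y) ^ (DIM('a) + 1) * \<phi> y) =
    - (1 / 2) * (\<integral>h. indicator {h. e < norm h} h * (frac_integrand 0 \<phi> x h \<bullet> b) \<partial>lborel)"
proof -
  define f where "f y = indicator {y. e < norm (x - y)} y * (((x - y) \<bullet> b) / norm (x - y) ^ (DIM('a) + 1) * \<phi> y)" for y
  have [measurable]: "f \<in> borel_measurable borel" unfolding f_def[abs_def] by measurable
  have i: "integrable lborel f"
  proof (rule integrable_bounded_support[where R=R])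
    fix y
    show "norm (f y) \<le> norm b / e ^ DIM('a) * M"
    proof (cases "e < norm (x - y)")
      case True
      then have p: "0 < norm (x - y)" using e by linarith
      have "\<bar>(x - y) \<bullet> b\<bar> / norm (x - y) ^ (DIM('a) + 1) \<le> (norm (x - y) * norm b) / norm (x - y) ^ (DIM('a) + 1)"
        by (intro divide_right_mono Cauchy_Schwarz_ineq2) simp
      also have "\<dots> = norm b / norm (x - y) ^ DIM('a)" using p by simp
      also have "\<dots> \<le> norm b / e ^ DIM('a)" using e True p by (intro divide_left_mono power_mono mult_pos_pos zero_less_power) auto
      finally have "\<bar>(x - y) \<bullet> b\<bar> / norm (x - y) ^ (DIM('a) + 1) * \<bar>\<phi> y\<bar> \<le> norm b / e ^ DIM('a) * M"
        using bound e by (intro mult_mono) auto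
      then show ?thesis using True by (simp add: f_def abs_mult)
    qed (use e M0 in \<open>auto simp: f_def\<close>)
  qed (auto simp: f_def outside)
  have "(LINT y:{y. e < norm (x - y)}|lebesgue. ((x - y) \<bullet> b) / norm (x - y) ^ (DIM('a) + 1) * \<phi> y) = (\<integral>y. f y \<partial>lebesgue)"
    by (simp add: set_lebesgue_integral_def f_def)
  also have "\<dots> = (\<integral>y. f y \<partial>lborel)" by (rule integral_completion) measurable
  also have "\<dots> = (1 / 2) * (\<integral>h. f (x + h) + f (x - h) \<partial>lborel)"
    using i by (subst Bochner_Integration.integral_add) 
     (auto simp: lborel_integral_translate lborel_integral_reflect lborel_integrable_translate lborel_integrable_reflect)
  also have "(\<integral>h. f (x + h) + f (x - h) \<partial>lborel) = (\<integral>h. - (indicator {h. e < norm h} h * (frac_integrand 0 \<phi> x h \<bullet> b)) \<partial>lborel)"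
  proof (rule Bochner_Integration.integral_cong[OF refl])
    fix h :: 'a
    show "f (x + h) + f (x - h) = - (indicator {h. e < norm h} h * (frac_integrand 0 \<phi> x h \<bullet> b))"
    proof (cases "e < norm h")
      case True
      then have "0 < norm h" using e by linarith
      then have "norm h powr - (real DIM('a) + 1 + 0) = 1 / norm h ^ (DIM('a) + 1)"
        using powr_realpow[of "norm h" "DIM('a) + 1"] by (simp only: powr_minus_divide) (simp add: add.commute)
      then show ?thesis using True
        by (simp add: f_def frac_integrand_def frac_kernel_def divide_inverse algebra_simps)
    qed (simp add: f_def)
  qed
  finally show ?thesis by simp
qed

text \<open>The symmetrised integrand is absolutely integrable, hence the truncated integrals converge by dominated
  convergence and the principal value exists. The two normalising constants agree because \<open>Gamma (1 / 2) = sqrt pi\<close>.\<close>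

lemma frac_grad_test_0: "frac_grad_test 0 \<phi> x = singular_frac_grad 0 \<phi> x"
proof -
  let ?S = "\<integral>h. frac_integrand 0 \<phi> x h \<partial>lborel"
  have iS: "integrable lborel (frac_integrand 0 \<phi> x)" by (rule frac_integrand_integrable) auto
  have L: "Lim (at_right 0) (\<lambda>\<epsilon>. LINT y:{y. \<epsilon> < norm (x - y)}|lebesgue.
         ((x - y) \<bullet> b) / norm (x - y) ^ (DIM('a) + 1) * \<phi> y) = - (1 / 2) * (?S \<bullet> b)" for b
  proof (rule tendsto_Lim)
    show "((\<lambda>\<epsilon>. LINT y:{y. \<epsilon> < norm (x - y)}|lebesgue.
         ((x - y) \<bullet> b) / norm (x - y) ^ (DIM('a) + 1) * \<phi> y) \<longlongrightarrow> - (1 / 2) * (?S \<bullet> b)) (at_right 0)"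
      unfolding tendsto_at_iff_sequentially
    proof (intro allI impI)
      fix e :: "nat \<Rightarrow> real" assume e: "\<forall>i. e i \<in> {0<..} - {0}" "e \<longlonglongrightarrow> 0"
      have "(\<lambda>n. \<integral>h. indicator {h. e n < norm h} h * (frac_integrand 0 \<phi> x h \<bullet> b) \<partial>lborel) \<longlonglongrightarrow> (\<integral>h. frac_integrand 0 \<phi> x h \<bullet> b \<partial>lborel)"
      proof (rule integral_dominated_convergence[where w="\<lambda>h. \<bar>frac_integrand 0 \<phi> x h \<bullet> b\<bar>"])
        show "integrable lborel (\<lambda>h. \<bar>frac_integrand 0 \<phi> x h \<bullet> b\<bar>)"
          by (intro integrable_abs integrable_inner_left iS)
        show "AE h in lborel. (\<lambda>n. indicator {h. e n < norm h} h * (frac_integrand 0 \<phi> x h \<bullet> b)) \<longlonglongrightarrow> frac_integrand 0 \<phi> x h \<bullet> b"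
        proof (rule AE_I2)
          fix h :: 'a
          show "(\<lambda>n. indicator {h. e n < norm h} h * (frac_integrand 0 \<phi> x h \<bullet> b)) \<longlonglongrightarrow> frac_integrand 0 \<phi> x h \<bullet> b"
          proof (cases "h = 0")
            case False
            then have "\<forall>\<^sub>F n in sequentially. e n < norm h"
              using e(2) by (intro order_tendstoD) auto
            then have "\<forall>\<^sub>F n in sequentially. indicator {h. e n < norm h} h * (frac_integrand 0 \<phi> x h \<bullet> b) = frac_integrand 0 \<phi> x h \<bullet> b"
              by eventually_elim simp
            then show ?thesis by (rule tendsto_eventually)
          qed (simp add: frac_integrand_def)
        qed
        show "AE h in lborel. norm (indicator {h. e n < norm h} h * (frac_integrand 0 \<phi> x h \<bullet> b)) \<le> \<bar>frac_integrand 0 \<phi> x h \<bullet> b\<bar>" for n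
          by (rule AE_I2) (auto simp: indicator_def)
      qed measurable
      then have "(\<lambda>n. - (1 / 2) * (\<integral>h. indicator {h. e n < norm h} h * (frac_integrand 0 \<phi> x h \<bullet> b) \<partial>lborel)) \<longlonglongrightarrow> - (1 / 2) * (\<integral>h. frac_integrand 0 \<phi> x h \<bullet> b \<partial>lborel)"
        by (intro tendsto_mult tendsto_const)
      moreover have "0 < e n" for n using e(1) by auto
      ultimately show "((\<lambda>\<epsilon>. LINT y:{y. \<epsilon> < norm (x - y)}|lebesgue.
         ((x - y) \<bullet> b) / norm (x - y) ^ (DIM('a) + 1) * \<phi> y) \<circ> e) \<longlonglongrightarrow> - (1 / 2) * (?S \<bullet> b)"
        using iS by (simp only: comp_def truncated_riesz_integral integral_inner_left)
    qed
  qed simp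
  have mu: "Gamma ((real DIM('a) + 1) / 2) / pi powr ((real DIM('a) + 1) / 2) = \<mu> DIM('a) 0"
    by (simp add: \<mu>_def Gamma_one_half_real add_divide_distrib powr_add powr_half_sqrt)
  have "frac_grad_test 0 \<phi> x = - (\<Sum>b\<in>Basis. (\<mu> DIM('a) 0 * (- (1 / 2) * (?S \<bullet> b))) *\<^sub>R b)"
    by (simp only: frac_grad_test_def riesz_transform_def L mu if_True simp_thms)
  also have "\<dots> = (\<Sum>b\<in>Basis. (((\<mu> DIM('a) 0 / 2) *\<^sub>R ?S) \<bullet> b) *\<^sub>R b)"
    by (simp add: sum_negf[symmetric])
  also have "\<dots> = (\<mu> DIM('a) 0 / 2) *\<^sub>R ?S" by (rule euclidean_representation)
  finally show ?thesis by (simp add: singular_frac_grad_def)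
qed

lemma frac_grad_test_eq_singular:
  assumes "0 \<le> s" "s < 1"
  shows "frac_grad_test s \<phi> x = singular_frac_grad s \<phi> x"
  using assms frac_grad_test_0 frac_grad_test_eq_riesz_gradient riesz_gradient_eq_singular
  by (cases "s = 0") auto

end

section \<open>The normalising constant as a function of the order\<close>

text \<open>The constant \<open>\<mu> d s\<close> without its zero at \<open>s = 1\<close>, which comes from the pole of the Gamma function at \<open>0\<close>.\<close>

definition \<nu> :: "nat \<Rightarrow> real \<Rightarrow> real" where
  "\<nu> d s = 2 powr (s - 1) * Gamma ((real d + s + 1) / 2) / (pi powr (real d / 2) * Gamma ((3 - s) / 2))"

lemma \<mu>_eq_\<nu>: 
  assumes "s \<le> 1"
  shows "\<mu> d s = (1 - s) * \<nu> d s"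
proof (cases "s = 1")
  case False
  have "Gamma ((3 - s) / 2) = Gamma ((1 - s) / 2 + 1)" by (simp add: field_simps)
  also have "\<dots> = (1 - s) / 2 * Gamma ((1 - s) / 2)"
    by (rule Gamma_plus1) (use False assms in \<open>auto elim!: nonpos_Ints_cases\<close>)
  finally have G: "Gamma ((3 - s) / 2) = (1 - s) / 2 * Gamma ((1 - s) / 2)" .
  have "Gamma ((1 - s) / 2) > 0" using False assms by (intro Gamma_real_pos) auto
  moreover have "2 powr s = 2 * 2 powr (s - 1)" by (simp add: powr_diff)
  ultimately show ?thesis
    using False unfolding \<mu>_def \<nu>_def G by (simp add: field_simps)
qed (simp add: \<mu>_def)

lemma \<nu>_nonneg: "0 \<le> s \<Longrightarrow> s \<le> 1 \<Longrightarrow> 0 \<le> \<nu> d s"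
  by (simp add: \<nu>_def Gamma_real_pos less_imp_le)

lemma continuous_on_\<nu>: "continuous_on {0..1} (\<nu> d)"
proof -
  have "0 < (3 - s) / 2" "0 < (real d + s + 1) / 2" if "s \<in> {0..1}" for s :: real using that by auto
  then have G: "Gamma ((3 - s) / 2) > 0" "(real d + s + 1) / 2 \<notin> \<int>\<^sub>\<le>\<^sub>0" "(3 - s) / 2 \<notin> \<int>\<^sub>\<le>\<^sub>0" if "s \<in> {0..1}" for s :: real
    using that nonpos_Ints_nonpos[of "(3 - s) / 2"] nonpos_Ints_nonpos[of "(real d + s + 1) / 2"]
    by (meson Gamma_real_pos not_less)+
  have "pi powr (real d / 2) * Gamma ((3 - s) / 2) \<noteq> 0" if "s \<in> {0..1}" for s :: real
    using G(1)[OF that] by (simp add: less_imp_neq[symmetric])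
  with G show ?thesis
    unfolding \<nu>_def[abs_def]
    by (intro continuous_at_imp_continuous_on ballI continuous_intros) auto
qed

text \<open>The mass of the limiting approximate identity: it is here that the normalisation of the fractional gradient
  gives the classical gradient as \<open>s\<close> tends to one.\<close>

lemma \<nu>_1: "\<nu> d 1 * unit_ball_vol (real d) = 1"
proof -
  have e: "(real d + 1 + 1) / 2 = real d / 2 + 1" by simp
  have "Gamma (real d / 2 + 1) > 0" by (intro Gamma_real_pos) auto
  then have "Gamma (real d / 2 + 1) \<noteq> 0" by (rule less_imp_neq[symmetric])
  then show ?thesis unfolding \<nu>_def unit_ball_vol_def e by simp
qed

lemma \<nu>_bounded: obtains N where "0 \<le> N" "\<And>s. s \<in> {0..1} \<Longrightarrow> \<nu> d s \<le> N"
proof -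
  have "bounded (\<nu> d ` {0..1})"
    by (intro compact_imp_bounded compact_continuous_image continuous_on_\<nu>) simp
  then obtain B where B: "\<And>s. s \<in> {0..1} \<Longrightarrow> \<bar>\<nu> d s\<bar> \<le> B" by (fastforce simp: bounded_iff)
  from B[of 0] have "0 \<le> B" by (simp add: order_trans[OF abs_ge_zero])
  with B show thesis by (intro that[of B]) force+
qed

lemma \<mu>_bounds:
  assumes "s \<in> {0..1}"
  shows "0 \<le> \<mu> d s" "\<mu> d s \<le> \<nu> d s"
  using assms \<nu>_nonneg[of s d] by (auto simp: \<mu>_eq_\<nu> mult_left_le_one_le)

lemma \<nu>_tendsto:
  assumes "\<And>n. s n \<in> {0..1}" "s \<longlonglongrightarrow> \<sigma>" "\<sigma> \<in> {0..1}"
  shows "(\<lambda>n. \<nu> d (s n)) \<longlonglongrightarrow> \<nu> d \<sigma>"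
  using continuous_on_tendsto_compose[OF continuous_on_\<nu> assms(2,3)] assms(1) by simp

lemma \<mu>_tendsto:
  assumes "\<And>n. s n \<in> {0..1}" "s \<longlonglongrightarrow> \<sigma>" "\<sigma> \<in> {0..1}"
  shows "(\<lambda>n. \<mu> d (s n)) \<longlonglongrightarrow> \<mu> d \<sigma>"
proof -
  have "(\<lambda>n. (1 - s n) * \<nu> d (s n)) \<longlonglongrightarrow> (1 - \<sigma>) * \<nu> d \<sigma>"
    by (intro tendsto_intros \<nu>_tendsto assms)
  then show ?thesis using assms(1,3) by (simp add: \<mu>_eq_\<nu>)
qed

section \<open>Uniform decay and continuity in the order\<close>

context bounded_test_function
begin

lemma singular_frac_grad_measurable[measurable]: "singular_frac_grad s \<phi> \<in> borel_measurable borel"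
proof -
  have "(\<lambda>(x, h). frac_integrand s \<phi> x h) \<in> borel_measurable (borel \<Otimes>\<^sub>M lborel)"
    unfolding frac_integrand_def by measurable
  then have "(\<lambda>x. \<integral>h. frac_integrand s \<phi> x h \<partial>lborel) \<in> borel_measurable borel"
    by (rule lborel.borel_measurable_lebesgue_integral)
  then show ?thesis unfolding singular_frac_grad_def[abs_def] by measurable
qed

lemma frac_grad_test_measurable: "s \<in> {0..1} \<Longrightarrow> frac_grad_test s \<phi> \<in> borel_measurable borel"
proof (cases "s = 1")
  case False
  assume "s \<in> {0..1}"
  with False have "frac_grad_test s \<phi> = singular_frac_grad s \<phi>" 
    by (intro ext frac_grad_test_eq_singular) auto
  then show ?thesis by simp
qed (simp add: frac_grad_test_def)

text \<open>The integral of the majorant grows like \<open>1 / (1 - s)\<close>, and \<open>\<mu> d s = (1 - s) * \<nu> d s\<close> compensates for this. Hence the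
  bound stays finite up to \<open>s = 1\<close>.\<close>

lemma norm_singular_frac_grad_le:
  assumes s: "0 \<le> s" "s < 1"
  shows "norm (singular_frac_grad s \<phi> x) \<le> \<nu> DIM('a) s * (M * (DIM('a) * unit_ball_vol DIM('a)) + (\<integral>h. \<bar>\<phi> h\<bar> \<partial>lborel))"
proof -
  let ?A = "\<integral>h. \<bar>\<phi> h\<bar> \<partial>lborel" and ?B = "DIM('a) * unit_ball_vol DIM('a)" and ?m = "\<mu> DIM('a) s"
  have m: "0 \<le> ?m" "?m \<le> \<nu> DIM('a) s" "?m = (1 - s) * \<nu> DIM('a) s" using s \<mu>_bounds[of s "DIM('a)"] \<mu>_eq_\<nu>[of s] by auto
  have "norm (singular_frac_grad s \<phi> x) \<le> ?m / 2 * (\<integral>h. majorant s x h \<partial>lborel)"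
    unfolding singular_frac_grad_def norm_scaleR
    using m(1) s by (intro mult_mono Bochner_Integration.integral_norm_bound_integral norm_frac_integrand_le
        majorant_integral frac_integrand_integrable) auto
  also have "\<dots> = ?m / (1 - s) * (M * ?B) + ?m * ?A"
    unfolding majorant_integral(2)[OF s] by (simp add: distrib_left)
  also have "?m / (1 - s) = \<nu> DIM('a) s" using s m(3) by simp
  also have "\<nu> DIM('a) s * (M * ?B) + ?m * ?A \<le> \<nu> DIM('a) s * (M * ?B) + \<nu> DIM('a) s * ?A"
    using m by (intro add_left_mono mult_right_mono) auto
  finally show ?thesis by (simp add: distrib_left)
qed

text \<open>Far away from the support only \<open>h\<close> of length at least \<open>norm x / 2\<close> contribute.\<close>

lemma norm_singular_frac_grad_far:
  assumes s: "0 \<le> s" "s < 1" and x: "2 * R \<le> norm x"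
  shows "norm (singular_frac_grad s \<phi> x) \<le> \<mu> DIM('a) s * (\<integral>h. \<bar>\<phi> h\<bar> \<partial>lborel) * (norm x / 2) powr - real DIM('a)"
proof -
  let ?A = "\<integral>h. \<bar>\<phi> h\<bar> \<partial>lborel" and ?m = "\<mu> DIM('a) s"
  have m: "0 \<le> ?m" using s \<mu>_bounds[of s "DIM('a)"] by auto
  have le: "norm (frac_integrand s \<phi> x h) \<le> (\<bar>\<phi> (x + h)\<bar> + \<bar>\<phi> (x - h)\<bar>) * (norm x / 2) powr - real DIM('a)" for h
  proof (cases "\<phi> (x + h) = 0 \<and> \<phi> (x - h) = 0")
    case False
    then have "norm (x + h) \<le> R \<or> norm (x - h) \<le> R" using outside by (meson not_less)
    moreover have "norm x - norm h \<le> norm (x + h)" "norm x - norm h \<le> norm (x - h)"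
      using norm_triangle_ineq2[of x "- h"] norm_triangle_ineq2[of x h] by simp_all
    ultimately have h: "norm x / 2 \<le> norm h" "1 \<le> norm h" using x R1 by linarith+
    have p: "0 < norm x" using x R1 by linarith
    have "norm h powr - (real DIM('a) + s) \<le> norm h powr - real DIM('a)"
      using h s by (intro powr_mono) auto
    also have "\<dots> \<le> (norm x / 2) powr - real DIM('a)" using h p by (intro powr_mono2') auto
    finally have "\<bar>\<phi> (x + h) - \<phi> (x - h)\<bar> * norm h powr - (real DIM('a) + s) \<le> 
      (\<bar>\<phi> (x + h)\<bar> + \<bar>\<phi> (x - h)\<bar>) * (norm x / 2) powr - real DIM('a)"
      by (intro mult_mono) auto
    then show ?thesis by (simp add: frac_integrand_def norm_frac_kernel)
  qed (simp add: frac_integrand_def)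
  have "norm (singular_frac_grad s \<phi> x) \<le> ?m / 2 * (\<integral>h. (\<bar>\<phi> (x + h)\<bar> + \<bar>\<phi> (x - h)\<bar>) * (norm x / 2) powr - real DIM('a) \<partial>lborel)"
    unfolding singular_frac_grad_def norm_scaleR
    using m(1) s by (intro mult_mono Bochner_Integration.integral_norm_bound_integral le frac_integrand_integrable
       integrable_mult_left Bochner_Integration.integrable_add abs_\<phi>_translates) auto
  also have "\<dots> = ?m / 2 * ((?A + ?A) * (norm x / 2) powr - real DIM('a))"
    using abs_\<phi>_translates[of x] by simp
  finally show ?thesis by simp
qed

text \<open>The decay \<open>(1 + norm x) powr - d\<close>, with a constant that does not depend on the order, is the worst case \<open>s = 0\<close>.
  Its \<open>p\<close>-th power is integrable exactly because \<open>p > 1\<close>.\<close>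

lemma frac_grad_test_decay:
  obtains C where "0 \<le> C" "\<And>s x. s \<in> {0..1} \<Longrightarrow> norm (frac_grad_test s \<phi> x) \<le> C * (1 + norm x) powr - real DIM('a)"
proof -
  let ?A = "\<integral>h. \<bar>\<phi> h\<bar> \<partial>lborel" and ?B = "DIM('a) * unit_ball_vol DIM('a)" and ?d = "real DIM('a)"
  obtain N where N: "0 \<le> N" "\<And>s. s \<in> {0..1} \<Longrightarrow> \<nu> DIM('a) s \<le> N" using \<nu>_bounded by blast
  \<comment> \<open>\<open>C1\<close> handles points with \<open>norm x < 2 * R\<close>, \<open>C2\<close> all others; the summand \<open>M\<close> covers the order one\<close>
  define C1 where "C1 = (N * (M * ?B + ?A) + M) * (1 + 2 * R) powr ?d"
  define C2 where "C2 = N * ?A * 4 powr ?d"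
  have A0: "0 \<le> ?A" by simp
  have B0: "0 \<le> M * ?B + ?A" using M0 A0 by simp
  have C0: "0 \<le> C1" "0 \<le> C2" using N(1) A0 B0 M0 by (auto simp: C1_def C2_def)
  have "norm (frac_grad_test s \<phi> x) \<le> (C1 + C2) * (1 + norm x) powr - ?d" if s: "s \<in> {0..1}" for s x
  proof (cases "2 * R \<le> norm x")
    case False
    have "(1 + norm x) powr ?d \<le> (1 + 2 * R) powr ?d" using False by (intro powr_mono2) auto
    then have one: "1 \<le> (1 + 2 * R) powr ?d * (1 + norm x) powr - ?d"
      by (simp add: powr_minus divide_inverse[symmetric] add_pos_nonneg less_imp_neq[symmetric])
    have "norm (frac_grad_test s \<phi> x) \<le> N * (M * ?B + ?A) + M"
    proof (cases "s = 1")
      case True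
      then show ?thesis using grad_bound[of x] N(1) B0 by (simp add: frac_grad_test_def add_increasing)
    next
      case False
      then have "norm (frac_grad_test s \<phi> x) \<le> \<nu> DIM('a) s * (M * ?B + ?A)"
        using norm_singular_frac_grad_le[of s x] s by (simp add: frac_grad_test_eq_singular)
      also have "\<dots> \<le> N * (M * ?B + ?A)" using N(2)[OF s] B0 by (rule mult_right_mono)
      finally show ?thesis using M0 by simp
    qed
    also have "\<dots> \<le> (N * (M * ?B + ?A) + M) * ((1 + 2 * R) powr ?d * (1 + norm x) powr - ?d)"
      using mult_left_mono[OF one, of "N * (M * ?B + ?A) + M"] N(1) B0 M0 by simp
    also have "\<dots> = C1 * (1 + norm x) powr - ?d" by (simp add: C1_def)
    also have "\<dots> \<le> (C1 + C2) * (1 + norm x) powr - ?d" using C0 by (intro mult_right_mono) auto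
    finally show ?thesis .
  next
    case True
    then have x1: "2 \<le> norm x" using R1 by linarith
    have "norm (frac_grad_test s \<phi> x) \<le> C2 * (1 + norm x) powr - ?d"
    proof (cases "s = 1")
      case True
      have "R < norm x" using \<open>2 * R \<le> norm x\<close> R1 by linarith
      then show ?thesis using grad_outside True C0 by (simp add: frac_grad_test_def)
    next
      case False
      then have "norm (frac_grad_test s \<phi> x) \<le> \<mu> DIM('a) s * ?A * (norm x / 2) powr - ?d"
        using norm_singular_frac_grad_far[of s x] s True by (simp add: frac_grad_test_eq_singular)
      also have "\<dots> \<le> N * ?A * ((1 + norm x) / 4) powr - ?d"
        using \<mu>_bounds[OF s, of "DIM('a)"] N(1) N(2)[OF s] A0 x1 
        by (intro mult_mono powr_mono2' mult_nonneg_nonneg) auto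
      also have "((1 + norm x) / 4) powr - ?d = (1 + norm x) powr - ?d / 4 powr - ?d"
        by (rule powr_divide)
      also have "4 powr - ?d = inverse (4 powr ?d)" by (rule powr_minus)
      finally show ?thesis by (simp add: C2_def divide_inverse mult_ac)
    qed
    also have "\<dots> \<le> (C1 + C2) * (1 + norm x) powr - ?d" using C0 by (intro mult_right_mono) auto
    finally show ?thesis .
  qed
  then show thesis using C0 by (intro that[of "C1 + C2"]) auto
qed

text \<open>Orders that stay below some \<open>t < 1\<close> share an integrable majorant.\<close>

lemma singular_frac_grad_tendsto:
  assumes s: "\<And>n. s n \<in> {0..t}" "s \<longlonglongrightarrow> \<sigma>" and t: "t < 1"
  shows "(\<lambda>n. singular_frac_grad (s n) \<phi> x) \<longlonglongrightarrow> singular_frac_grad \<sigma> \<phi> x"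
proof -
  have "\<sigma> \<in> {0..t}" 
    using closed_sequentially[OF closed_atLeastAtMost[of 0 t] _ s(2)] s(1) by simp
  then have \<sigma>: "0 \<le> \<sigma>" "\<sigma> \<le> t" by auto
  have "(\<lambda>n. \<integral>h. frac_integrand (s n) \<phi> x h \<partial>lborel) \<longlonglongrightarrow> (\<integral>h. frac_integrand \<sigma> \<phi> x h \<partial>lborel)"
  proof (rule integral_dominated_convergence[where w="majorant t x"])
    show "integrable lborel (majorant t x)" using \<sigma> t by (intro majorant_integral) auto
    show "AE h in lborel. (\<lambda>n. frac_integrand (s n) \<phi> x h) \<longlonglongrightarrow> frac_integrand \<sigma> \<phi> x h"
    proof (rule AE_I2)
      fix h
      show "(\<lambda>n. frac_integrand (s n) \<phi> x h) \<longlonglongrightarrow> frac_integrand \<sigma> \<phi> x h"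
        unfolding frac_integrand_def frac_kernel_def
        by (cases "h = 0") (auto intro!: tendsto_intros s(2))
    qed
    show "AE h in lborel. norm (frac_integrand (s n) \<phi> x h) \<le> majorant t x h" for n
      using s(1)[of n] by (intro AE_I2 norm_frac_integrand_le) auto
  qed measurable
  moreover have "(\<lambda>n. \<mu> DIM('a) (s n)) \<longlonglongrightarrow> \<mu> DIM('a) \<sigma>"
  proof (rule \<mu>_tendsto)
    show "s n \<in> {0..1}" for n using s(1)[of n] t by auto
  qed (use s \<sigma> t in auto)
  ultimately show ?thesis unfolding singular_frac_grad_def by (intro tendsto_intros) auto
qed

text \<open>The kernel of the Riesz potential is split at the unit ball. Inside, \<open>gradient \<phi> (x + h)\<close> is replaced by
  \<open>gradient \<phi> x\<close>; the mass of the kernel there is \<open>\<nu> d s * d * V / (d - 1 + s)\<close>, where \<open>V\<close> is the volume of the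
  unit ball, and tends to one. The error and the part outside are bounded integrals times \<open>1 - s\<close>.\<close>

lemma frac_grad_test_near_1:
  assumes s: "0 < s" "s < 1"
  shows "norm (frac_grad_test s \<phi> x - gradient \<phi> x) \<le>
    \<bar>\<nu> DIM('a) s * (DIM('a) * unit_ball_vol DIM('a)) / (real DIM('a) - 1 + s) - 1\<bar> * M +
    (1 - s) * (\<nu> DIM('a) s / (real DIM('a) - 1 + s) * (M * (DIM('a) * unit_ball_vol DIM('a)) + (\<integral>h. norm (gradient \<phi> h) \<partial>lborel)))"
proof -
  let ?B = "DIM('a) * unit_ball_vol DIM('a)" and ?G = "\<integral>h. norm (gradient \<phi> h) \<partial>lborel" and ?g = "gradient \<phi> x"
  define a where "a = real DIM('a) - 1 + s"
  define c where "c = \<mu> DIM('a) s / a"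
  have d1: "1 \<le> real DIM('a)" using DIM_positive[where 'a='a] by linarith
  then have a: "0 < a" "0 \<le> a" "a < real DIM('a)" using s unfolding a_def by linarith+
  have c: "c = (1 - s) * (\<nu> DIM('a) s / a)" "0 \<le> c" using s a \<mu>_bounds[of s "DIM('a)"] by (auto simp: c_def \<mu>_eq_\<nu>)
  define k where "k h = indicator (ball 0 1) h * norm h powr - a" for h :: 'a
  have "has_bochner_integral lborel k (?B / (real DIM('a) - a))"
    unfolding k_def[abs_def] by (rule has_integral_norm_powr_ball[OF a(2,3)])
  then have k: "integrable lborel k" "(\<integral>h. k h \<partial>lborel) = ?B / (1 - s)" by (auto simp: has_bochner_integral_iff a_def)
  \<comment> \<open>the error of replacing the kernel by its restriction to the unit ball and the gradient by its value at \<open>x\<close>\<close>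
  define Z where "Z h = norm h powr - a *\<^sub>R gradient \<phi> (x + h) - k h *\<^sub>R ?g" for h
  have iG: "integrable lborel (\<lambda>h. norm h powr - a *\<^sub>R gradient \<phi> (x + h))"
    by (rule integrable_norm_powr_times[where K=M, OF gradient_measurable grad_bound grad_outside a(2,3)])
  have iZ: "integrable lborel Z"
    unfolding Z_def[abs_def] by (intro Bochner_Integration.integrable_diff iG integrable_scaleR_left k(1)) 
  have ig: "integrable lborel (\<lambda>h. norm (gradient \<phi> h))"
    by (intro integrable_norm integrable_bounded_support[OF gradient_measurable grad_bound grad_outside])
  have igx: "integrable lborel (\<lambda>h. norm (gradient \<phi> (x + h)))" "(\<integral>h. norm (gradient \<phi> (x + h)) \<partial>lborel) = ?G"
    using ig lborel_integrable_translate[of "\<lambda>h. norm (gradient \<phi> h)" x] lborel_integral_translate[of "\<lambda>h. norm (gradient \<phi> h)" x] by auto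
  \<comment> \<open>a bound of \<open>norm h powr (1 - a)\<close> inside the unit ball that does not depend on \<open>s\<close>\<close>
  define w where "w h = indicator (ball 0 1) h * norm h powr - (real DIM('a) - 1)" for h :: 'a
  have "has_bochner_integral lborel w (?B / (real DIM('a) - (real DIM('a) - 1)))"
    unfolding w_def[abs_def] using d1 by (intro has_integral_norm_powr_ball) auto
  then have w: "integrable lborel w" "(\<integral>h. w h \<partial>lborel) = ?B" by (auto simp: has_bochner_integral_iff)
  have Zle: "norm (Z h) \<le> M * w h + norm (gradient \<phi> (x + h))" for h
  proof (cases "norm h < 1")
    case True
    have "Z h = norm h powr - a *\<^sub>R (gradient \<phi> (x + h) - ?g)" using True by (simp add: Z_def k_def scaleR_diff_right)
    then have "norm (Z h) = norm h powr - a * norm (gradient \<phi> (x + h) - ?g)" by simp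
    also have "\<dots> \<le> norm h powr - a * (M * norm h)" using grad_lipschitz[of "x + h" x] by (intro mult_left_mono) auto
    also have "\<dots> = M * norm h powr (1 - a)"
    proof (cases "h = 0")
      case False
      have "norm h powr - a * norm h powr 1 = norm h powr (1 - a)" by (simp only: powr_add[symmetric]) simp
      then show ?thesis using False by simp
    qed simp
    also have "\<dots> \<le> M * norm h powr - (real DIM('a) - 1)"
      using True M0 s by (cases "h = 0") (auto intro!: mult_left_mono powr_mono' simp: a_def)
    also have "\<dots> \<le> M * w h + norm (gradient \<phi> (x + h))" using True by (simp add: w_def)
    finally show ?thesis .
  next
    case False
    then have "norm h powr - a \<le> 1" using powr_mono2'[of "- a" 1 "norm h"] a by simp
    then show ?thesis using False by (simp add: Z_def k_def w_def mult_left_le_one_le)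
  qed
  have Zint: "norm (\<integral>h. Z h \<partial>lborel) \<le> M * ?B + ?G"
  proof -
    have "norm (\<integral>h. Z h \<partial>lborel) \<le> (\<integral>h. M * w h + norm (gradient \<phi> (x + h)) \<partial>lborel)"
      by (intro Bochner_Integration.integral_norm_bound_integral iZ Zle Bochner_Integration.integrable_add integrable_mult_right w igx)
    then show ?thesis using w igx by simp
  qed
  have "frac_grad_test s \<phi> x = c *\<^sub>R (\<integral>h. norm h powr - a *\<^sub>R gradient \<phi> (x + h) \<partial>lborel)"
    using frac_grad_test_eq_riesz_gradient[OF s, of x] by (simp add: c_def a_def)
  also have "(\<integral>h. norm h powr - a *\<^sub>R gradient \<phi> (x + h) \<partial>lborel) = (\<integral>h. k h *\<^sub>R ?g + Z h \<partial>lborel)"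
    by (simp add: Z_def)
  also have "\<dots> = (?B / (1 - s)) *\<^sub>R ?g + (\<integral>h. Z h \<partial>lborel)"
    using k iZ by (subst Bochner_Integration.integral_add) auto
  finally have "frac_grad_test s \<phi> x - ?g = (c * (?B / (1 - s)) - 1) *\<^sub>R ?g + c *\<^sub>R (\<integral>h. Z h \<partial>lborel)"
    by (simp add: algebra_simps)
  also have "c * (?B / (1 - s)) = \<nu> DIM('a) s * ?B / a" using s by (simp add: c(1))
  also have "norm ((\<nu> DIM('a) s * ?B / a - 1) *\<^sub>R ?g + c *\<^sub>R (\<integral>h. Z h \<partial>lborel)) \<le> \<bar>\<nu> DIM('a) s * ?B / a - 1\<bar> * norm ?g + c * norm (\<integral>h. Z h \<partial>lborel)"
    using c(2) by (intro order_trans[OF norm_triangle_ineq]) simp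
  also have "\<dots> \<le> \<bar>\<nu> DIM('a) s * ?B / a - 1\<bar> * M + c * (M * ?B + ?G)"
    using c(2) by (intro add_mono mult_left_mono grad_bound Zint) auto
  finally show ?thesis unfolding c(1) a_def by (simp only: mult.assoc)
qed

lemma frac_grad_test_tendsto:
  assumes s: "\<And>n. s n \<in> {0..1}" and \<sigma>: "\<sigma> \<in> {0..1}" and lim: "s \<longlonglongrightarrow> \<sigma>"
  shows "(\<lambda>n. frac_grad_test (s n) \<phi> x) \<longlonglongrightarrow> frac_grad_test \<sigma> \<phi> x"
proof (cases "\<sigma> = 1")
  case False
  define t where "t = (1 + \<sigma>) / 2"
  have t: "\<sigma> < t" "t < 1" "0 \<le> t" using False \<sigma> by (auto simp: t_def)
  \<comment> \<open>capping the orders at \<open>t\<close> changes only finitely many of them\<close>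
  have "(\<lambda>n. min (s n) t) \<longlonglongrightarrow> min \<sigma> t" by (intro tendsto_intros lim)
  then have "(\<lambda>n. singular_frac_grad (min (s n) t) \<phi> x) \<longlonglongrightarrow> singular_frac_grad \<sigma> \<phi> x"
    using s t by (intro singular_frac_grad_tendsto[of _ t]) auto
  moreover have "\<forall>\<^sub>F n in sequentially. singular_frac_grad (min (s n) t) \<phi> x = frac_grad_test (s n) \<phi> x"
    using order_tendstoD(2)[OF lim t(1)]
  proof eventually_elim
    fix n assume "s n < t"
    then show "singular_frac_grad (min (s n) t) \<phi> x = frac_grad_test (s n) \<phi> x"
      using s[of n] t by (simp add: frac_grad_test_eq_singular)
  qed
  ultimately show ?thesis
    using False \<sigma> by (auto simp: frac_grad_test_eq_singular intro: Lim_transform_eventually)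
next
  case True
  let ?B = "DIM('a) * unit_ball_vol DIM('a)" and ?G = "\<integral>h. norm (gradient \<phi> h) \<partial>lborel"
  define E where "E s = \<bar>\<nu> DIM('a) s * ?B / (real DIM('a) - 1 + s) - 1\<bar> * M +
    (1 - s) * (\<nu> DIM('a) s / (real DIM('a) - 1 + s) * (M * ?B + ?G))" for s
  have \<nu>: "(\<lambda>n. \<nu> DIM('a) (s n)) \<longlonglongrightarrow> \<nu> DIM('a) 1" using \<nu>_tendsto[OF s] lim True by simp
  have lim1: "s \<longlonglongrightarrow> 1" using lim True by simp
  have "(\<lambda>n. E (s n)) \<longlonglongrightarrow> \<bar>\<nu> DIM('a) 1 * ?B / (real DIM('a) - 1 + 1) - 1\<bar> * M +
    (1 - 1) * (\<nu> DIM('a) 1 / (real DIM('a) - 1 + 1) * (M * ?B + ?G))"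
    unfolding E_def by (intro tendsto_intros \<nu> lim1) auto
  also have "\<nu> DIM('a) 1 * ?B / (real DIM('a) - 1 + 1) = 1"
    using \<nu>_1[of "DIM('a)"] by (simp add: mult_ac)
  finally have E: "(\<lambda>n. E (s n)) \<longlonglongrightarrow> 0" by simp
  have "(\<lambda>n. frac_grad_test (s n) \<phi> x - gradient \<phi> x) \<longlonglongrightarrow> 0"
  proof (rule Lim_null_comparison[OF _ E])
    have "\<forall>\<^sub>F n in sequentially. 0 < s n" using lim1 by (intro order_tendstoD) auto
    then show "\<forall>\<^sub>F n in sequentially. norm (frac_grad_test (s n) \<phi> x - gradient \<phi> x) \<le> E (s n)"
    proof eventually_elim
      fix n assume "0 < s n"
      show "norm (frac_grad_test (s n) \<phi> x - gradient \<phi> x) \<le> E (s n)"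
      proof (cases "s n = 1")
        case True
        then show ?thesis using M0 by (simp add: frac_grad_test_def E_def)
      next
        case False
        then show ?thesis using frac_grad_test_near_1[of "s n" x] \<open>0 < s n\<close> s[of n] by (simp add: E_def)
      qed
    qed
  qed
  then show ?thesis using True by (simp add: frac_grad_test_def LIM_zero_iff)
qed

end

section \<open>Antisymmetry of the fractional gradient\<close>

text \<open>The kernel is odd, so shifting \<open>x\<close> by \<open>h\<close> moves the symmetric difference from one factor to the other and
  changes the sign. Fubini applies since the majorant of the inner integral has an integral independent of \<open>x\<close>.\<close>

lemma singular_frac_grad_duality:
  assumes "bounded_test_function \<phi> R M" "bounded_test_function \<psi> R' M'" and s: "0 \<le> s" "s < 1"
  shows "(\<integral>x. \<phi> x * (singular_frac_grad s \<psi> x \<bullet> b) \<partial>lborel) = - (\<integral>x. \<psi> x * (singular_frac_grad s \<phi> x \<bullet> b) \<partial>lborel)"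
proof -
  define P where "P f g x h = f x * (frac_integrand s g x h \<bullet> b)" for f g :: "'a \<Rightarrow> real" and x h
  have int: "integrable (lborel \<Otimes>\<^sub>M lborel) (\<lambda>(x, h). P f g x h)"
    and eq: "(\<integral>x. f x * (singular_frac_grad s g x \<bullet> b) \<partial>lborel) = \<mu> DIM('a) s / 2 * (\<integral>x. (\<integral>h. P f g x h \<partial>lborel) \<partial>lborel)"
    if f: "bounded_test_function f R M" and g: "bounded_test_function g R' M'" for f g :: "'a \<Rightarrow> real" and R M R' M'
  proof -
    interpret f: bounded_test_function f R M by fact
    interpret g: bounded_test_function g R' M' by fact
    have [measurable]: "(\<lambda>(x, h). P f g x h) \<in> borel_measurable (lborel \<Otimes>\<^sub>M lborel)"
      unfolding P_def frac_integrand_def by measurable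
    have iP: "integrable lborel (P f g x)" for x
      unfolding P_def[abs_def] by (intro integrable_mult_right integrable_inner_left g.frac_integrand_integrable s)
    define K where "K = (\<integral>h. g.majorant s 0 h \<partial>lborel)"
    have K: "(\<integral>h. g.majorant s x h \<partial>lborel) = K" for x unfolding K_def g.majorant_integral(2)[OF s] ..
    show "integrable (lborel \<Otimes>\<^sub>M lborel) (\<lambda>(x, h). P f g x h)"
    proof (rule lborel_pair.Fubini_integrable)
      show "AE x in lborel. integrable lborel (\<lambda>y. case (x, y) of (x, h) \<Rightarrow> P f g x h)" using iP by simp
      show "integrable lborel (\<lambda>x. LINT y|lborel. norm (case (x, y) of (x, h) \<Rightarrow> P f g x h))"
      proof (rule Bochner_Integration.integrable_bound)
        show "integrable lborel (\<lambda>x. \<bar>f x\<bar> * (norm b * K))" by (intro integrable_mult_left f.abs_\<phi>_integrable)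
        show "AE x in lborel. norm (LINT y|lborel. norm (case (x, y) of (x, h) \<Rightarrow> P f g x h)) \<le> norm (\<bar>f x\<bar> * (norm b * K))"
        proof (rule AE_I2)
          fix x
          have "norm (LINT y|lborel. norm (P f g x y)) \<le> (LINT h|lborel. \<bar>f x\<bar> * norm b * g.majorant s x h)"
          proof (rule Bochner_Integration.integral_norm_bound_integral)
            fix h
            have "\<bar>frac_integrand s g x h \<bullet> b\<bar> \<le> g.majorant s x h * norm b"
              using Cauchy_Schwarz_ineq2[of "frac_integrand s g x h" b] 
                mult_right_mono[OF g.norm_frac_integrand_le[OF s(1) order_refl, of x h] norm_ge_zero[of b]] by linarith
            from mult_left_mono[OF this, of "\<bar>f x\<bar>"]
            show "norm (norm (P f g x h)) \<le> \<bar>f x\<bar> * norm b * g.majorant s x h"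
              by (simp add: P_def abs_mult mult_ac)
          qed (use iP g.majorant_integral(1)[OF s] in auto)
          also have "\<dots> \<le> norm (\<bar>f x\<bar> * (norm b * K))" by (simp add: K abs_mult mult.assoc mult_left_mono)
          finally show "norm (LINT y|lborel. norm (case (x, y) of (x, h) \<Rightarrow> P f g x h)) \<le> norm (\<bar>f x\<bar> * (norm b * K))" by simp
        qed
      qed measurable
    qed measurable
    have "f x * (singular_frac_grad s g x \<bullet> b) = \<mu> DIM('a) s / 2 * (\<integral>h. P f g x h \<partial>lborel)" for x
      using g.frac_integrand_integrable[OF s, of x] by (simp add: singular_frac_grad_def P_def)
    then show "(\<integral>x. f x * (singular_frac_grad s g x \<bullet> b) \<partial>lborel) = \<mu> DIM('a) s / 2 * (\<integral>x. (\<integral>h. P f g x h \<partial>lborel) \<partial>lborel)"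
      by (simp only: integral_mult_right_zero)
  qed
  interpret f: bounded_test_function \<phi> R M by fact
  interpret g: bounded_test_function \<psi> R' M' by fact
  have swap: "(\<integral>x. P \<phi> \<psi> x h \<partial>lborel) = - (\<integral>x. P \<psi> \<phi> x h \<partial>lborel)" for h
  proof -
    let ?k = "frac_kernel s h \<bullet> b"
    have i: "integrable lborel (\<lambda>x. \<phi> (x + c) * \<psi> (x + c'))" for c c'
    proof (rule integrable_bounded_support)
      show "norm (\<phi> (x + c) * \<psi> (x + c')) \<le> M * M'" for x
        using f.bound g.bound f.M0 by (auto simp: abs_mult intro!: mult_mono)
      show "\<phi> (x + c) * \<psi> (x + c') = 0" if "R + norm c < norm x" for x
      proof -
        have "norm x \<le> norm (x + c) + norm c" using norm_triangle_ineq4[of "x + c" c] by simp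
        then show ?thesis using that f.outside[of "x + c"] by simp
      qed
    qed measurable
    have t: "(\<integral>x. \<phi> (x + c) * \<psi> x \<partial>lborel) = (\<integral>x. \<phi> x * \<psi> (x - c) \<partial>lborel)" for c
      using lborel_integral_translate[of "\<lambda>x. \<phi> x * \<psi> (x - c)" c] by (simp add: add.commute)
    have "(\<integral>x. P \<phi> \<psi> x h \<partial>lborel) = (\<integral>x. ?k * (\<phi> x * \<psi> (x + h)) - ?k * (\<phi> x * \<psi> (x - h)) \<partial>lborel)"
      by (simp add: P_def frac_integrand_def algebra_simps)
    also have "\<dots> = ?k * (\<integral>x. \<phi> x * \<psi> (x + h) \<partial>lborel) - ?k * (\<integral>x. \<phi> x * \<psi> (x - h) \<partial>lborel)"
      using i[of 0 h] i[of 0 "- h"] by (subst Bochner_Integration.integral_diff) auto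
    also have "\<dots> = ?k * (\<integral>x. \<phi> (x - h) * \<psi> x \<partial>lborel) - ?k * (\<integral>x. \<phi> (x + h) * \<psi> x \<partial>lborel)"
      using t[of h] t[of "- h"] by simp
    also have "\<dots> = - (\<integral>x. ?k * (\<phi> (x + h) * \<psi> x) - ?k * (\<phi> (x - h) * \<psi> x) \<partial>lborel)"
      using i[of h 0] i[of "- h" 0] by (subst Bochner_Integration.integral_diff) auto
    also have "\<dots> = - (\<integral>x. P \<psi> \<phi> x h \<partial>lborel)"
      by (simp add: P_def frac_integrand_def algebra_simps)
    finally show ?thesis .
  qed
  have "(\<integral>x. (\<integral>h. P \<phi> \<psi> x h \<partial>lborel) \<partial>lborel) = (\<integral>h. (\<integral>x. P \<phi> \<psi> x h \<partial>lborel) \<partial>lborel)"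
    using lborel_pair.Fubini_integral[OF int[OF assms(1,2)]] by simp
  also have "\<dots> = - (\<integral>h. (\<integral>x. P \<psi> \<phi> x h \<partial>lborel) \<partial>lborel)" by (simp add: swap)
  also have "(\<integral>h. (\<integral>x. P \<psi> \<phi> x h \<partial>lborel) \<partial>lborel) = (\<integral>x. (\<integral>h. P \<psi> \<phi> x h \<partial>lborel) \<partial>lborel)"
    using lborel_pair.Fubini_integral[OF int[OF assms(2,1)]] by simp
  finally show ?thesis using eq[OF assms(1,2)] eq[OF assms(2,1)] by simp
qed

lemma frac_grad_test_duality:
  assumes \<phi>: "bounded_test_function \<phi> R M" and \<psi>: "bounded_test_function \<psi> R' M'" and s: "s \<in> {0..1}"
  shows "(\<integral>x. \<phi> x * (frac_grad_test s \<psi> x \<bullet> b) \<partial>lborel) = - (\<integral>x. \<psi> x * (frac_grad_test s \<phi> x \<bullet> b) \<partial>lborel)"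
proof -
  interpret f: bounded_test_function \<phi> R M by fact
  interpret g: bounded_test_function \<psi> R' M' by fact
  show ?thesis
  proof (cases "s = 1")
    case False
    then show ?thesis using singular_frac_grad_duality[OF \<phi> \<psi>, of s b] s
      by (simp add: f.frac_grad_test_eq_singular g.frac_grad_test_eq_singular)
  next
    case True
    have "(\<integral>x. \<phi> x * (b \<bullet> gradient \<psi> x) + (b \<bullet> gradient \<phi> x) * \<psi> x \<partial>lborel) = 0"
    proof (rule integral_directional_derivative_0[where R=R])
      show "((\<lambda>x. \<phi> x * \<psi> x) has_derivative (\<lambda>h. \<phi> x * (h \<bullet> gradient \<psi> x) + (h \<bullet> gradient \<phi> x) * \<psi> x)) (at x)" for x
        using f.\<phi>_GDERIV[of x] g.\<phi>_GDERIV[of x] unfolding gderiv_def by (rule has_derivative_mult)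
      show "continuous_on UNIV (\<lambda>x. \<phi> x * (b \<bullet> gradient \<psi> x) + (b \<bullet> gradient \<phi> x) * \<psi> x)"
        by (intro continuous_intros f.\<phi>_continuous g.\<phi>_continuous f.gradient_continuous g.gradient_continuous)
    qed (simp add: f.outside)
    moreover have "integrable lborel (\<lambda>x. \<phi> x * (b \<bullet> gradient \<psi> x))" "integrable lborel (\<lambda>x. (b \<bullet> gradient \<phi> x) * \<psi> x)"
    proof -
      have le: "\<bar>b \<bullet> v\<bar> \<le> norm b * K" if "norm v \<le> K" for v K
        using Cauchy_Schwarz_ineq2[of b v] mult_left_mono[OF that norm_ge_zero[of b]] by linarith
      show "integrable lborel (\<lambda>x. \<phi> x * (b \<bullet> gradient \<psi> x))"
        by (rule integrable_bounded_support[where K="M * (norm b * M')" and R=R])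
         (auto simp: f.outside abs_mult intro!: mult_mono f.bound le g.grad_bound f.M0)
      show "integrable lborel (\<lambda>x. (b \<bullet> gradient \<phi> x) * \<psi> x)"
        by (rule integrable_bounded_support[where K="(norm b * M) * M'" and R=R])
         (auto simp: f.grad_outside abs_mult intro!: mult_mono g.bound le f.grad_bound f.M0 mult_nonneg_nonneg)
    qed
    ultimately show ?thesis using True by (simp add: frac_grad_test_def inner_commute mult.commute)
  qed
qed

section \<open>Lebesgue spaces and the weak fractional gradient\<close>

lemma lebesgue_measurable_if_borel: "f \<in> borel_measurable borel \<Longrightarrow> f \<in> borel_measurable lebesgue"
  by (simp add: measurable_completion)

lemma integrable_lebesgue_if_lborel: "integrable lborel f \<Longrightarrow> integrable lebesgue f"
  for f :: "'a::euclidean_space \<Rightarrow> 'b::{banach, second_countable_topology}"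
  by (simp add: integrable_completion borel_measurable_integrable)

lemma decay_powr_integrable:
  fixes f :: "'a::euclidean_space \<Rightarrow> 'b::euclidean_space"
  assumes p: "1 < p" and [measurable]: "f \<in> borel_measurable borel"
    and f: "\<And>x. norm (f x) \<le> C * (1 + norm x) powr - real DIM('a)"
  shows "integrable lborel (\<lambda>x. norm (f x) powr p)"
    and "norm (f x) powr p \<le> C powr p * (1 + norm x) powr - (real DIM('a) * p)"
    and "integrable lborel (\<lambda>x::'a. C powr p * (1 + norm x) powr - (real DIM('a) * p))"
proof -
  have C: "0 \<le> C" using order_trans[OF norm_ge_zero f[of 0]] by simp
  show le: "norm (f x) powr p \<le> C powr p * (1 + norm x) powr - (real DIM('a) * p)" for x
  proof -
    have "norm (f x) powr p \<le> (C * (1 + norm x) powr - real DIM('a)) powr p"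
      using p by (intro powr_mono2 f) auto
    then show ?thesis using C by (simp add: powr_mult powr_powr)
  qed
  show i: "integrable lborel (\<lambda>x::'a. C powr p * (1 + norm x) powr - (real DIM('a) * p))"
    using p by (intro integrable_mult_right integrable_one_plus_norm_powr) auto
  show "integrable lborel (\<lambda>x. norm (f x) powr p)"
    by (rule Bochner_Integration.integrable_bound[OF i]) (use le in \<open>auto intro!: AE_I2 order_trans[OF _ abs_ge_self]\<close>)
qed

lemma decay_imp_Lp:
  fixes f :: "'a::euclidean_space \<Rightarrow> 'b::euclidean_space"
  assumes p: "1 < p" and f: "f \<in> borel_measurable borel" "\<And>x. norm (f x) \<le> C * (1 + norm x) powr - real DIM('a)"
  shows "f \<in> Lp p"
  using decay_powr_integrable(1)[OF p f] f(1)
  by (simp add: Lp_def lebesgue_measurable_if_borel integrable_lebesgue_if_lborel)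

text \<open>Young's inequality with the conjugate exponent: a function that decays like \<open>(1 + norm x) powr - d\<close> lies in every
  Lebesgue space with exponent greater than one.\<close>

lemma Lp_decay_integrable:
  fixes u v :: "'a::euclidean_space \<Rightarrow> real"
  assumes p: "1 < p" and u: "u \<in> Lp p" 
    and v[measurable]: "v \<in> borel_measurable borel" "\<And>x. norm (v x) \<le> C * (1 + norm x) powr - real DIM('a)"
  shows "integrable lebesgue (\<lambda>x. u x * v x)"
proof -
  define q where "q = p / (p - 1)"
  have q: "1 < q" "1 / p + 1 / q = 1" using p by (auto simp: q_def field_simps)
  have iu: "integrable lebesgue (\<lambda>x. norm (u x) powr p)" and mu: "u \<in> borel_measurable lebesgue" using u by (auto simp: Lp_def)
  have iv: "integrable lebesgue (\<lambda>x. norm (v x) powr q)" 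
    using decay_imp_Lp[OF q(1) v] by (simp add: Lp_def)
  show ?thesis
  proof (rule Bochner_Integration.integrable_bound)
    show "integrable lebesgue (\<lambda>x. norm (u x) powr p / p + norm (v x) powr q / q)"
      by (intro Bochner_Integration.integrable_add integrable_divide iu iv)
    show "(\<lambda>x. u x * v x) \<in> borel_measurable lebesgue"
      by (intro borel_measurable_times mu lebesgue_measurable_if_borel v(1))
    show "AE x in lebesgue. norm (u x * v x) \<le> norm (norm (u x) powr p / p + norm (v x) powr q / q)"
    proof (rule AE_I2)
      fix x
      have "\<bar>u x\<bar> * \<bar>v x\<bar> \<le> \<bar>u x\<bar> powr p / p + \<bar>v x\<bar> powr q / q"
        using p q by (intro Youngs_inequality) auto
      then show "norm (u x * v x) \<le> norm (norm (u x) powr p / p + norm (v x) powr q / q)"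
        by (simp add: abs_mult)
    qed
  qed
qed

lemma Lp_subset_L1_loc:
  fixes f :: "'a::euclidean_space \<Rightarrow> 'a"
  assumes p: "1 < p" and f: "f \<in> Lp p"
  shows "f \<in> L1_loc"
  unfolding L1_loc_def
proof (intro CollectI allI impI)
  fix C :: "'a set" assume C: "compact C"
  have bC: "C \<in> sets borel" using compact_imp_closed[OF C] by simp
  show "set_integrable lebesgue C f"
    unfolding set_integrable_def
  proof (rule Bochner_Integration.integrable_bound)
    have "integrable lborel (indicat_real C)"
      using C bC emeasure_bounded_finite[OF compact_imp_bounded[OF C]] by (intro integrable_real_indicator) auto
    then show "integrable lebesgue (\<lambda>x. indicat_real C x + norm (f x) powr p)"
      using f integrable_lebesgue_if_lborel[of "indicat_real C"]
      by (intro Bochner_Integration.integrable_add) (auto simp: Lp_def)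
    show "(\<lambda>x. indicat_real C x *\<^sub>R f x) \<in> borel_measurable lebesgue"
    proof (rule borel_measurable_scaleR)
      show "indicat_real C \<in> borel_measurable lebesgue"
        using bC by (intro lebesgue_measurable_if_borel borel_measurable_indicator) simp
    qed (use f in \<open>simp add: Lp_def\<close>)
    show "AE x in lebesgue. norm (indicat_real C x *\<^sub>R f x) \<le> norm (indicat_real C x + norm (f x) powr p)"
    proof (rule AE_I2)
      fix x
      have "norm (f x) \<le> 1 + norm (f x) powr p"
      proof (cases "norm (f x) \<le> 1")
        case False
        then have "norm (f x) powr 1 \<le> norm (f x) powr p" using p by (intro powr_mono) auto
        then show ?thesis using False by simp
      qed (simp add: add_increasing2)
      then show "norm (indicat_real C x *\<^sub>R f x) \<le> norm (indicat_real C x + norm (f x) powr p)"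
        by (simp add: indicator_def)
    qed
  qed
qed

lemma test_function_borel: "\<phi> \<in> test_functions \<Omega> \<Longrightarrow> \<phi> \<in> borel_measurable borel"
  by (rule borel_measurable_continuous_onI) (rule test_functionD(2))

lemma L1_loc_test_integrable:
  fixes G :: "'a::euclidean_space \<Rightarrow> 'a"
  assumes G: "G \<in> L1_loc" and \<Phi>: "\<Phi> \<in> test_functions UNIV"
  shows "integrable lebesgue (\<lambda>x. G x \<bullet> \<Phi> x)"
proof -
  obtain R where R: "\<And>x. R < norm x \<Longrightarrow> \<Phi> x = 0" by (rule test_function_support[OF \<Phi>]) blast
  obtain M where M: "0 \<le> M" "\<And>x. norm (\<Phi> x) \<le> M" by (rule test_function_bounded[OF \<Phi>]) blast
  have i: "integrable lebesgue (\<lambda>x. indicat_real (cball 0 R) x *\<^sub>R G x)"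
    using G compact_cball by (auto simp: L1_loc_def set_integrable_def)
  have e: "(\<lambda>x. G x \<bullet> \<Phi> x) = (\<lambda>x. (indicat_real (cball 0 R) x *\<^sub>R G x) \<bullet> \<Phi> x)"
    using R by (auto simp: fun_eq_iff indicator_def not_le)
  show ?thesis unfolding e
  proof (rule Bochner_Integration.integrable_bound)
    show "integrable lebesgue (\<lambda>x. norm (indicat_real (cball 0 R) x *\<^sub>R G x) * M)"
      by (intro integrable_mult_left integrable_norm i)
    show "(\<lambda>x. (indicat_real (cball 0 R) x *\<^sub>R G x) \<bullet> \<Phi> x) \<in> borel_measurable lebesgue"
      by (intro borel_measurable_inner borel_measurable_integrable[OF i] lebesgue_measurable_if_borel test_function_borel[OF \<Phi>])
    show "AE x in lebesgue. norm ((indicat_real (cball 0 R) x *\<^sub>R G x) \<bullet> \<Phi> x) \<le> norm (norm (indicat_real (cball 0 R) x *\<^sub>R G x) * M)"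
    proof (rule AE_I2)
      fix x
      have "norm ((indicat_real (cball 0 R) x *\<^sub>R G x) \<bullet> \<Phi> x) \<le> norm (indicat_real (cball 0 R) x *\<^sub>R G x) * norm (\<Phi> x)"
        unfolding real_norm_def by (rule Cauchy_Schwarz_ineq2)
      also have "\<dots> \<le> norm (indicat_real (cball 0 R) x *\<^sub>R G x) * M" by (intro mult_left_mono M) simp
      finally show "norm ((indicat_real (cball 0 R) x *\<^sub>R G x) \<bullet> \<Phi> x) \<le> norm (norm (indicat_real (cball 0 R) x *\<^sub>R G x) * M)"
        using M(1) by simp
    qed
  qed
qed

lemma test_function_component:
  assumes \<Phi>: "\<Phi> \<in> test_functions \<Omega>"
  shows "(\<lambda>x. \<Phi> x \<bullet> b) \<in> test_functions \<Omega>"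
proof -
  have "closure {x. \<Phi> x \<bullet> b \<noteq> 0} \<subseteq> closure {x. \<Phi> x \<noteq> 0}" by (intro closure_mono) auto
  moreover from this have "compact (closure {x. \<Phi> x \<bullet> b \<noteq> 0})"
    using test_functionD(4)[OF \<Phi>] by (meson bounded_subset closed_closure compact_eq_bounded_closed)
  moreover have "C_k k (\<lambda>x. \<Phi> x \<bullet> b)" for k
    by (rule C_k_bounded_linear[OF bounded_linear_inner_left test_functionD(1)[OF \<Phi>]])
  ultimately show ?thesis using \<Phi> by (auto simp: test_functions_def)
qed

lemma test_function_Lp:
  fixes \<phi> :: "'a::euclidean_space \<Rightarrow> real"
  assumes \<phi>: "\<phi> \<in> test_functions \<Omega>" and p: "1 < p"
  shows "\<phi> \<in> Lp p"
proof -
  obtain R where R: "\<And>x. R < norm x \<Longrightarrow> \<phi> x = 0" by (rule test_function_support[OF \<phi>]) blast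
  obtain M where M: "\<And>x. norm (\<phi> x) \<le> M" by (rule test_function_bounded[OF \<phi>]) blast
  have [measurable]: "\<phi> \<in> borel_measurable borel" by (rule test_function_borel[OF \<phi>])
  have "integrable lborel (\<lambda>x. norm (\<phi> x) powr p)"
  proof (rule integrable_bounded_support)
    show "norm (norm (\<phi> x) powr p) \<le> M powr p" for x using M[of x] p by (simp add: powr_mono2)
  qed (use R in auto)
  then show ?thesis by (simp add: Lp_def lebesgue_measurable_if_borel integrable_lebesgue_if_lborel)
qed

lemma frac_grad_test_Lp:
  assumes \<phi>: "\<phi> \<in> test_functions \<Omega>" and s: "s \<in> {0..1}" and p: "1 < p"
  shows "frac_grad_test s \<phi> \<in> Lp p"
proof -
  obtain R M where "bounded_test_function \<phi> R M" by (rule test_function_bounds[OF \<phi>])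
  then interpret bounded_test_function \<phi> R M .
  obtain C where "\<And>x. norm (frac_grad_test s \<phi> x) \<le> C * (1 + norm x) powr - real DIM('a)"
    using frac_grad_test_decay s by metis
  then show ?thesis by (intro decay_imp_Lp p frac_grad_test_measurable s)
qed

text \<open>Pointwise convergence and the decay estimate, which is uniform in the order, allow dominated convergence.\<close>

lemma frac_grad_test_Lp_tendsto:
  fixes \<phi> :: "'a::euclidean_space \<Rightarrow> real"
  assumes \<phi>: "\<phi> \<in> test_functions \<Omega>" and p: "1 < p" 
    and s: "\<And>n. s n \<in> {0..1}" "\<sigma> \<in> {0..1}" "s \<longlonglongrightarrow> \<sigma>"
  shows "(\<lambda>n. \<integral>x. norm (frac_grad_test (s n) \<phi> x - frac_grad_test \<sigma> \<phi> x) powr p \<partial>lebesgue) \<longlonglongrightarrow> 0"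
proof -
  obtain R M where "bounded_test_function \<phi> R M" by (rule test_function_bounds[OF \<phi>])
  then interpret bounded_test_function \<phi> R M .
  obtain C where C: "\<And>s x. s \<in> {0..1} \<Longrightarrow> norm (frac_grad_test s \<phi> x) \<le> C * (1 + norm x) powr - real DIM('a)"
    using frac_grad_test_decay by metis
  define f where "f n x = frac_grad_test (s n) \<phi> x - frac_grad_test \<sigma> \<phi> x" for n x
  have m[measurable]: "f n \<in> borel_measurable borel" for n
    unfolding f_def[abs_def] by (intro borel_measurable_diff frac_grad_test_measurable s)
  have le: "norm (f n x) \<le> (2 * C) * (1 + norm x) powr - real DIM('a)" for n x
    using norm_triangle_ineq4[of "frac_grad_test (s n) \<phi> x" "frac_grad_test \<sigma> \<phi> x"] C[OF s(1), of n x] C[OF s(2), of x]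
    unfolding f_def by linarith
  have "(\<lambda>n. \<integral>x. norm (f n x) powr p \<partial>lborel) \<longlonglongrightarrow> (\<integral>x. 0 \<partial>(lborel :: 'a measure))"
  proof (rule integral_dominated_convergence[where w="\<lambda>x. (2 * C) powr p * (1 + norm x) powr - (real DIM('a) * p)"])
    show "integrable lborel (\<lambda>x::'a. (2 * C) powr p * (1 + norm x) powr - (real DIM('a) * p))"
      by (rule decay_powr_integrable(3)[OF p m le])
    show "AE x in lborel. norm (norm (f n x) powr p) \<le> (2 * C) powr p * (1 + norm x) powr - (real DIM('a) * p)" for n
      using decay_powr_integrable(2)[OF p m le] by simp
    show "AE x in lborel. (\<lambda>n. norm (f n x) powr p) \<longlonglongrightarrow> 0"
    proof (rule AE_I2)
      fix x
      have "(\<lambda>n. f n x) \<longlonglongrightarrow> 0"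
        unfolding f_def using frac_grad_test_tendsto[OF s, of x] by (simp add: LIM_zero)
      then show "(\<lambda>n. norm (f n x) powr p) \<longlonglongrightarrow> 0"
        using p by (intro tendsto_zero_powrI[of _ _ _ p] tendsto_norm_zero tendsto_const) auto
    qed
  qed auto
  moreover have "(\<integral>x. norm (f n x) powr p \<partial>lebesgue) = (\<integral>x. norm (f n x) powr p \<partial>lborel)" for n
    by (rule integral_completion) measurable
  ultimately show ?thesis by (simp add: f_def)
qed

lemma frac_div_test_decay:
  fixes \<Phi> :: "'a::euclidean_space \<Rightarrow> 'a"
  assumes \<Phi>: "\<Phi> \<in> test_functions UNIV" and s: "s \<in> {0..1}"
  obtains C where "frac_div_test s \<Phi> \<in> borel_measurable borel"
    "\<And>x. norm (frac_div_test s \<Phi> x) \<le> C * (1 + norm x) powr - real DIM('a)"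
proof -
  have "\<exists>C. frac_grad_test s (\<lambda>z. \<Phi> z \<bullet> b) \<in> borel_measurable borel \<and> (\<forall>x. norm (frac_grad_test s (\<lambda>z. \<Phi> z \<bullet> b) x) \<le> C * (1 + norm x) powr - real DIM('a))" for b
  proof -
    obtain R M where "bounded_test_function (\<lambda>z. \<Phi> z \<bullet> b) R M" by (rule test_function_bounds[OF test_function_component[OF \<Phi>]])
    then interpret bounded_test_function "\<lambda>z. \<Phi> z \<bullet> b" R M .
    show ?thesis using frac_grad_test_decay s frac_grad_test_measurable by metis
  qed
  then obtain C where C: "\<And>b. frac_grad_test s (\<lambda>z. \<Phi> z \<bullet> b) \<in> borel_measurable borel"
    "\<And>b x. norm (frac_grad_test s (\<lambda>z. \<Phi> z \<bullet> b) x) \<le> C b * (1 + norm x) powr - real DIM('a)"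
    by metis
  have "norm (frac_div_test s \<Phi> x) \<le> (\<Sum>b\<in>Basis. C b) * (1 + norm x) powr - real DIM('a)" for x
    unfolding frac_div_test_def sum_distrib_right
  proof (rule order_trans[OF norm_sum sum_mono])
    fix b :: 'a assume "b \<in> Basis"
    then have "norm (frac_grad_test s (\<lambda>z. \<Phi> z \<bullet> b) x \<bullet> b) \<le> norm (frac_grad_test s (\<lambda>z. \<Phi> z \<bullet> b) x)"
      using Basis_le_norm by auto
    then show "norm (frac_grad_test s (\<lambda>z. \<Phi> z \<bullet> b) x \<bullet> b) \<le> C b * (1 + norm x) powr - real DIM('a)"
      using C(2)[of b x] by linarith
  qed
  moreover have "frac_div_test s \<Phi> \<in> borel_measurable borel"
    unfolding frac_div_test_def[abs_def] by (intro borel_measurable_sum borel_measurable_inner C(1) borel_measurable_const)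
  ultimately show thesis by (intro that)
qed

lemma Lp_frac_div_integrable:
  fixes u :: "'a::euclidean_space \<Rightarrow> real"
  assumes "1 < p" "u \<in> Lp p" "s \<in> {0..1}" "\<Phi> \<in> test_functions UNIV"
  shows "integrable lebesgue (\<lambda>x. u x * frac_div_test s \<Phi> x)"
proof -
  obtain C where "frac_div_test s \<Phi> \<in> borel_measurable borel"
    "\<And>x. norm (frac_div_test s \<Phi> x) \<le> C * (1 + norm x) powr - real DIM('a)"
    by (rule frac_div_test_decay[OF assms(4,3)]) blast
  then show ?thesis by (intro Lp_decay_integrable[OF assms(1,2)])
qed

text \<open>Antisymmetry, applied to each component of the vector field, says that the fractional gradient of a test function
  is also its weak fractional gradient. This places test functions in all the spaces simultaneously.\<close>

lemma has_frac_grad_test: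
  fixes \<phi> :: "'a::euclidean_space \<Rightarrow> real"
  assumes \<phi>: "\<phi> \<in> test_functions \<Omega>" and s: "s \<in> {0..1}"
  shows "has_frac_grad s \<phi> (frac_grad_test s \<phi>)"
  unfolding has_frac_grad_def
proof (intro conjI ballI)
  show "frac_grad_test s \<phi> \<in> L1_loc"
    by (rule Lp_subset_L1_loc[of 2]) (auto intro: frac_grad_test_Lp[OF \<phi> s])
  fix \<Phi> :: "'a \<Rightarrow> 'a" assume \<Phi>: "\<Phi> \<in> test_functions UNIV"
  have int: "integrable lborel (\<lambda>x. f x * (frac_grad_test s g x \<bullet> b))"
    if f: "f \<in> test_functions UNIV" and g: "g \<in> test_functions UNIV" for f g :: "'a \<Rightarrow> real" and b
  proof -
    obtain R M where "bounded_test_function f R M" by (rule test_function_bounds[OF f])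
    then interpret f: bounded_test_function f R M .
    obtain R' M' where "bounded_test_function g R' M'" by (rule test_function_bounds[OF g])
    then interpret g: bounded_test_function g R' M' .
    have [measurable]: "frac_grad_test s g \<in> borel_measurable borel" by (rule g.frac_grad_test_measurable[OF s])
    obtain C where C: "\<And>x. norm (frac_grad_test s g x) \<le> C * (1 + norm x) powr - real DIM('a)" "0 \<le> C"
      using g.frac_grad_test_decay s by metis
    have C1: "norm (frac_grad_test s g x) \<le> C" for x
    proof -
      have "(1 + norm x) powr - real DIM('a) \<le> 1" using powr_mono2'[of "- real DIM('a)" 1 "1 + norm x"] by simp
      from mult_left_mono[OF this C(2)] show ?thesis using C(1)[of x] by simp
    qed
    show ?thesis
    proof (rule integrable_bounded_support[where R=R and K="M * (C * norm b)"])
      show "norm (f x * (frac_grad_test s g x \<bullet> b)) \<le> M * (C * norm b)" for x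
      proof -
        have "\<bar>frac_grad_test s g x \<bullet> b\<bar> \<le> C * norm b"
          using Cauchy_Schwarz_ineq2[of "frac_grad_test s g x" b] mult_right_mono[OF C1[of x] norm_ge_zero[of b]] by linarith
        then show ?thesis using f.bound[of x] f.M0 by (simp add: abs_mult mult_mono)
      qed
    qed (auto simp: f.outside)
  qed
  have \<phi>': "\<phi> \<in> test_functions UNIV" by (rule test_functionD(5)[OF \<phi>])
  note comp = test_function_component[OF \<Phi>]
  have dual: "(\<integral>x. \<phi> x * (frac_grad_test s (\<lambda>z. \<Phi> z \<bullet> b) x \<bullet> b) \<partial>lborel) = - (\<integral>x. (\<Phi> x \<bullet> b) * (frac_grad_test s \<phi> x \<bullet> b) \<partial>lborel)" for b
  proof -
    obtain R M where 1: "bounded_test_function \<phi> R M" by (rule test_function_bounds[OF \<phi>])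
    obtain R' M' where 2: "bounded_test_function (\<lambda>z. \<Phi> z \<bullet> b) R' M'" by (rule test_function_bounds[OF comp])
    show ?thesis by (rule frac_grad_test_duality[OF 1 2 s])
  qed
  have 1: "(\<lambda>x. \<phi> x * frac_div_test s \<Phi> x) = (\<lambda>x. \<Sum>b\<in>Basis. \<phi> x * (frac_grad_test s (\<lambda>z. \<Phi> z \<bullet> b) x \<bullet> b))"
    by (simp add: frac_div_test_def sum_distrib_left)
  have 2: "(\<lambda>x. frac_grad_test s \<phi> x \<bullet> \<Phi> x) = (\<lambda>x. \<Sum>b\<in>Basis. (\<Phi> x \<bullet> b) * (frac_grad_test s \<phi> x \<bullet> b))"
    by (subst euclidean_inner) (simp add: mult.commute)
  have i1: "integrable lborel (\<lambda>x. \<phi> x * frac_div_test s \<Phi> x)" and i2: "integrable lborel (\<lambda>x. frac_grad_test s \<phi> x \<bullet> \<Phi> x)"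
    unfolding 1 2 by (intro Bochner_Integration.integrable_sum int \<phi>' comp)+
  have "(\<integral>x. \<phi> x * frac_div_test s \<Phi> x \<partial>lebesgue) = (\<integral>x. \<phi> x * frac_div_test s \<Phi> x \<partial>lborel)"
    by (rule integral_completion) (rule borel_measurable_integrable[OF i1])
  also have "\<dots> = (\<Sum>b\<in>Basis. \<integral>x. \<phi> x * (frac_grad_test s (\<lambda>z. \<Phi> z \<bullet> b) x \<bullet> b) \<partial>lborel)"
    unfolding 1 by (intro Bochner_Integration.integral_sum int \<phi>' comp)
  also have "\<dots> = - (\<Sum>b\<in>Basis. \<integral>x. (\<Phi> x \<bullet> b) * (frac_grad_test s \<phi> x \<bullet> b) \<partial>lborel)"
    by (simp add: dual sum_negf)
  also have "(\<Sum>b\<in>Basis. \<integral>x. (\<Phi> x \<bullet> b) * (frac_grad_test s \<phi> x \<bullet> b) \<partial>lborel) = (\<integral>x. frac_grad_test s \<phi> x \<bullet> \<Phi> x \<partial>lborel)"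
    unfolding 2 by (intro Bochner_Integration.integral_sum[symmetric] int \<phi>' comp)
  also have "\<dots> = (\<integral>x. frac_grad_test s \<phi> x \<bullet> \<Phi> x \<partial>lebesgue)"
    by (rule integral_completion[symmetric]) (rule borel_measurable_integrable[OF i2])
  finally show "(\<integral>x. \<phi> x * frac_div_test s \<Phi> x \<partial>lebesgue) = - (\<integral>x. frac_grad_test s \<phi> x \<bullet> \<Phi> x \<partial>lebesgue)" .
qed

text \<open>Linearity is not automatic: with a non-integrable product the integral defaults to zero. Integrability follows
  from \<open>u \<in> Lp p\<close> and the decay of the fractional divergence.\<close>

lemma has_frac_grad_diff:
  fixes u v :: "'a::euclidean_space \<Rightarrow> real"
  assumes p: "1 < p" and s: "s \<in> {0..1}" and u: "u \<in> Lp p" "has_frac_grad s u G" and v: "v \<in> Lp p" "has_frac_grad s v H"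
  shows "has_frac_grad s (\<lambda>x. u x - v x) (\<lambda>x. G x - H x)"
  unfolding has_frac_grad_def
proof (intro conjI ballI)
  have GH: "G \<in> L1_loc" "H \<in> L1_loc" using u v by (auto simp: has_frac_grad_def)
  then show "(\<lambda>x. G x - H x) \<in> L1_loc" by (auto simp: L1_loc_def)
  fix \<Phi> :: "'a \<Rightarrow> 'a" assume \<Phi>: "\<Phi> \<in> test_functions UNIV"
  have "(\<integral>x. (u x - v x) * frac_div_test s \<Phi> x \<partial>lebesgue) = (\<integral>x. u x * frac_div_test s \<Phi> x \<partial>lebesgue) - (\<integral>x. v x * frac_div_test s \<Phi> x \<partial>lebesgue)"
    using Lp_frac_div_integrable[OF p u(1) s \<Phi>] Lp_frac_div_integrable[OF p v(1) s \<Phi>]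
    by (simp add: left_diff_distrib)
  also have "\<dots> = - ((\<integral>x. G x \<bullet> \<Phi> x \<partial>lebesgue) - (\<integral>x. H x \<bullet> \<Phi> x \<partial>lebesgue))"
    using u v \<Phi> by (simp add: has_frac_grad_def)
  also have "\<dots> = - (\<integral>x. (G x - H x) \<bullet> \<Phi> x \<partial>lebesgue)"
    using L1_loc_test_integrable[OF GH(1) \<Phi>] L1_loc_test_integrable[OF GH(2) \<Phi>]
    by (simp add: inner_diff_left)
  finally show "(\<integral>x. (u x - v x) * frac_div_test s \<Phi> x \<partial>lebesgue) = - (\<integral>x. (G x - H x) \<bullet> \<Phi> x \<partial>lebesgue)" .
qed

lemma has_frac_grad_frac_grad: "has_frac_grad s u G \<Longrightarrow> has_frac_grad s u (frac_grad s u)"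
  unfolding frac_grad_def by (rule someI[of "has_frac_grad s u"])

lemma frac_grad_AE_eq: "has_frac_grad s u G \<Longrightarrow> AE x in lebesgue. frac_grad s u x = G x"
  by (rule has_frac_grad_unique[OF has_frac_grad_frac_grad])

lemma Lp_cong_AE:
  fixes f g :: "'a::euclidean_space \<Rightarrow> 'b::euclidean_space"
  assumes f: "f \<in> Lp p" and ae: "AE x in lebesgue. f x = g x"
  shows "g \<in> Lp p"
proof -
  have g: "g \<in> borel_measurable lebesgue" using f ae by (auto simp: Lp_def intro: borel_measurable_AE)
  have "integrable lebesgue (\<lambda>x. norm (g x) powr p)"
  proof (rule integrable_cong_AE_imp)
    show "integrable lebesgue (\<lambda>x. norm (f x) powr p)" using f by (simp add: Lp_def)
    show "(\<lambda>x. norm (g x) powr p) \<in> borel_measurable lebesgue" using g by measurable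
    show "AE x in lebesgue. norm (f x) powr p = norm (g x) powr p" using ae by eventually_elim simp
  qed
  with g show ?thesis by (simp add: Lp_def)
qed

lemma frac_grad_Lp:
  assumes "u \<in> Lambda s p"
  shows "frac_grad s u \<in> Lp p" "has_frac_grad s u (frac_grad s u)"
proof -
  obtain G where G: "G \<in> Lp p" "has_frac_grad s u G" using assms by (auto simp: Lambda_def)
  show "has_frac_grad s u (frac_grad s u)" by (rule has_frac_grad_frac_grad[OF G(2)])
  show "frac_grad s u \<in> Lp p" using frac_grad_AE_eq[OF G(2)] by (intro Lp_cong_AE[OF G(1)]) (auto simp: eq_commute)
qed

lemma test_function_Lambda:
  fixes \<phi> :: "'a::euclidean_space \<Rightarrow> real"
  assumes "\<phi> \<in> test_functions \<Omega>" "s \<in> {0..1}" "1 < p"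
  shows "\<phi> \<in> Lambda s p"
  unfolding Lambda_def using test_function_Lp frac_grad_test_Lp has_frac_grad_test assms by blast

lemma Lp_norm_powr:
  assumes "1 < p"
  shows "Lp_norm p u powr p = (\<integral>x. norm (u x) powr p \<partial>lebesgue)"
  using assms by (simp add: Lp_norm_def powr_powr)

lemma Lp_integral_cong_AE:
  fixes f g :: "'a::euclidean_space \<Rightarrow> 'b::euclidean_space"
  assumes "f \<in> borel_measurable lebesgue" "g \<in> borel_measurable lebesgue" "AE x in lebesgue. f x = g x"
  shows "(\<integral>x. norm (f x) powr p \<partial>lebesgue) = (\<integral>x. norm (g x) powr p \<partial>lebesgue)"
proof (rule integral_cong_AE)
  show "AE x in lebesgue. norm (f x) powr p = norm (g x) powr p" using assms(3) by eventually_elim simp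
qed (use assms(1,2) in measurable)

text \<open>A quasi-triangle inequality for \<open>p\<close>-th powers is enough for convergence statements and avoids roots.\<close>

lemma norm_add_powr_le:
  fixes a b :: "'b::real_normed_vector"
  assumes "1 < p"
  shows "norm (a + b) powr p \<le> 2 powr p * (norm a powr p + norm b powr p)"
proof -
  have "norm (a + b) powr p \<le> (2 * max (norm a) (norm b)) powr p"
    using norm_triangle_ineq[of a b] assms by (intro powr_mono2) auto
  also have "\<dots> = 2 powr p * max (norm a) (norm b) powr p" by (simp add: powr_mult)
  also have "max (norm a) (norm b) powr p \<le> norm a powr p + norm b powr p" by (auto simp: max_def)
  finally show ?thesis by simp
qed

lemma Lp_add_integrable:
  fixes f g :: "'a::euclidean_space \<Rightarrow> 'b::euclidean_space"
  assumes p: "1 < p" and f: "f \<in> Lp p" and g: "g \<in> Lp p"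
  shows "(\<lambda>x. f x + g x) \<in> Lp p"
    and "(\<integral>x. norm (f x + g x) powr p \<partial>lebesgue) \<le> 2 powr p * ((\<integral>x. norm (f x) powr p \<partial>lebesgue) + (\<integral>x. norm (g x) powr p \<partial>lebesgue))"
proof -
  have [measurable]: "f \<in> borel_measurable lebesgue" "g \<in> borel_measurable lebesgue"
    and i: "integrable lebesgue (\<lambda>x. norm (f x) powr p)" "integrable lebesgue (\<lambda>x. norm (g x) powr p)"
    using f g by (auto simp: Lp_def)
  have b: "integrable lebesgue (\<lambda>x. 2 powr p * (norm (f x) powr p + norm (g x) powr p))" using i by simp
  have s: "integrable lebesgue (\<lambda>x. norm (f x + g x) powr p)"
    by (rule Bochner_Integration.integrable_bound[OF b]) (use norm_add_powr_le[OF p] in \<open>auto intro!: AE_I2 order_trans[OF _ abs_ge_self]\<close>)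
  then show "(\<lambda>x. f x + g x) \<in> Lp p" by (simp add: Lp_def)
  have "(\<integral>x. norm (f x + g x) powr p \<partial>lebesgue) \<le> (\<integral>x. 2 powr p * (norm (f x) powr p + norm (g x) powr p) \<partial>lebesgue)"
    by (intro integral_mono s b norm_add_powr_le p)
  then show "(\<integral>x. norm (f x + g x) powr p \<partial>lebesgue) \<le> 2 powr p * ((\<integral>x. norm (f x) powr p \<partial>lebesgue) + (\<integral>x. norm (g x) powr p \<partial>lebesgue))"
    using i by simp
qed

lemma Lp_diff:
  fixes f g :: "'a::euclidean_space \<Rightarrow> 'b::euclidean_space"
  assumes p: "1 < p" and f: "f \<in> Lp p" and g: "g \<in> Lp p"
  shows "(\<lambda>x. f x - g x) \<in> Lp p"
proof -
  have "(\<lambda>x. - g x) \<in> Lp p" using g by (simp add: Lp_def)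
  from Lp_add_integrable(1)[OF p f this] show ?thesis by simp
qed

section \<open>Approximation in the spaces that vanish outside an open set\<close>

lemma test_function_Lambda0:
  fixes \<phi> :: "'a::euclidean_space \<Rightarrow> real"
  assumes \<phi>: "\<phi> \<in> test_functions \<Omega>" and s: "s \<in> {0..1}" and p: "1 < p"
  shows "\<phi> \<in> Lambda0 s p \<Omega>"
proof -
  have "has_frac_grad s (\<lambda>x::'a. 0) (\<lambda>x. 0)"
    by (auto simp: has_frac_grad_def L1_loc_def set_integrable_def)
  then have "AE x in lebesgue. frac_grad s (\<lambda>x::'a. 0) x = 0" by (rule frac_grad_AE_eq)
  then have "AE x in lebesgue. norm (frac_grad s (\<lambda>x::'a. 0) x) powr p = 0" by eventually_elim simp
  then have "(\<integral>x. norm (frac_grad s (\<lambda>x::'a. 0) x) powr p \<partial>lebesgue) = 0" by (rule integral_eq_zero_AE)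
  then have z: "Lambda_norm s p (\<lambda>x. \<phi> x - \<phi> x) = 0"
    using p by (simp add: Lambda_norm_def Lp_norm_powr)
  have "\<exists>\<psi>\<in>test_functions \<Omega>. Lambda_norm s p (\<lambda>x. \<phi> x - \<psi> x) < \<epsilon>" if "0 < \<epsilon>" for \<epsilon>
    by (rule bexI[of _ \<phi>]) (simp_all only: z \<phi> that)
  then show ?thesis
    using test_function_Lambda[OF \<phi> s p] by (simp add: Lambda0_def)
qed

text \<open>The norm of \<open>Lambda0\<close> rewritten with \<open>p\<close>-th powers and with the concrete fractional gradient of the approximating
  test function.\<close>

lemma Lambda0_approx:
  fixes u :: "'a::euclidean_space \<Rightarrow> real"
  assumes u: "u \<in> Lambda0 s p \<Omega>" and s: "s \<in> {0..1}" and p: "1 < p" and \<epsilon>: "0 < \<epsilon>"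
  obtains \<phi> where "\<phi> \<in> test_functions \<Omega>"
    "(\<integral>x. norm (\<phi> x - u x) powr p \<partial>lebesgue) + (\<integral>x. norm (frac_grad_test s \<phi> x - frac_grad s u x) powr p \<partial>lebesgue) < \<epsilon>"
proof -
  have "0 < \<epsilon> powr (1 / p)" using \<epsilon> by simp
  then obtain \<phi> where \<phi>: "\<phi> \<in> test_functions \<Omega>" and lt: "Lambda_norm s p (\<lambda>x. u x - \<phi> x) < \<epsilon> powr (1 / p)"
    using u unfolding Lambda0_def by blast
  have uL: "u \<in> Lambda s p" using u by (simp add: Lambda0_def)
  then have uLp: "u \<in> Lp p" by (simp add: Lambda_def)
  let ?w = "\<lambda>x. u x - \<phi> x"
  have h: "has_frac_grad s ?w (\<lambda>x. frac_grad s u x - frac_grad_test s \<phi> x)"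
    by (rule has_frac_grad_diff[OF p s uLp frac_grad_Lp(2)[OF uL] test_function_Lp[OF \<phi> p] has_frac_grad_test[OF \<phi> s]])
  have d: "(\<lambda>x. frac_grad s u x - frac_grad_test s \<phi> x) \<in> Lp p"
    by (rule Lp_diff[OF p frac_grad_Lp(1)[OF uL] frac_grad_test_Lp[OF \<phi> s p]])
  have "frac_grad s ?w \<in> Lp p"
    using frac_grad_AE_eq[OF h] by (intro Lp_cong_AE[OF d]) (auto simp: eq_commute)
  with d have m: "frac_grad s ?w \<in> borel_measurable lebesgue" "(\<lambda>x. frac_grad s u x - frac_grad_test s \<phi> x) \<in> borel_measurable lebesgue"
    by (auto simp: Lp_def)
  have "(\<integral>x. norm (frac_grad s ?w x) powr p \<partial>lebesgue) = (\<integral>x. norm (frac_grad_test s \<phi> x - frac_grad s u x) powr p \<partial>lebesgue)"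
    using Lp_integral_cong_AE[OF m frac_grad_AE_eq[OF h], of p] by (simp add: norm_minus_commute)
  moreover define S where "S = (\<integral>x. norm (\<phi> x - u x) powr p \<partial>lebesgue) + (\<integral>x. norm (frac_grad_test s \<phi> x - frac_grad s u x) powr p \<partial>lebesgue)"
  ultimately have "Lambda_norm s p ?w = S powr (1 / p)"
    using p by (simp add: Lambda_norm_def Lp_norm_powr norm_minus_commute abs_minus_commute)
  then have "\<not> \<epsilon> \<le> S"
    using lt powr_mono2[of "1 / p" \<epsilon> S] p \<epsilon> by auto
  then have "(\<integral>x. norm (\<phi> x - u x) powr p \<partial>lebesgue) + (\<integral>x. norm (frac_grad_test s \<phi> x - frac_grad s u x) powr p \<partial>lebesgue) < \<epsilon>"
    by (simp add: S_def)
  with \<phi> show thesis by (rule that)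
qed

text \<open>Approximating test functions vanish outside \<open>\<Omega>\<close>, so the integral of \<open>\<bar>u\<bar> powr p\<close> over the complement is at most
  every positive number.\<close>

lemma Lambda0_Lp0:
  fixes u :: "'a::euclidean_space \<Rightarrow> real"
  assumes u: "u \<in> Lambda0 s p \<Omega>" and s: "s \<in> {0..1}" and p: "1 < p" and \<Omega>: "open \<Omega>"
  shows "u \<in> Lp0 p \<Omega>"
proof -
  have uLp: "u \<in> Lp p" using u by (simp add: Lambda0_def Lambda_def)
  let ?v = "\<lambda>x. indicat_real (- \<Omega>) x * norm (u x) powr p"
  have [measurable]: "u \<in> borel_measurable lebesgue" using uLp by (simp add: Lp_def)
  have \<Omega>'[measurable]: "- \<Omega> \<in> sets lebesgue" using \<Omega> by auto
  have i: "integrable lebesgue ?v"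
    using integrable_mult_indicator[OF \<Omega>', of "\<lambda>x. norm (u x) powr p"] uLp by (simp add: Lp_def)
  have "(\<integral>x. ?v x \<partial>lebesgue) \<le> 0 + \<epsilon>" if \<epsilon>: "0 < \<epsilon>" for \<epsilon>
  proof -
    obtain \<phi> where \<phi>: "\<phi> \<in> test_functions \<Omega>"
     "(\<integral>x. norm (\<phi> x - u x) powr p \<partial>lebesgue) + (\<integral>x. norm (frac_grad_test s \<phi> x - frac_grad s u x) powr p \<partial>lebesgue) < \<epsilon>"
      by (rule Lambda0_approx[OF u s p \<epsilon>])
    have "(\<integral>x. ?v x \<partial>lebesgue) \<le> (\<integral>x. norm (\<phi> x - u x) powr p \<partial>lebesgue)"
    proof (rule integral_mono[OF i])
      show "integrable lebesgue (\<lambda>x. norm (\<phi> x - u x) powr p)"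
        using Lp_diff[OF p test_function_Lp[OF \<phi>(1) p] uLp] by (simp add: Lp_def)
      fix x
      have "\<phi> x = 0" if "x \<notin> \<Omega>" using \<phi>(1) that closure_subset[of "{x. \<phi> x \<noteq> 0}"] by (auto simp: test_functions_def)
      then show "?v x \<le> norm (\<phi> x - u x) powr p" by (auto simp: indicator_def)
    qed
    moreover have "0 \<le> (\<integral>x. norm (frac_grad_test s \<phi> x - frac_grad s u x) powr p \<partial>lebesgue)" by simp
    ultimately show ?thesis using \<phi>(2) by linarith
  qed
  then have "(\<integral>x. ?v x \<partial>lebesgue) \<le> 0" by (rule field_le_epsilon)
  moreover have "0 \<le> (\<integral>x. ?v x \<partial>lebesgue)" by simp
  ultimately have "(\<integral>x. ?v x \<partial>lebesgue) = 0" by linarith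
  then have "AE x in lebesgue. ?v x = 0" 
    by (subst (asm) integral_nonneg_eq_0_iff_AE[OF i]) auto
  then have "AE x in lebesgue. x \<notin> \<Omega> \<longrightarrow> u x = 0"
    by eventually_elim (auto simp: indicator_def)
  with uLp show ?thesis by (simp add: Lp0_def)
qed

text \<open>The diagonal argument: instead of choosing a subsequence of approximations, take for each \<open>n\<close> an element whose
  error at stage \<open>n\<close> is within \<open>1 / (n + 1)\<close> of the best possible one.\<close>

lemma near_minimisers_tendsto_0:
  fixes E :: "nat \<Rightarrow> 'b \<Rightarrow> real"
  assumes nonneg: "\<And>n \<phi>. 0 \<le> E n \<phi>"
    and small: "\<And>\<epsilon>. 0 < \<epsilon> \<Longrightarrow> \<exists>\<phi>\<in>T. \<forall>\<^sub>F n in sequentially. E n \<phi> < \<epsilon>"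
  obtains v where "\<And>n. v n \<in> T" "(\<lambda>n. E n (v n)) \<longlonglongrightarrow> 0"
proof -
  have T: "T \<noteq> {}" using small[of 1] by auto
  have bdd: "bdd_below (E n ` T)" for n using nonneg by (intro bdd_belowI[of _ 0]) auto
  have "\<exists>\<phi>\<in>T. E n \<phi> < (INF \<phi>\<in>T. E n \<phi>) + inverse (real (Suc n))" for n
    using cInf_lessD[of "E n ` T" "(INF \<phi>\<in>T. E n \<phi>) + inverse (real (Suc n))"] T by auto
  then obtain v where v: "\<And>n. v n \<in> T" "\<And>n. E n (v n) < (INF \<phi>\<in>T. E n \<phi>) + inverse (real (Suc n))" by metis
  have "(\<lambda>n. E n (v n)) \<longlonglongrightarrow> 0"
  proof (rule LIMSEQ_I)
    fix \<epsilon> :: real assume \<epsilon>: "0 < \<epsilon>"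
    then obtain \<phi> where \<phi>: "\<phi> \<in> T" "\<forall>\<^sub>F n in sequentially. E n \<phi> < \<epsilon> / 2" using small[of "\<epsilon> / 2"] by auto
    have "\<forall>\<^sub>F n in sequentially. inverse (real (Suc n)) < \<epsilon> / 2"
      using \<epsilon> by (intro order_tendstoD(2)[OF LIMSEQ_inverse_real_of_nat]) auto
    with \<phi>(2) have "\<forall>\<^sub>F n in sequentially. E n (v n) < \<epsilon>"
    proof eventually_elim
      fix n assume "E n \<phi> < \<epsilon> / 2" "inverse (real (Suc n)) < \<epsilon> / 2"
      moreover have "(INF \<phi>\<in>T. E n \<phi>) \<le> E n \<phi>" by (rule cINF_lower[OF bdd \<phi>(1)])
      ultimately show "E n (v n) < \<epsilon>" using v(2)[of n] by linarith
    qed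
    then show "\<exists>no. \<forall>n\<ge>no. norm (E n (v n) - 0) < \<epsilon>"
      using nonneg by (simp add: eventually_sequentially)
  qed
  with v(1) show thesis by (rule that)
qed

text \<open>One fixed test function is close to \<open>u\<close> at the order \<open>\<sigma>\<close>, and its fractional gradients at the orders \<open>s n\<close> converge
  to the one at \<open>\<sigma>\<close>.\<close>

lemma test_function_recovery:
  fixes u :: "'a::euclidean_space \<Rightarrow> real"
  assumes u: "u \<in> Lambda0 \<sigma> p \<Omega>" and p: "1 < p" 
    and s: "\<And>n. s n \<in> {0..1}" "\<sigma> \<in> {0..1}" "s \<longlonglongrightarrow> \<sigma>" and \<epsilon>: "0 < \<epsilon>"
  shows "\<exists>\<phi>\<in>test_functions \<Omega>. \<forall>\<^sub>F n in sequentially.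
    (\<integral>x. norm (\<phi> x - u x) powr p \<partial>lebesgue) + (\<integral>x. norm (frac_grad (s n) \<phi> x - frac_grad \<sigma> u x) powr p \<partial>lebesgue) < \<epsilon>"
proof -
  \<comment> \<open>the constant of the quasi-triangle inequality for \<open>p\<close>-th powers\<close>
  define c where "c = 2 powr p"
  have c: "1 \<le> c" using p ge_one_powr_ge_zero[of 2 p] by (simp add: c_def)
  have "0 < \<epsilon> / (2 * c)" using \<epsilon> c by simp
  then obtain \<phi> where \<phi>: "\<phi> \<in> test_functions \<Omega>"
    "(\<integral>x. norm (\<phi> x - u x) powr p \<partial>lebesgue) + (\<integral>x. norm (frac_grad_test \<sigma> \<phi> x - frac_grad \<sigma> u x) powr p \<partial>lebesgue) < \<epsilon> / (2 * c)"
    by (rule Lambda0_approx[OF u s(2) p])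
  let ?A = "\<integral>x. norm (\<phi> x - u x) powr p \<partial>lebesgue"
  let ?B = "\<integral>x. norm (frac_grad_test \<sigma> \<phi> x - frac_grad \<sigma> u x) powr p \<partial>lebesgue"
  let ?D = "\<lambda>n. \<integral>x. norm (frac_grad_test (s n) \<phi> x - frac_grad_test \<sigma> \<phi> x) powr p \<partial>lebesgue"
  have uL: "u \<in> Lambda \<sigma> p" using u by (simp add: Lambda0_def)
  note Lps = frac_grad_Lp(1)[OF uL] frac_grad_test_Lp[OF \<phi>(1) s(2) p] frac_grad_test_Lp[OF \<phi>(1) s(1) p]
    frac_grad_Lp(1)[OF test_function_Lambda[OF \<phi>(1) s(1) p]]
  have le: "(\<integral>x. norm (frac_grad (s n) \<phi> x - frac_grad \<sigma> u x) powr p \<partial>lebesgue) \<le> c * (?D n + ?B)" for n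
  proof -
    have ae: "AE x in lebesgue. frac_grad (s n) \<phi> x - frac_grad \<sigma> u x = frac_grad_test (s n) \<phi> x - frac_grad \<sigma> u x"
      using frac_grad_AE_eq[OF has_frac_grad_test[OF \<phi>(1) s(1)[of n]]] by eventually_elim simp
    have "(\<integral>x. norm (frac_grad (s n) \<phi> x - frac_grad \<sigma> u x) powr p \<partial>lebesgue) = 
       (\<integral>x. norm (frac_grad_test (s n) \<phi> x - frac_grad \<sigma> u x) powr p \<partial>lebesgue)"
      using Lp_diff[OF p Lps(4) Lps(1), of n] Lp_diff[OF p Lps(3) Lps(1), of n]
      by (intro Lp_integral_cong_AE ae) (auto simp: Lp_def)
    also have "\<dots> \<le> c * (?D n + ?B)"
      using Lp_add_integrable(2)[OF p Lp_diff[OF p Lps(3) Lps(2), of n] Lp_diff[OF p Lps(2) Lps(1)]] by (simp add: c_def)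
    finally show ?thesis .
  qed
  have "\<forall>\<^sub>F n in sequentially. ?D n < \<epsilon> / (2 * c)"
    using \<open>0 < \<epsilon> / (2 * c)\<close> by (intro order_tendstoD(2)[OF frac_grad_test_Lp_tendsto[OF \<phi>(1) p s]])
  then have "\<forall>\<^sub>F n in sequentially. ?A + (\<integral>x. norm (frac_grad (s n) \<phi> x - frac_grad \<sigma> u x) powr p \<partial>lebesgue) < \<epsilon>"
  proof eventually_elim
    fix n assume D: "?D n < \<epsilon> / (2 * c)"
    have "0 \<le> ?A" by simp
    have "?A + (\<integral>x. norm (frac_grad (s n) \<phi> x - frac_grad \<sigma> u x) powr p \<partial>lebesgue) \<le> c * ?A + c * (?D n + ?B)"
      using le[of n] mult_right_mono[OF c \<open>0 \<le> ?A\<close>] by linarith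
    also have "\<dots> = c * (?D n + (?A + ?B))" by (simp add: algebra_simps)
    also have "\<dots> < c * (\<epsilon> / (2 * c) + \<epsilon> / (2 * c))"
      using D \<phi>(2) c by (intro mult_strict_left_mono add_strict_mono) auto
    also have "\<dots> = \<epsilon>" using c by (simp add: field_simps)
    finally show "?A + (\<integral>x. norm (frac_grad (s n) \<phi> x - frac_grad \<sigma> u x) powr p \<partial>lebesgue) < \<epsilon>" .
  qed
  with \<phi>(1) show ?thesis by blast
qed

theorem theorem5p1:
  fixes \<Omega> :: "'a::euclidean_space set" and p \<sigma> :: real and s :: "nat \<Rightarrow> real"
  assumes "open \<Omega>" and "1 < p"
    and "\<And>n. s n \<in> {0..1}" and "\<sigma> \<in> {0..1}" and "s \<longlonglongrightarrow> \<sigma>"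
  shows "mosco_converges p \<Omega> s \<sigma> (\<lambda>n. Lambda0 (s n) p \<Omega>) (Lambda0 \<sigma> p \<Omega>)"
  unfolding mosco_converges_def
proof (intro conjI ballI allI impI)
  fix u assume u: "u \<in> Lambda0 \<sigma> p \<Omega>"
  define E where "E n \<phi> = (\<integral>x. norm (\<phi> x - u x) powr p \<partial>lebesgue) + 
    (\<integral>x. norm (frac_grad (s n) \<phi> x - frac_grad \<sigma> u x) powr p \<partial>lebesgue)" for n \<phi>
  obtain v where v: "\<And>n. v n \<in> test_functions \<Omega>" "(\<lambda>n. E n (v n)) \<longlonglongrightarrow> 0"
  proof (rule near_minimisers_tendsto_0[of E "test_functions \<Omega>"])
    show "0 \<le> E n \<phi>" for n \<phi> by (simp add: E_def)
    show "\<exists>\<phi>\<in>test_functions \<Omega>. \<forall>\<^sub>F n in sequentially. E n \<phi> < \<epsilon>" if "0 < \<epsilon>" for \<epsilon>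
      unfolding E_def by (rule test_function_recovery[OF u assms(2-5) that])
  qed blast
  have v0: "v n \<in> Lambda0 (s n) p \<Omega>" for n by (rule test_function_Lambda0[OF v(1) assms(3,2)])
  have LL: "Pi_s t w \<in> LL p \<Omega>" if w: "w \<in> Lambda0 t p \<Omega>" and t: "t \<in> {0..1}" for t w
    using Lambda0_Lp0[OF w t assms(2,1)] frac_grad_Lp(1)[of w t p] w by (simp add: Pi_s_def LL_def Lambda0_def)
  have "(\<lambda>n. E n (v n) powr (1 / p)) \<longlonglongrightarrow> 0"
    using assms(2) by (intro tendsto_zero_powrI[OF v(2) tendsto_const]) (auto simp: E_def)
  then have "LL_tendsto p \<Omega> (\<lambda>n. Pi_s (s n) (v n)) (Pi_s \<sigma> u)"
    unfolding LL_tendsto_def using LL[OF v0 assms(3)] LL[OF u assms(4)] assms(2)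
    by (simp add: LL_norm_def Lp_norm_powr Pi_s_def E_def)
  with v0 show "\<exists>v. (\<forall>n. v n \<in> Lambda0 (s n) p \<Omega>) \<and> LL_tendsto p \<Omega> (\<lambda>n. Pi_s (s n) (v n)) (Pi_s \<sigma> u)" by blast
qed

end
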